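(* Let $x \ge 2$ be a real number and let $q$ and $a$ be positive, coprime integers. Then $$\sum_{\substack{p \le x \\ p \equiv a \bmod q}} \log\left(1 - \frac{1}{p}\right)^{-1} = \phi(q)^{-1}(\gamma + \log\log x) + \log G(q,a) + x^{-1}E(x;q,a) - \int_x^{\infty} t^{-2}E(t;q,a)\, dt + O\left((x\log x)^{-1}\right),$$ where the implicit constant is absolute (independent of $x$, $q$ and $a$).
   Context: Here $p$ always denotes a prime, $\nu$ a positive integer, $\phi$ is Euler's totient function, $\gamma$ is the Euler-Mascheroni constant. Let $\mathrm{li}(t) = \int_2^t \frac{du}{\log u}$, $\pi(t;q,a) = \#\{p \le t : p \equiv a \bmod q\}$, and $E(t;q,a) = \pi(t;q,a) - \phi(q)^{-1}\mathrm{li}(t)$. For Dirichlet characters $\chi$ modulo $q$ ($\chi_0$ being the principal one), $L(s,\chi)$ is the Dirichlet $L$-function. Powers and logarithms of $L$-functions are branches (in $s$) normalised by the Euler product for $s>1$ (so $\log L(s,\chi)\to 0$ as $s \to+\infty$), continued to $s=1$. Let $\mathcal{L}(q,a)$ be the positive real number with $$\mathcal{L}(q,a)^{\phi(q)} = \frac{\phi(q)}{q}\prod_{\chi \ne \chi_0} L(1,\chi)^{\bar{\chi}(a)},$$ the product being over the non-principal Dirichlet characters modulo $q$, and let $$G(q,a) = \mathcal{L}(q,a)\cdot\exp\Bigl\{\sum_{p \equiv a \bmod q}\sum_{\nu \ge 2}\frac{1}{\nu p^{\nu}} - \sum_{\substack{p,\ \nu \ge 2 \\ p^{\nu} \equiv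 a \bmod q}} \frac{1}{\nu p^{\nu}}\Bigr\}.$$ *)

theory Defs
  imports "HOL-Analysis.Analysis" "HOL-Number_Theory.Number_Theory"
begin

definition log_integral :: "real \<Rightarrow> real" where
  "log_integral t = integral {2..t} (\<lambda>u. 1 / ln u)"

definition prime_count_ap :: "real \<Rightarrow> nat \<Rightarrow> nat \<Rightarrow> nat" where
  "prime_count_ap t q a = card {p. prime p \<and> real p \<le> t \<and> [p = a] (mod q)}"

definition prime_error_ap :: "real \<Rightarrow> nat \<Rightarrow> nat \<Rightarrow> real" where
  "prime_error_ap t q a =
     real (prime_count_ap t q a) - inverse (real (totient q)) * log_integral t"

definition dirichlet_character :: "nat \<Rightarrow> (nat \<Rightarrow> complex) \<Rightarrow> bool" where
  "dirichlet_character q chi \<longleftrightarrow>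
     (\<forall>n. chi (n + q) = chi n) \<and>
     (\<forall>m n. chi (m * n) = chi m * chi n) \<and>
     (\<forall>n. chi n = 0 \<longleftrightarrow> \<not> coprime n q)"

definition principal_character :: "nat \<Rightarrow> nat \<Rightarrow> complex" where
  "principal_character q n = (if coprime n q then 1 else 0)"

(* The series converges for Re s > 1, and for Re s > 0 if the character is
   non-principal (conditionally, hence the ordered sum); only real s >= 1 and
   non-principal characters are used below. *)
definition dirichlet_L :: "(nat \<Rightarrow> complex) \<Rightarrow> complex \<Rightarrow> complex" where
  "dirichlet_L chi s = (\<Sum>n. chi (Suc n) / of_nat (Suc n) powr s)"

(* Value at s >= 1 of the continuous branch on [1, \<infinity>) of log L(s, chi) that tends
   to 0 as s \<rightarrow> \<infinity>.  For s > 1 this is the logarithm given by the Euler product;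
   it need not agree with the principal value Ln of L(s, chi). *)
definition log_dirichlet_L :: "(nat \<Rightarrow> complex) \<Rightarrow> real \<Rightarrow> complex" where
  "log_dirichlet_L chi s = (THE z. \<exists>f. continuous_on {1..} f \<and>
     (\<forall>t\<ge>1. exp (f t) = dirichlet_L chi (of_real t)) \<and>
     (f \<longlongrightarrow> 0) at_top \<and> z = f s)"

definition dirichlet_L_power :: "(nat \<Rightarrow> complex) \<Rightarrow> real \<Rightarrow> complex \<Rightarrow> complex" where
  "dirichlet_L_power chi s w = exp (w * log_dirichlet_L chi s)"

definition mertens_L :: "nat \<Rightarrow> nat \<Rightarrow> real" where
  "mertens_L q a = (THE r. r > 0 \<and>
     complex_of_real (r ^ totient q) =
       of_nat (totient q) / of_nat q *
       (\<Prod>chi | dirichlet_character q chi \<and> chi \<noteq> principal_character q.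
          dirichlet_L_power chi 1 (cnj (chi a))))"

definition mertens_G :: "nat \<Rightarrow> nat \<Rightarrow> real" where
  "mertens_G q a = mertens_L q a *
     exp ((\<Sum>\<^sub>\<infinity>p\<in>{p. prime p \<and> [p = a] (mod q)}.
             \<Sum>\<^sub>\<infinity>\<nu>\<in>{2..}. 1 / (real \<nu> * real p ^ \<nu>))
        - (\<Sum>\<^sub>\<infinity>(p, \<nu>)\<in>{(p, \<nu>). prime p \<and> \<nu> \<ge> 2 \<and> [p ^ \<nu> = a] (mod q)}.
             1 / (real \<nu> * real p ^ \<nu>)))"

end

theory Submission
  imports Defs "HOL-Number_Theory.Prime_Powers" "HOL-Real_Asymp.Real_Asymp"
begin

text \<open>
  Write \<open>-ln (1 - 1/p) = 1/p + r(p)\<close> with \<open>r(p) = \<Sum>\<nu>\<ge>2. 1/(\<nu> p^\<nu>) = O(1/p\<^sup>2)\<close>.  Partial integration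
  turns \<open>E(x;q,a)/x - (\<integral>t\<ge>x. E(t;q,a)/t\<^sup>2)\<close> into \<open>(\<Sum>p\<le>x, p\<equiv>a. 1/p) - ln (ln x)/\<phi>(q) - M\<close>, where \<open>M\<close> is the
  limit of \<open>(\<Sum>p\<le>b, p\<equiv>a. 1/p) - ln (ln b)/\<phi>(q)\<close> as \<open>b \<rightarrow> \<infinity>\<close> (\<open>has_integral_prime_error_ap\<close>).  So the integral
  converges because Mertens' theorem holds in the progression, and once
  \<open>M = \<gamma>/\<phi>(q) + ln G(q,a) - (\<Sum>p\<equiv>a. r(p))\<close> is known (\<open>mertens_sum_primes_residue_class\<close>), the difference of
  the two sides of the claim is exactly \<open>-(\<Sum>p>x, p\<equiv>a. r(p))\<close>.  Chebyshev's bound makes it \<open>O(1/(x ln x))\<close>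
  with an absolute constant (\<open>ln_remainder_tail_le\<close>).

  The value of \<open>M\<close> comes from the sums \<open>\<Sum>n\<le>N. \<chi>(n) \<Lambda>(n)/(n ln n)\<close> by orthogonality of characters.  For
  nonprincipal \<open>\<chi>\<close> they converge to \<open>ln L(1,\<chi>)\<close>.  This is Mertens' argument: if \<open>L(1,\<chi>) \<noteq> 0\<close>, then
  \<open>\<Sum>n\<le>N. \<chi>(n) \<Lambda>(n)/n\<close> is bounded, so the series with the additional factor \<open>1/ln n\<close> converges at \<open>s = 1\<close>, and by
  Abel's theorem it is there the continuous continuation of \<open>ln L(s,\<chi>)\<close> from \<open>s > 1\<close>.  The locale
  \<open>dirichlet_log\<close> carries this out for every Dirichlet series with bounded partial sums of coefficients.

  For the principal character the same locale is applied to the alternating zeta function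
  \<open>\<eta>(s) = (1 - 2 powr (1-s)) \<zeta>(s)\<close>, which has the value \<open>ln 2\<close> at \<open>1\<close>.  Its logarithmic coefficients differ from those
  of \<open>\<zeta>\<close> by \<open>1/k\<close> at \<open>2^k\<close> (after division by \<open>2^k\<close>), so \<open>\<Sum>n\<le>N. \<Lambda>(n)/(n ln n)\<close> is compared with a harmonic
  number, and Euler's constant appears by its definition.

  That \<open>L(1,\<chi>) \<noteq> 0\<close> is shown for real \<open>\<chi>\<close> by Monsky's argument with a Lambert series, and for the others by
  observing that \<open>L(1,\<chi>) = 0\<close> for at most one \<open>\<chi>\<close>, as \<open>\<Sum>\<chi>. ln |L(s,\<chi>)| \<ge> 0\<close> for \<open>s > 1\<close>.
\<close>

section \<open>Dirichlet characters\<close>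

lemma character_mult:
  "dirichlet_character q chi \<Longrightarrow> chi (m * n) = chi m * chi n"
  by (simp add: dirichlet_character_def)

lemma character_eq_0_iff:
  "dirichlet_character q chi \<Longrightarrow> chi n = 0 \<longleftrightarrow> \<not> coprime n q"
  by (simp add: dirichlet_character_def)

lemma character_one:
  assumes "dirichlet_character q chi"
  shows "chi (Suc 0) = 1"
proof -
  have "chi (Suc 0) * chi (Suc 0) = chi (Suc 0) * 1"
    using character_mult[OF assms, of "Suc 0" "Suc 0"] by simp
  moreover have "chi (Suc 0) \<noteq> 0"
    using character_eq_0_iff[OF assms, of "Suc 0"] by simp
  ultimately show ?thesis by simp
qed

lemma character_power:
  assumes "dirichlet_character q chi"
  shows "chi (n ^ k) = chi n ^ k"
  by (induction k) (use character_one[OF assms] in \<open>simp_all add: character_mult[OF assms]\<close>)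

lemma character_cong:
  assumes "dirichlet_character q chi" "[m = n] (mod q)"
  shows "chi m = chi n"
proof -
  have shift: "chi (r + k * q) = chi r" for r k
  proof (induction k)
    case (Suc k)
    have "chi (r + Suc k * q) = chi (r + k * q + q)" by (simp add: algebra_simps)
    also have "\<dots> = chi r" using Suc assms(1) by (simp add: dirichlet_character_def)
    finally show ?case .
  qed simp
  have "chi r = chi (r mod q)" for r
    using shift[of "r mod q" "r div q"] by (simp add: add.commute)
  then show ?thesis using assms(2) by (metis cong_def)
qed

lemma character_power_totient:
  assumes "dirichlet_character q chi" "coprime n q"
  shows "chi n ^ totient q = 1"
proof -
  have "chi n ^ totient q = chi (n ^ totient q)" by (simp add: character_power[OF assms(1)])
  also have "\<dots> = chi 1" by (rule character_cong[OF assms(1)]) (use assms euler_theorem in auto)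
  finally show ?thesis using character_one[OF assms(1)] by simp
qed

lemma norm_character:
  assumes "dirichlet_character q chi" "coprime n q" "q > 0"
  shows "norm (chi n) = 1"
proof -
  have "norm (chi n) ^ totient q = 1 ^ totient q"
    using character_power_totient[OF assms(1,2)] by (metis norm_one norm_power power_one)
  moreover have "totient q > 0" using assms by simp
  ultimately show ?thesis using power_eq_iff_eq_base[of "totient q" "norm (chi n)" 1] by simp
qed

lemma norm_character_le_1:
  assumes "dirichlet_character q chi" "q > 0"
  shows "norm (chi n) \<le> 1"
proof (cases "coprime n q")
  case True
  then show ?thesis using norm_character[OF assms(1) True assms(2)] by simp
next
  case False
  then have "chi n = 0" by (simp add: character_eq_0_iff[OF assms(1)])
  then show ?thesis by simp
qed

lemma character_cnj_mult_self:
  assumes "dirichlet_character q chi" "coprime n q" "q > 0"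
  shows "cnj (chi n) * chi n = 1"
  using norm_character[OF assms] by (simp add: complex_norm_square[symmetric] mult.commute)

lemma dirichlet_character_principal:
  assumes "q > 0"
  shows "dirichlet_character q (principal_character q)"
proof -
  have "coprime (n + q) q \<longleftrightarrow> coprime n q" for n
    by (rule coprime_cong_cong_left) (simp add: cong_def)
  then show ?thesis by (auto simp: dirichlet_character_def principal_character_def)
qed

lemma dirichlet_character_times:
  assumes "dirichlet_character q chi" "dirichlet_character q psi"
  shows "dirichlet_character q (\<lambda>n. chi n * psi n)"
  using assms by (auto simp: dirichlet_character_def)

lemma dirichlet_character_cnj:
  assumes "dirichlet_character q chi"
  shows "dirichlet_character q (\<lambda>n. cnj (chi n))"
  using assms by (auto simp: dirichlet_character_def)

lemma finite_dirichlet_characters: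
  assumes "q > 0"
  shows "finite {chi. dirichlet_character q chi}"
proof -
  let ?R = "insert 0 {z::complex. z ^ totient q = 1}"
  have "totient q \<ge> 1" using assms by (simp add: Suc_leI)
  then have "finite ?R" using finite_roots_unity[of "totient q"] by simp
  then have fin: "finite (PiE {..<q} (\<lambda>_. ?R))" by (intro finite_PiE) auto
  have "inj_on (\<lambda>chi. restrict chi {..<q}) {chi. dirichlet_character q chi}"
  proof (rule inj_onI, rule ext)
    fix chi psi n
    assume "chi \<in> {chi. dirichlet_character q chi}" "psi \<in> {chi. dirichlet_character q chi}"
      and eq: "restrict chi {..<q} = restrict psi {..<q}"
    then have "chi n = chi (n mod q)" "psi n = psi (n mod q)"
      by (auto intro: character_cong simp: cong_def)
    moreover have "chi (n mod q) = psi (n mod q)"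
      using fun_cong[OF eq, of "n mod q"] assms by simp
    ultimately show "chi n = psi n" by simp
  qed
  moreover have "(\<lambda>chi. restrict chi {..<q}) ` {chi. dirichlet_character q chi}
      \<subseteq> PiE {..<q} (\<lambda>_. ?R)"
  proof (rule image_subsetI)
    fix chi assume "chi \<in> {chi. dirichlet_character q chi}"
    then have "chi n \<in> ?R" for n
      using character_eq_0_iff[of q chi n] character_power_totient[of q chi n]
      by (cases "coprime n q") auto
    then show "restrict chi {..<q} \<in> PiE {..<q} (\<lambda>_. ?R)" by auto
  qed
  ultimately show ?thesis using fin by (meson finite_imageD finite_subset)
qed

text \<open>
  The shift \<open>f \<mapsto> f (g * \<sqdot>)\<close> acts on functions modulo \<open>q\<close> and its \<open>\<phi>(q)\<close>-th power is the identity.  Hence the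
  averages of \<open>f\<close> over this action, twisted by the \<open>\<phi>(q)\<close>-th roots of unity, are eigenfunctions that
  add up to \<open>\<phi>(q) f\<close>.  If \<open>f\<close> is not itself invariant, one of the averages with a root of unity other
  than \<open>1\<close> is nonzero.  All shifts commute, so the average keeps the eigenvalue equations that \<open>f\<close> already
  satisfies; this lets one diagonalise the shifts one after another.
\<close>

lemma eigenfunction_of_shift:
  fixes f :: "nat \<Rightarrow> complex"
  assumes q: "q > 0" and g: "coprime g q"
    and per: "\<And>x y. [x = y] (mod q) \<Longrightarrow> f x = f y"
    and ex: "\<exists>x. f x \<noteq> 0"
  shows "\<exists>f' z. (\<forall>x y. [x = y] (mod q) \<longrightarrow> f' x = f' y) \<and> (\<exists>x. f' x \<noteq> 0) \<and>
    (\<forall>x. f' (g * x) = z * f' x) \<and> ((\<exists>x. f (g * x) \<noteq> f x) \<longrightarrow> z \<noteq> 1) \<and>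
    (\<forall>h w. (\<forall>x. f (h * x) = w * f x) \<longrightarrow> (\<forall>x. f' (h * x) = w * f' x))"
proof (cases "\<exists>x. f (g * x) \<noteq> f x")
  case False
  then show ?thesis using per ex by (intro exI[of _ f] exI[of _ 1]) auto
next
  case True
  define m where "m = totient q"
  have m: "m > 0" using q by (simp add: m_def)
  define w :: complex where "w = exp (2 * of_real pi * \<i> / of_nat m)"
  have wj: "w ^ j = exp (2 * of_real pi * \<i> * of_nat j / of_nat m)" for j
    unfolding w_def by (simp add: exp_of_nat_mult[symmetric] mult_ac)
  have w1: "w ^ j = 1 \<longleftrightarrow> m dvd j" for j
    using complex_root_unity_eq_1[of m j] m wj[of j] by simp
  have w0: "w \<noteq> 0" by (simp add: w_def)
  define P where "P k x = (\<Sum>j<m. (w ^ k) ^ j * f (g ^ j * x))" for k x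
  have fm: "f (g ^ m * x) = f x" for x
  proof -
    have "[g ^ m * x = 1 * x] (mod q)"
      using euler_theorem[OF g] by (intro cong_mult) (auto simp: m_def)
    then show ?thesis using per by simp
  qed
  have shift: "w ^ k * P k (g * x) = P k x" for k x
  proof -
    define F where "F j = (w ^ k) ^ j * f (g ^ j * x)" for j
    have "(w ^ k) ^ m = 1" using w1[of "k * m"] by (simp add: power_mult)
    then have "F m = F 0" using fm by (simp add: F_def)
    then have "(\<Sum>j<m. F (Suc j)) = (\<Sum>j<m. F j)"
      using sum.lessThan_Suc_shift[of F m] by simp
    then show ?thesis
      by (simp add: P_def F_def sum_distrib_left mult_ac)
  qed
  have total: "(\<Sum>k<m. P k x) = of_nat m * f x" for x
  proof -
    have "(\<Sum>k<m. P k x) = (\<Sum>j<m. \<Sum>k<m. (w ^ j) ^ k * f (g ^ j * x))"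
      unfolding P_def by (subst sum.swap) (simp add: power_mult[symmetric] mult.commute)
    also have "\<dots> = (\<Sum>j<m. if j = 0 then of_nat m * f x else 0)"
    proof (intro sum.cong refl)
      fix j assume j: "j \<in> {..<m}"
      show "(\<Sum>k<m. (w ^ j) ^ k * f (g ^ j * x)) = (if j = 0 then of_nat m * f x else 0)"
      proof (cases "j = 0")
        case False
        then have "w ^ j \<noteq> 1" using j w1 by (auto dest: dvd_imp_le)
        moreover have "(w ^ j) ^ m = 1" using w1[of "j * m"] by (simp add: power_mult)
        ultimately have "(\<Sum>k<m. (w ^ j) ^ k) = 0" by (simp add: geometric_sum)
        with False show ?thesis by (simp add: sum_distrib_right[symmetric])
      qed simp
    qed
    also have "\<dots> = of_nat m * f x" using m by simp
    finally show ?thesis .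
  qed
  have "\<exists>k\<in>{0<..<m}. \<exists>x. P k x \<noteq> 0"
  proof (rule ccontr)
    assume "\<not> ?thesis"
    then have zero: "P k x = 0" if "k \<in> {0<..<m}" for k x using that by auto
    have eq: "of_nat m * f x = P 0 x" for x
    proof -
      have "(\<Sum>k<m. P k x) = (\<Sum>k\<in>{0}. P k x)"
        by (rule sum.mono_neutral_right) (use m zero in auto)
      then show ?thesis using total[of x] by simp
    qed
    have "f (g * x) = f x" for x
    proof -
      have "of_nat m * f (g * x) = of_nat m * f x"
        using shift[of 0 x] eq[of x] eq[of "g * x"] by simp
      then show ?thesis using m by (metis mult_cancel_left of_nat_eq_0_iff less_irrefl)
    qed
    then show False using True by auto
  qed
  then obtain k where k: "0 < k" "k < m" "\<exists>x. P k x \<noteq> 0"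
    unfolding greaterThanLessThan_iff Bex_def by blast
  show ?thesis
  proof (rule exI[of _ "P k"], rule exI[of _ "inverse (w ^ k)"], intro conjI allI impI)
    show "P k x = P k y" if "[x = y] (mod q)" for x y
      unfolding P_def using per[OF cong_scalar_left[OF that]] by simp
    show "P k (g * x) = inverse (w ^ k) * P k x" for x
      using shift[of k x] w0 by (simp add: field_simps)
    show "inverse (w ^ k) \<noteq> 1" using w1[of k] k by (auto dest: dvd_imp_le)
    show "P k (h * x) = v * P k x" if "\<forall>x. f (h * x) = v * f x" for h v x
    proof -
      have "f (g ^ j * (h * x)) = v * f (g ^ j * x)" for j
        using that[rule_format, of "g ^ j * x"] by (simp add: mult_ac)
      then show ?thesis by (simp add: P_def sum_distrib_left mult_ac)
    qed
  qed (use k in auto)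
qed

text \<open>
  The eigenvalues of a joint eigenfunction of all shifts form a character.  Starting from the
  indicator function of the class of \<open>1\<close>, which the shift by \<open>n\<close> moves, makes the eigenvalue at \<open>n\<close>
  different from \<open>1\<close>.  This replaces the usual extension of characters from subgroups.
\<close>

lemma ex_character_not_1:
  assumes q: "q > 0" and n: "coprime n q" "\<not> [n = 1] (mod q)"
  shows "\<exists>chi. dirichlet_character q chi \<and> chi n \<noteq> 1"
proof -
  have joint: "\<exists>f :: nat \<Rightarrow> complex. (\<forall>x y. [x = y] (mod q) \<longrightarrow> f x = f y) \<and> (\<exists>x. f x \<noteq> 0) \<and>
      (\<exists>z. z \<noteq> 1 \<and> (\<forall>x. f (n * x) = z * f x)) \<and> (\<forall>h\<in>S. \<exists>z. \<forall>x. f (h * x) = z * f x)"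
    if "finite S" "\<forall>h\<in>S. coprime h q" for S
    using that
  proof (induction S)
    case empty
    define f :: "nat \<Rightarrow> complex" where "f x = (if [x = 1] (mod q) then 1 else 0)" for x
    have per: "f x = f y" if "[x = y] (mod q)" for x y
      using that unfolding f_def by (metis cong_sym cong_trans)
    have ex: "\<exists>x. f x \<noteq> 0" by (rule exI[of _ 1]) (simp add: f_def)
    have moved: "\<exists>x. f (n * x) \<noteq> f x" by (rule exI[of _ 1]) (use n in \<open>simp add: f_def\<close>)
    from eigenfunction_of_shift[OF q n(1) per ex] moved show ?case by blast
  next
    case (insert g S)
    then obtain f :: "nat \<Rightarrow> complex" where f: "\<And>x y. [x = y] (mod q) \<Longrightarrow> f x = f y"
        "\<exists>x. f x \<noteq> 0" "\<exists>z. z \<noteq> 1 \<and> (\<forall>x. f (n * x) = z * f x)"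
        "\<forall>h\<in>S. \<exists>z. \<forall>x. f (h * x) = z * f x"
      by auto
    from insert have "coprime g q" by simp
    from eigenfunction_of_shift[OF q this f(1,2)] obtain f' z where
      f': "\<And>x y. [x = y] (mod q) \<Longrightarrow> f' x = f' y" "\<exists>x. f' x \<noteq> 0"
        "\<And>x. f' (g * x) = z * f' x"
        "\<And>h w. (\<forall>x. f (h * x) = w * f x) \<Longrightarrow> (\<forall>x. f' (h * x) = w * f' x)"
      by blast
    show ?case
    proof (intro exI[of _ f'] conjI)
      show "\<forall>x y. [x = y] (mod q) \<longrightarrow> f' x = f' y" using f'(1) by blast
      show "\<exists>x. f' x \<noteq> 0" by (fact f'(2))
      show "\<exists>z. z \<noteq> 1 \<and> (\<forall>x. f' (n * x) = z * f' x)" using f(3) f'(4)[of n] by blast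
      show "\<forall>h\<in>insert g S. \<exists>z. \<forall>x. f' (h * x) = z * f' x"
      proof
        fix h assume "h \<in> insert g S"
        then consider "h = g" | "h \<in> S" by blast
        then show "\<exists>z. \<forall>x. f' (h * x) = z * f' x"
          by cases (use f'(3) f(4) f'(4)[of h] in blast)+
      qed
    qed
  qed
  have "finite {h. h < q \<and> coprime h q}" "\<forall>h\<in>{h. h < q \<and> coprime h q}. coprime h q" by simp_all
  from joint[OF this] obtain f :: "nat \<Rightarrow> complex"
    where f: "(\<forall>x y. [x = y] (mod q) \<longrightarrow> f x = f y) \<and> (\<exists>x. f x \<noteq> 0) \<and>
      (\<exists>z. z \<noteq> 1 \<and> (\<forall>x. f (n * x) = z * f x)) \<and>
      (\<forall>h\<in>{h. h < q \<and> coprime h q}. \<exists>z. \<forall>x. f (h * x) = z * f x)" ..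
  have per: "f x = f y" if "[x = y] (mod q)" for x y using f that by blast
  have ex: "\<exists>x. f x \<noteq> 0" and nz: "\<exists>z. z \<noteq> 1 \<and> (\<forall>x. f (n * x) = z * f x)"
    and S: "\<forall>h\<in>{h. h < q \<and> coprime h q}. \<exists>z. \<forall>x. f (h * x) = z * f x"
    using f by simp_all
  obtain x0 where x0: "f x0 \<noteq> 0" using ex by auto
  define chi where "chi k = (if coprime k q then f (k * x0) / f x0 else 0)" for k
  have eig: "f (k * x) = chi k * f x" if "coprime k q" for k x
  proof -
    have "coprime (k mod q) q" "k mod q < q" using that q by auto
    then have "\<exists>z. \<forall>x. f (k mod q * x) = z * f x" using S by simp
    then obtain z where z: "\<And>x. f (k mod q * x) = z * f x" by blast
    have "f (k * x) = f (k mod q * x)" for x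
      by (rule per) (simp add: cong_def mod_mult_left_eq)
    then have "f (k * x) = z * f x" for x using z by simp
    then show ?thesis using that x0 by (simp add: chi_def)
  qed
  have nonzero: "chi k \<noteq> 0" if k: "coprime k q" for k
  proof
    assume "chi k = 0"
    obtain l where l: "[k * l = 1] (mod q)" using cong_solve_coprime_nat[OF k] by auto
    then have "f (k * (l * x0)) = f (1 * x0)"
      using cong_scalar_right[OF l, of x0] per by (simp add: mult.assoc)
    then show False using eig[OF k, of "l * x0"] x0 \<open>chi k = 0\<close> by simp
  qed
  have "dirichlet_character q chi"
    unfolding dirichlet_character_def
  proof (intro conjI allI)
    fix k l :: nat
    have "f ((k + q) * x0) = f (k * x0)"
      by (rule per) (simp add: cong_def add_mult_distrib)
    moreover have "coprime (k + q) q \<longleftrightarrow> coprime k q"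
      by (rule coprime_cong_cong_left) (simp add: cong_def)
    ultimately show "chi (k + q) = chi k" by (simp add: chi_def)
    show "chi (k * l) = chi k * chi l"
      using eig[of k "l * x0"] by (auto simp: chi_def mult.assoc)
    show "chi k = 0 \<longleftrightarrow> \<not> coprime k q" using nonzero by (auto simp: chi_def)
  qed
  moreover have "chi n \<noteq> 1" using nz n x0 by (auto simp: chi_def)
  ultimately show ?thesis by blast
qed

lemma sum_character_residues:
  assumes q: "q > 0" and chi: "dirichlet_character q chi" "chi \<noteq> principal_character q"
  shows "(\<Sum>n<q. chi n) = 0"
proof -
  obtain b where b: "coprime b q" "chi b \<noteq> 1"
  proof (rule ccontr)
    assume "\<not> thesis"
    then have "\<forall>b. coprime b q \<longrightarrow> chi b = 1" using that by blast
    then have "chi = principal_character q"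
      using character_eq_0_iff[OF chi(1)] by (auto simp: principal_character_def)
    then show False using chi(2) by simp
  qed
  have inj: "inj_on (\<lambda>n. b * n mod q) {..<q}"
  proof (rule inj_onI)
    fix x y assume xy: "x \<in> {..<q}" "y \<in> {..<q}" "b * x mod q = b * y mod q"
    then have "[b * x = b * y] (mod q)" by (simp add: cong_def)
    then have "[x = y] (mod q)" using b(1) by (simp add: cong_mult_lcancel_nat)
    then show "x = y" using xy by (simp add: cong_def)
  qed
  then have "bij_betw (\<lambda>n. b * n mod q) {..<q} {..<q}"
    unfolding bij_betw_def using q by (intro conjI endo_inj_surj) auto
  then have "(\<Sum>n<q. chi n) = (\<Sum>n<q. chi (b * n mod q))"
    by (simp add: sum.reindex_bij_betw[where g = chi, symmetric])
  also have "\<dots> = (\<Sum>n<q. chi b * chi n)"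
  proof (intro sum.cong refl)
    fix n
    have "chi (b * n mod q) = chi (b * n)" by (rule character_cong[OF chi(1)]) (simp add: cong_def)
    then show "chi (b * n mod q) = chi b * chi n" by (simp add: character_mult[OF chi(1)])
  qed
  also have "\<dots> = chi b * (\<Sum>n<q. chi n)" by (simp add: sum_distrib_left)
  finally have "(chi b - 1) * (\<Sum>n<q. chi n) = 0" by (simp add: ring_distribs)
  then show ?thesis using b(2) by simp
qed

lemma norm_sum_character_le:
  assumes q: "q > 0" and chi: "dirichlet_character q chi" "chi \<noteq> principal_character q"
  shows "norm (\<Sum>n<N. chi (Suc n)) \<le> real q + 1"
proof -
  have bound: "norm (\<Sum>n<M. chi n) \<le> real q" for M
  proof (induction M rule: less_induct)
    case (less M)
    show ?case
    proof (cases "M \<le> q")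
      case True
      have "norm (\<Sum>n<M. chi n) \<le> (\<Sum>n<M. 1)"
        by (intro sum_norm_le norm_character_le_1[OF chi(1) q])
      then show ?thesis using True by simp
    next
      case False
      have "{..<M} = {..<q} \<union> {q..<q + (M - q)}" using False by auto
      moreover have "sum chi ({..<q} \<union> {q..<q + (M - q)}) =
          (\<Sum>n<q. chi n) + (\<Sum>n=q..<q + (M - q). chi n)"
        by (rule sum.union_disjoint) auto
      ultimately have "(\<Sum>n<M. chi n) = (\<Sum>n<q. chi n) + (\<Sum>n=q..<q + (M - q). chi n)"
        by simp
      also have "(\<Sum>n=q..<q + (M - q). chi n) = (\<Sum>n<M - q. chi (n + q))"
        using sum.shift_bounds_nat_ivl[of chi 0 q "M - q"] by (simp add: add.commute atLeast0LessThan)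
      also have "\<dots> = (\<Sum>n<M - q. chi n)" using chi(1) by (simp add: dirichlet_character_def)
      finally show ?thesis
        using less[of "M - q"] False q sum_character_residues[OF assms] by simp
    qed
  qed
  have "(\<Sum>n<N. chi (Suc n)) = (\<Sum>n<Suc N. chi n) - chi 0"
    by (subst sum.lessThan_Suc_shift) simp
  also have "norm \<dots> \<le> norm (\<Sum>n<Suc N. chi n) + norm (chi 0)" by (rule norm_triangle_ineq4)
  also have "\<dots> \<le> real q + 1" by (intro add_mono bound norm_character_le_1[OF chi(1) q])
  finally show ?thesis .
qed

text \<open>
  Multiplication by a character that is not \<open>1\<close> at \<open>n\<close> permutes the characters and multiplies the sum by
  a factor other than \<open>1\<close>.
\<close>

lemma sum_over_characters:
  assumes q: "q > 0" and n: "coprime n q"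
  shows "(\<Sum>chi | dirichlet_character q chi. chi n) =
    (if [n = 1] (mod q) then of_nat (card {chi. dirichlet_character q chi}) else 0)"
proof (cases "[n = 1] (mod q)")
  case True
  have "chi n = 1" if "dirichlet_character q chi" for chi
    using character_cong[OF that True] character_one[OF that] by simp
  then have "(\<Sum>chi | dirichlet_character q chi. chi n) = (\<Sum>chi | dirichlet_character q chi. 1)"
    by (intro sum.cong) auto
  then show ?thesis using True by simp
next
  case False
  let ?X = "{chi. dirichlet_character q chi}"
  obtain psi where psi: "dirichlet_character q psi" "psi n \<noteq> 1"
    using ex_character_not_1[OF q n False] by auto
  have "bij_betw (\<lambda>chi k. psi k * chi k) ?X ?X"
  proof (rule bij_betw_byWitness[where f' = "\<lambda>chi k. cnj (psi k) * chi k"])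
    have *: "cnj (psi k) * (psi k * chi k) = chi k"
      if "dirichlet_character q chi" for chi k
      using character_cnj_mult_self[OF psi(1) _ q, of k] character_eq_0_iff[OF that, of k]
      by (cases "coprime k q") (auto simp: mult.assoc[symmetric])
    show "\<forall>chi\<in>?X. (\<lambda>k. cnj (psi k) * (psi k * chi k)) = chi" using * by auto
    show "\<forall>chi\<in>?X. (\<lambda>k. psi k * (cnj (psi k) * chi k)) = chi"
      using * by (auto simp: mult_ac)
  qed (auto intro!: dirichlet_character_times dirichlet_character_cnj psi)
  then have "(\<Sum>chi\<in>?X. chi n) = (\<Sum>chi\<in>?X. psi n * chi n)"
    by (rule sum.reindex_bij_betw[where g = "\<lambda>chi. chi n", symmetric])
  also have "\<dots> = psi n * (\<Sum>chi\<in>?X. chi n)" by (simp add: sum_distrib_left)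
  finally have "(psi n - 1) * (\<Sum>chi\<in>?X. chi n) = 0" by (simp add: ring_distribs)
  then show ?thesis using psi False by simp
qed

lemma sum_principal_character:
  assumes "q > 0"
  shows "(\<Sum>n<q. principal_character q n) = of_nat (totient q)"
proof -
  have "(\<Sum>n<q. principal_character q n) = (\<Sum>n<q. principal_character q (Suc n))"
  proof -
    have "principal_character q 0 = principal_character q q" by (simp add: principal_character_def)
    then show ?thesis
      using sum.lessThan_Suc_shift[of "principal_character q" q]
        sum.lessThan_Suc[of "principal_character q" q] by simp
  qed
  also have "\<dots> = (\<Sum>n\<in>{0<..q}. principal_character q n)"
    by (rule sum.reindex_bij_witness[of _ "\<lambda>n. n - 1" Suc]) auto
  also have "\<dots> = (\<Sum>n\<in>totatives q. 1)"
    by (rule sum.mono_neutral_cong_right) (auto simp: totatives_def principal_character_def)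
  finally show ?thesis by (simp add: totient_def)
qed

text \<open>
  Both evaluations of the double sum over characters and residues collapse: one to the residue \<open>1\<close>,
  the other to the principal character.
\<close>

lemma card_dirichlet_characters:
  assumes q: "q > 0"
  shows "card {chi. dirichlet_character q chi} = totient q"
proof -
  let ?X = "{chi. dirichlet_character q chi}"
  have "(\<Sum>n<q. \<Sum>chi\<in>?X. chi n) = (\<Sum>n<q. if n = 1 mod q then of_nat (card ?X) else 0)"
  proof (intro sum.cong refl)
    fix n assume n: "n \<in> {..<q}"
    show "(\<Sum>chi\<in>?X. chi n) = (if n = 1 mod q then of_nat (card ?X) else 0)"
    proof (cases "coprime n q")
      case True
      then show ?thesis using sum_over_characters[OF q True] n by (simp add: cong_def)
    next
      case False
      then have "(\<Sum>chi\<in>?X. chi n) = 0"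
        by (intro sum.neutral) (auto simp: character_eq_0_iff)
      moreover have "n \<noteq> 1 mod q"
      proof
        assume "n = 1 mod q"
        then have "[n = 1] (mod q)" by (simp add: cong_def)
        then have "coprime n q" using coprime_cong_cong_left[of n 1 q] by simp
        then show False using False by simp
      qed
      ultimately show ?thesis by simp
    qed
  qed
  also have "\<dots> = of_nat (card ?X)" using q by simp
  finally have 1: "(\<Sum>n<q. \<Sum>chi\<in>?X. chi n) = of_nat (card ?X)" .
  have "(\<Sum>n<q. \<Sum>chi\<in>?X. chi n) = (\<Sum>chi\<in>?X. \<Sum>n<q. chi n)" by (rule sum.swap)
  also have "\<dots> = (\<Sum>chi\<in>{principal_character q}. \<Sum>n<q. chi n)"
    by (rule sum.mono_neutral_right)
      (simp_all add: finite_dirichlet_characters[OF q] dirichlet_character_principal[OF q]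
        sum_character_residues[OF q])
  also have "\<dots> = of_nat (totient q)" using sum_principal_character[OF q] by simp
  finally have "of_nat (card ?X) = (of_nat (totient q) :: complex)" unfolding 1 .
  then show ?thesis by (simp only: of_nat_eq_iff)
qed

lemma character_orthogonality:
  assumes q: "q > 0" and a: "coprime a q"
  shows "(\<Sum>chi | dirichlet_character q chi. cnj (chi a) * chi n) =
    (if [n = a] (mod q) then of_nat (totient q) else 0)"
proof (cases "coprime n q")
  case False
  then have "(\<Sum>chi | dirichlet_character q chi. cnj (chi a) * chi n) = 0"
    by (intro sum.neutral) (auto simp: character_eq_0_iff)
  moreover have "\<not> [n = a] (mod q)" using False coprime_cong_cong_left[of n a q] a by blast
  ultimately show ?thesis by simp
next
  case True
  obtain b where b: "[a * b = 1] (mod q)" using cong_solve_coprime_nat[OF a] by auto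
  have cb: "coprime b q"
    using cong_imp_coprime[OF cong_sym[OF b]] by simp
  have "cnj (chi a) * chi n = chi (b * n)" if chi: "dirichlet_character q chi" for chi
  proof -
    have ab: "chi a * chi b = 1"
      using character_cong[OF chi b] character_mult[OF chi] character_one[OF chi] by simp
    have "cnj (chi a) = cnj (chi a) * (chi a * chi b)" by (simp only: ab mult_1_right)
    also have "\<dots> = chi b" using character_cnj_mult_self[OF chi a q] by (simp add: mult.assoc[symmetric])
    finally show ?thesis by (simp add: character_mult[OF chi])
  qed
  then have "(\<Sum>chi | dirichlet_character q chi. cnj (chi a) * chi n) =
      (\<Sum>chi | dirichlet_character q chi. chi (b * n))"
    by (intro sum.cong) auto
  also have "\<dots> = (if [b * n = 1] (mod q) then of_nat (totient q) else 0)"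
    using sum_over_characters[OF q, of "b * n"] True cb card_dirichlet_characters[OF q] by simp
  also have "[b * n = 1] (mod q) \<longleftrightarrow> [n = a] (mod q)"
  proof
    assume "[b * n = 1] (mod q)"
    then have "[b * n = b * a] (mod q)"
      using cong_trans[OF _ cong_sym[OF b]] by (simp only: mult.commute[of b a])
    then show "[n = a] (mod q)" using cb by (simp add: cong_mult_lcancel_nat)
  next
    assume "[n = a] (mod q)"
    then have "[b * n = b * a] (mod q)" by (rule cong_scalar_left)
    then show "[b * n = 1] (mod q)"
      using cong_trans[OF _ b] by (simp only: mult.commute[of b a])
  qed
  finally show ?thesis .
qed

section \<open>Summation by parts\<close>

lemma sum_by_parts:
  fixes c :: "nat \<Rightarrow> 'a::real_vector" and w :: "nat \<Rightarrow> real"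
  shows "(\<Sum>k<N. w k *\<^sub>R c k) =
    (\<Sum>k<N. (w k - w (Suc k)) *\<^sub>R (\<Sum>j<Suc k. c j)) + w N *\<^sub>R (\<Sum>k<N. c k)"
  by (induction N) (simp_all add: algebra_simps)

lemma norm_weighted_sum_le:
  fixes c :: "nat \<Rightarrow> 'a::real_normed_vector" and w :: "nat \<Rightarrow> real"
  assumes dec: "decseq w" and nonneg: "\<And>k. w k \<ge> 0" and bound: "\<And>n. norm (\<Sum>k<n. c k) \<le> B"
  shows "norm (\<Sum>k<N. w k *\<^sub>R c k) \<le> w 0 * B"
proof -
  have "norm (\<Sum>k<N. w k *\<^sub>R c k) \<le>
      norm (\<Sum>k<N. (w k - w (Suc k)) *\<^sub>R (\<Sum>j<Suc k. c j)) + norm (w N *\<^sub>R (\<Sum>k<N. c k))"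
    unfolding sum_by_parts[of w c N] by (rule norm_triangle_ineq)
  also have "\<dots> \<le> (\<Sum>k<N. (w k - w (Suc k)) * B) + w N * B"
  proof (intro add_mono sum_norm_le)
    fix k
    have "w (Suc k) \<le> w k" using dec by (simp add: decseq_Suc_iff)
    then have "norm ((w k - w (Suc k)) *\<^sub>R (\<Sum>j<Suc k. c j))
        = (w k - w (Suc k)) * norm (\<Sum>j<Suc k. c j)" by (simp del: sum.lessThan_Suc)
    also have "\<dots> \<le> (w k - w (Suc k)) * B"
      using bound[of "Suc k"] \<open>w (Suc k) \<le> w k\<close> by (intro mult_left_mono) simp_all
    finally show "norm ((w k - w (Suc k)) *\<^sub>R (\<Sum>j<Suc k. c j)) \<le> (w k - w (Suc k)) * B" .
  next
    show "norm (w N *\<^sub>R (\<Sum>k<N. c k)) \<le> w N * B"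
      using bound[of N] nonneg[of N] by (simp add: mult_left_mono)
  qed
  also have "\<dots> = w 0 * B"
    using sum_lessThan_telescope'[of w N]
    by (simp add: sum_distrib_right[symmetric] distrib_right[symmetric])
  finally show ?thesis .
qed

lemma norm_weighted_block_le:
  fixes c :: "nat \<Rightarrow> 'a::real_normed_vector" and w :: "nat \<Rightarrow> real"
  assumes dec: "decseq w" and nonneg: "\<And>k. w k \<ge> 0"
    and bound: "\<And>n. norm (\<Sum>k=m..<n. c k) \<le> B"
  shows "norm (\<Sum>k=m..<n. w k *\<^sub>R c k) \<le> w m * B"
proof (cases "m \<le> n")
  case True
  have shift: "(\<Sum>k=m..<m + N. f k) = (\<Sum>k<N. f (k + m))" for f :: "nat \<Rightarrow> 'a" and N
    using sum.shift_bounds_nat_ivl[of f 0 m N] by (simp add: atLeast0LessThan add.commute)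
  have "norm (\<Sum>k<n - m. w (k + m) *\<^sub>R c (k + m)) \<le> w (0 + m) * B"
  proof (rule norm_weighted_sum_le)
    show "decseq (\<lambda>k. w (k + m))" using dec by (simp add: decseq_def)
    show "norm (\<Sum>k<N. c (k + m)) \<le> B" for N using bound[of "m + N"] shift[of c N] by simp
  qed (rule nonneg)
  then show ?thesis using shift[of "\<lambda>k. w k *\<^sub>R c k" "n - m"] True by simp
next
  case False
  have "0 \<le> B" using bound[of m] by simp
  then show ?thesis using False nonneg[of m] by simp
qed

text \<open>
  For decreasing weights only the partial sums matter.  In this form a bound for
  \<open>\<Sum>n\<le>N. \<Lambda>(n)\<close> that is linear in \<open>N\<close> allows \<open>\<Lambda>\<close> to be replaced by a constant.
\<close>

lemma weighted_sum_mono: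
  fixes x y w :: "nat \<Rightarrow> real"
  assumes dec: "decseq w" and nonneg: "\<And>k. w k \<ge> 0"
    and le: "\<And>n. (\<Sum>k<n. x k) \<le> (\<Sum>k<n. y k)"
  shows "(\<Sum>k<N. w k * x k) \<le> (\<Sum>k<N. w k * y k)"
proof -
  have "(\<Sum>k<N. (w k - w (Suc k)) *\<^sub>R (\<Sum>j<Suc k. x j)) \<le>
      (\<Sum>k<N. (w k - w (Suc k)) *\<^sub>R (\<Sum>j<Suc k. y j))"
  proof (rule sum_mono)
    fix k
    have "w (Suc k) \<le> w k" using dec by (simp add: decseq_Suc_iff)
    then show "(w k - w (Suc k)) *\<^sub>R (\<Sum>j<Suc k. x j) \<le> (w k - w (Suc k)) *\<^sub>R (\<Sum>j<Suc k. y j)"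
      using le[of "Suc k"] unfolding real_scaleR_def by (intro mult_left_mono) simp_all
  qed
  moreover have "w N *\<^sub>R (\<Sum>k<N. x k) \<le> w N *\<^sub>R (\<Sum>k<N. y k)"
    using le[of N] nonneg[of N] by (simp add: mult_left_mono)
  ultimately show ?thesis
    using sum_by_parts[of w x N] sum_by_parts[of w y N] unfolding real_scaleR_def by linarith
qed

lemma norm_block_le_of_partial_sums:
  fixes c :: "nat \<Rightarrow> 'a::real_normed_vector"
  assumes "\<And>n. norm (\<Sum>k<n. c k) \<le> B"
  shows "norm (\<Sum>k=m..<n. c k) \<le> 2 * B"
proof (cases "m \<le> n")
  case True
  then have "(\<Sum>k=m..<n. c k) = (\<Sum>k<n. c k) - (\<Sum>k<m. c k)"
    using sum_diff_nat_ivl[of 0 m n c] by (simp add: atLeast0LessThan)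
  then show ?thesis
    using norm_triangle_ineq4[of "\<Sum>k<n. c k" "\<Sum>k<m. c k"] assms[of n] assms[of m] by simp
next
  case False
  then show ?thesis using assms[of 0] by simp
qed

lemma summable_Dirichlet_test:
  fixes c :: "nat \<Rightarrow> 'a::banach" and w :: "nat \<Rightarrow> real"
  assumes dec: "decseq w" and lim: "w \<longlonglongrightarrow> 0" and bound: "\<And>n. norm (\<Sum>k<n. c k) \<le> B"
  shows "summable (\<lambda>k. w k *\<^sub>R c k)"
  unfolding summable_Cauchy
proof (intro allI impI)
  fix e :: real assume "e > 0"
  have nonneg: "w k \<ge> 0" for k using dec lim by (rule decseq_ge)
  have "(\<lambda>k. w k * (2 * B)) \<longlonglongrightarrow> 0 * (2 * B)" by (intro tendsto_intros lim)
  then obtain M where M: "\<And>m. m \<ge> M \<Longrightarrow> w m * (2 * B) < e"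
    using order_tendstoD(2)[of _ 0 sequentially e] \<open>e > 0\<close> by (auto simp: eventually_sequentially)
  have "norm (sum (\<lambda>k. w k *\<^sub>R c k) {m..<n}) < e" if "m \<ge> M" for m n
    using norm_weighted_block_le[OF dec nonneg norm_block_le_of_partial_sums[OF bound], of m n] M[OF that]
    by (rule le_less_trans)
  then show "\<exists>N. \<forall>m\<ge>N. \<forall>n. norm (sum (\<lambda>k. w k *\<^sub>R c k) {m..<n}) < e" by blast
qed

section \<open>Dirichlet series on a real half-line\<close>

text \<open>
  Terms are indexed from \<open>0\<close> by \<open>Suc n\<close>, as in the definition of \<^const>\<open>dirichlet_L\<close>, so that the weights
  \<open>n powr -s\<close> form a decreasing sequence.
\<close>

definition dterm :: "(nat \<Rightarrow> complex) \<Rightarrow> real \<Rightarrow> nat \<Rightarrow> complex" where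
  "dterm c s n = (real (Suc n) powr - s) *\<^sub>R c (Suc n)"

definition dseries :: "(nat \<Rightarrow> complex) \<Rightarrow> real \<Rightarrow> complex" where
  "dseries c s = (\<Sum>n. dterm c s n)"

lemma decseq_powr_Suc: "u \<ge> 0 \<Longrightarrow> decseq (\<lambda>n. real (Suc n) powr - u)"
  by (auto simp: decseq_def intro!: powr_mono2')

lemma dterm_shift: "dterm c s n = (real (Suc n) powr - (s - s0)) *\<^sub>R dterm c s0 n"
  by (simp add: dterm_def powr_add[symmetric] del: of_nat_Suc)

text \<open>
  Passing from \<open>s0\<close> to \<open>s \<ge> s0\<close> multiplies the terms by the decreasing weights \<open>n powr -(s - s0) \<le> 1\<close>, so
  blocks of the series at \<open>s\<close> are at most as large as blocks at \<open>s0\<close>, uniformly in \<open>s\<close>.  This makes a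
  conditionally convergent Dirichlet series continuous up to the endpoint.
\<close>

lemma dterm_block_le:
  assumes "s \<ge> s0" and bound: "\<And>n. norm (\<Sum>k=m..<n. dterm c s0 k) \<le> B"
  shows "norm (\<Sum>k=m..<n. dterm c s k) \<le> real (Suc m) powr - (s - s0) * B"
  unfolding dterm_shift[of c s _ s0]
  by (rule norm_weighted_block_le[OF decseq_powr_Suc _ bound]) (use assms in auto)

lemma dterm_block_le':
  assumes "s \<ge> s0" and bound: "\<And>n. norm (\<Sum>k=m..<n. dterm c s0 k) \<le> B"
  shows "norm (\<Sum>k=m..<n. dterm c s k) \<le> B"
proof -
  have "norm (\<Sum>k=m..<n. dterm c s k) \<le> real (Suc m) powr - (s - s0) * B"
    by (rule dterm_block_le[OF assms])
  also have "\<dots> \<le> 1 * B"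
  proof (rule mult_right_mono)
    have "real (Suc m) powr - (s - s0) \<le> real (Suc m) powr 0"
      using assms(1) by (intro powr_mono) auto
    then show "real (Suc m) powr - (s - s0) \<le> 1" by simp
    show "0 \<le> B" using bound[of m] by simp
  qed
  finally show ?thesis by simp
qed

lemma uniform_limit_dseries:
  assumes summable: "summable (dterm c s0)"
  shows "uniform_limit {s0..} (\<lambda>N s. \<Sum>n<N. dterm c s n) (dseries c) sequentially"
proof (rule uniform_limitI)
  fix e :: real assume "e > 0"
  then obtain M where M: "\<And>m n. m \<ge> M \<Longrightarrow> norm (\<Sum>k=m..<n. dterm c s0 k) < e / 2"
    using summable unfolding summable_Cauchy by (metis half_gt_zero)
  have block: "norm (\<Sum>k=m..<n. dterm c s k) \<le> e / 2" if "m \<ge> M" "s \<ge> s0" for m n s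
    using dterm_block_le'[OF that(2), of c m "e / 2" n] M[OF that(1)] by (simp add: less_imp_le)
  have "dist (\<Sum>n<N. dterm c s n) (dseries c s) < e" if N: "N \<ge> M" and s: "s \<ge> s0" for N s
  proof -
    have "summable (dterm c s)"
      unfolding summable_Cauchy
    proof (intro allI impI)
      fix d :: real assume "d > 0"
      then obtain K where K: "\<And>m n. m \<ge> K \<Longrightarrow> norm (\<Sum>k=m..<n. dterm c s0 k) < d / 2"
        using summable unfolding summable_Cauchy by (metis half_gt_zero)
      have "norm (\<Sum>k=m..<n. dterm c s k) < d" if "m \<ge> K" for m n
        using dterm_block_le'[OF s, of c m "d / 2" n] K[OF that] \<open>d > 0\<close>
        by (fastforce simp: less_imp_le)
      then show "\<exists>N. \<forall>m\<ge>N. \<forall>n. norm (sum (dterm c s) {m..<n}) < d" by blast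
    qed
    then have "(\<lambda>n. (\<Sum>k<n. dterm c s k) - (\<Sum>k<N. dterm c s k)) \<longlonglongrightarrow> dseries c s - (\<Sum>k<N. dterm c s k)"
      unfolding dseries_def by (intro tendsto_intros summable_LIMSEQ)
    then have lim: "(\<lambda>n. norm ((\<Sum>k<n. dterm c s k) - (\<Sum>k<N. dterm c s k)))
        \<longlonglongrightarrow> norm (dseries c s - (\<Sum>k<N. dterm c s k))" by (rule tendsto_norm)
    have "norm (dseries c s - (\<Sum>k<N. dterm c s k)) \<le> e / 2"
    proof (rule LIMSEQ_le_const2[OF lim], intro exI[of _ N] allI impI)
      fix n assume "N \<le> n"
      then have "(\<Sum>k<n. dterm c s k) - (\<Sum>k<N. dterm c s k) = (\<Sum>k=N..<n. dterm c s k)"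
        using sum_diff_nat_ivl[of 0 N n "dterm c s"] by (simp add: atLeast0LessThan)
      then show "norm ((\<Sum>k<n. dterm c s k) - (\<Sum>k<N. dterm c s k)) \<le> e / 2"
        using block[OF N s] by simp
    qed
    then show ?thesis using \<open>e > 0\<close> by (simp add: dist_norm norm_minus_commute)
  qed
  then show "\<forall>\<^sub>F N in sequentially. \<forall>s\<in>{s0..}. dist (\<Sum>n<N. dterm c s n) (dseries c s) < e"
    unfolding eventually_sequentially by (intro exI[of _ M]) auto
qed

lemma dseries_sums:
  assumes "summable (dterm c s0)" "s \<ge> s0"
  shows "dterm c s sums dseries c s"
  unfolding sums_def using tendsto_uniform_limitI[OF uniform_limit_dseries[OF assms(1)], of s] assms
  by simp

lemma continuous_on_dseries:
  assumes "summable (dterm c s0)"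
  shows "continuous_on {s0..} (dseries c)"
proof (rule uniform_limit_theorem[OF _ uniform_limit_dseries[OF assms]])
  show "\<forall>\<^sub>F N in sequentially. continuous_on {s0..} (\<lambda>s. \<Sum>n<N. dterm c s n)"
    unfolding dterm_def by (intro always_eventually allI continuous_intros) auto
qed simp

lemma dseries_tendsto_at_top:
  assumes "summable (dterm c s0)"
  shows "(dseries c \<longlongrightarrow> c 1) at_top"
proof (rule swap_uniform_limit'[OF _ _ uniform_limit_dseries[OF assms]])
  have term0: "dterm c s 0 = c 1" for s by (simp add: dterm_def)
  have term_Suc: "(dterm' \<longlongrightarrow> 0) at_top" if "dterm' = (\<lambda>s. dterm c s (Suc n))" for n dterm'
  proof -
    have "((\<lambda>s. real (Suc (Suc n)) powr - s) \<longlongrightarrow> 0) at_top"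
      by real_asymp
    then have "((\<lambda>s. real (Suc (Suc n)) powr - s *\<^sub>R c (Suc (Suc n))) \<longlongrightarrow> 0 *\<^sub>R c (Suc (Suc n))) at_top"
      by (intro tendsto_intros)
    then show ?thesis using that by (simp add: dterm_def)
  qed
  have "((\<lambda>s. dterm c s 0 + (\<Sum>n<N. dterm c s (Suc n))) \<longlongrightarrow> c 1 + (\<Sum>n<N. 0)) at_top" for N
    unfolding term0 by (intro tendsto_intros term_Suc[OF refl])
  then have "((\<lambda>s. \<Sum>n<Suc N. dterm c s n) \<longlongrightarrow> c 1) at_top" for N
    unfolding sum.lessThan_Suc_shift by simp
  then have "((\<lambda>s. \<Sum>n<N. dterm c s n) \<longlongrightarrow> c 1) at_top" if "N \<ge> 1" for N
    using that by (cases N) auto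
  then show "\<forall>\<^sub>F N in sequentially. ((\<lambda>s. \<Sum>n<N. dterm c s n) \<longlongrightarrow> c 1) at_top"
    unfolding eventually_sequentially by blast
  show "\<forall>\<^sub>F s in at_top. s \<in> {s0..}" by (simp add: eventually_ge_at_top)
qed simp_all

lemma dseries_has_vector_derivative:
  assumes "summable (dterm c s0)" "summable (dterm (\<lambda>n. ln (real n) *\<^sub>R c n) s0)" "s \<ge> s0"
  shows "(dseries c has_vector_derivative - dseries (\<lambda>n. ln (real n) *\<^sub>R c n) s) (at s within {s0..})"
proof -
  let ?c' = "\<lambda>n. ln (real n) *\<^sub>R c n"
  have "\<exists>g. \<forall>s\<in>{s0..}. dterm c s sums g s \<and>
      (g has_derivative (\<lambda>h. h *\<^sub>R - dseries ?c' s)) (at s within {s0..})"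
  proof (rule has_derivative_series)
    fix n s
    have "((\<lambda>s. (real (Suc n) powr - s) *\<^sub>R c (Suc n)) has_vector_derivative
        (- ln (real (Suc n)) * real (Suc n) powr - s) *\<^sub>R c (Suc n)) (at s within {s0..})"
    proof -
      have "((\<lambda>s. real (Suc n) powr - s) has_vector_derivative
          - ln (real (Suc n)) * real (Suc n) powr - s) (at s within {s0..})"
        unfolding has_real_derivative_iff_has_vector_derivative[symmetric] powr_def
        by (rule derivative_eq_intros refl | simp)+
      then show ?thesis
        using has_vector_derivative_scaleR[OF _ has_vector_derivative_const[of "c (Suc n)"]]
        unfolding has_real_derivative_iff_has_vector_derivative[symmetric] by fastforce
    qed
    then show "((\<lambda>s. dterm c s n) has_derivative (\<lambda>h. h *\<^sub>R - dterm ?c' s n)) (at s within {s0..})"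
      by (simp add: dterm_def has_vector_derivative_def mult.commute)
  next
    fix e :: real assume "e > 0"
    with uniform_limit_dseries[OF assms(2)]
    have "\<forall>\<^sub>F N in sequentially. \<forall>s\<in>{s0..}. dist (\<Sum>n<N. dterm ?c' s n) (dseries ?c' s) < e"
      by (auto simp: uniform_limit_iff)
    then show "\<forall>\<^sub>F N in sequentially. \<forall>s\<in>{s0..}. \<forall>h.
        norm ((\<Sum>i<N. h *\<^sub>R - dterm ?c' s i) - h *\<^sub>R - dseries ?c' s) \<le> e * norm h"
    proof (rule eventually_mono, intro ballI allI)
      fix N s and h :: real
      assume "\<forall>s\<in>{s0..}. dist (\<Sum>n<N. dterm ?c' s n) (dseries ?c' s) < e" "s \<in> {s0..}"
      then have le: "norm ((\<Sum>n<N. dterm ?c' s n) - dseries ?c' s) \<le> e"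
        by (simp add: dist_norm less_imp_le)
      have "(\<Sum>i<N. h *\<^sub>R - dterm ?c' s i) - h *\<^sub>R - dseries ?c' s =
          - h *\<^sub>R ((\<Sum>n<N. dterm ?c' s n) - dseries ?c' s)"
        by (simp add: scaleR_sum_right sum_negf algebra_simps)
      then have "norm ((\<Sum>i<N. h *\<^sub>R - dterm ?c' s i) - h *\<^sub>R - dseries ?c' s) =
          \<bar>h\<bar> * norm ((\<Sum>n<N. dterm ?c' s n) - dseries ?c' s)" by simp
      also have "\<dots> \<le> \<bar>h\<bar> * e" by (rule mult_left_mono[OF le]) simp
      finally show "norm ((\<Sum>i<N. h *\<^sub>R - dterm ?c' s i) - h *\<^sub>R - dseries ?c' s) \<le> e * norm h"
        by (simp add: mult.commute)
    qed
  next
    show "dterm c s0 sums dseries c s0" using dseries_sums[OF assms(1)] by simp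
  qed auto
  then obtain g where g: "\<And>s. s \<ge> s0 \<Longrightarrow> dterm c s sums g s"
      "\<And>s. s \<ge> s0 \<Longrightarrow> (g has_derivative (\<lambda>h. h *\<^sub>R - dseries ?c' s)) (at s within {s0..})"
    by auto
  have eq: "g t = dseries c t" if "t \<ge> s0" for t
    using g(1)[OF that] by (simp add: dseries_def sums_iff)
  have "(dseries c has_derivative (\<lambda>h. h *\<^sub>R - dseries ?c' s)) (at s within {s0..})"
    by (rule has_derivative_transform[OF _ _ g(2)[OF assms(3)]]) (use eq assms(3) in auto)
  then show ?thesis by (simp add: has_vector_derivative_def)
qed

section \<open>Divisor sums\<close>

lemma dvd_pos_natD:
  fixes d n :: nat
  assumes "d dvd n" "n > 0"
  shows "d > 0" "n div d > 0" "d \<le> n" "d * (n div d) = n"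
  using assms by (auto intro: dvd_pos_nat dvd_imp_le simp: dvd_div_eq_0_iff Suc_le_eq elim!: dvdE)

lemma sum_divisors_swap:
  fixes F :: "nat \<Rightarrow> nat \<Rightarrow> 'a::comm_monoid_add"
  shows "(\<Sum>n=1..N. \<Sum>d | d dvd n. F d (n div d)) = (\<Sum>d=1..N. \<Sum>m=1..N div d. F d m)"
proof -
  have "(\<Sum>n=1..N. \<Sum>d | d dvd n. F d (n div d)) =
      (\<Sum>(n, d)\<in>Sigma {1..N} (\<lambda>n. {d. d dvd n}). F d (n div d))"
    by (rule sum.Sigma) (auto intro: finite_divisors_nat)
  also have "\<dots> = (\<Sum>(d, m)\<in>Sigma {1..N} (\<lambda>d. {1..N div d}). F d m)"
    by (rule sum.reindex_bij_witness[of _ "\<lambda>(d, m). (d * m, d)" "\<lambda>(n, d). (d, n div d)"])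
      (auto simp: Suc_le_eq dvd_pos_natD div_le_mono less_eq_div_iff_mult_less_eq mult.commute
        intro: order.trans[OF dvd_pos_natD(3)] order.trans[of _ "_ * _"])
  also have "\<dots> = (\<Sum>d=1..N. \<Sum>m=1..N div d. F d m)"
    by (rule sum.Sigma[symmetric]) auto
  finally show ?thesis .
qed

lemma has_sum_pairs_sums_divisors:
  fixes F :: "nat \<times> nat \<Rightarrow> 'a::{topological_comm_monoid_add, t3_space}"
  assumes "(F has_sum S) ({1..} \<times> {1..})"
  shows "(\<lambda>n. \<Sum>d | d dvd Suc n. F (d, Suc n div d)) sums S"
proof -
  have "((\<lambda>(n, d). F (d, Suc n div d)) has_sum S) (Sigma UNIV (\<lambda>n. {d. d dvd Suc n})) \<longleftrightarrow>
      (F has_sum S) ({1..} \<times> {1..})"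
    by (rule has_sum_reindex_bij_witness[of _ "\<lambda>(d, m). (d * m - 1, d)" "\<lambda>(n, d). (d, Suc n div d)"])
      (auto simp: Suc_le_eq dvd_pos_natD)
  with assms have "((\<lambda>(n, d). F (d, Suc n div d)) has_sum S) (Sigma UNIV (\<lambda>n. {d. d dvd Suc n}))"
    by simp
  then have "((\<lambda>n. \<Sum>d | d dvd Suc n. F (d, Suc n div d)) has_sum S) UNIV"
    by (rule has_sum_SigmaD) (auto intro!: has_sum_finiteI finite_divisors_nat)
  then show ?thesis by (rule has_sum_imp_sums)
qed

lemma has_sum_shift_atLeast_1:
  fixes f :: "nat \<Rightarrow> 'a::topological_comm_monoid_add"
  shows "(f has_sum S) {1..} \<longleftrightarrow> ((\<lambda>n. f (Suc n)) has_sum S) UNIV"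
  by (rule has_sum_reindex_bij_witness[of _ Suc "\<lambda>n. n - 1"]) auto

lemma dseries_convolution:
  fixes b g :: "nat \<Rightarrow> complex"
  assumes b: "summable (\<lambda>n. norm (dterm b s n))" and g: "summable (\<lambda>n. norm (dterm g s n))"
    and a: "\<And>n. n > 0 \<Longrightarrow> a n = (\<Sum>d | d dvd n. b d * g (n div d))"
  shows "dseries b s * dseries g s = dseries a s"
proof -
  define u v where "u n = (real n powr - s) *\<^sub>R b n" and "v n = (real n powr - s) *\<^sub>R g n" for n
  have u_Suc: "u (Suc n) = dterm b s n" and v_Suc: "v (Suc n) = dterm g s n" for n
    by (simp_all add: u_def v_def dterm_def)
  have u: "(u has_sum dseries b s) {1..}" and v: "(v has_sum dseries g s) {1..}"
    unfolding has_sum_shift_atLeast_1 u_Suc v_Suc dseries_def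
    by (rule norm_summable_imp_has_sum[OF b summable_sums[OF summable_norm_cancel[OF b]]])
      (rule norm_summable_imp_has_sum[OF g summable_sums[OF summable_norm_cancel[OF g]]])
  have nu: "((\<lambda>n. norm (u n)) has_sum (\<Sum>n. norm (dterm b s n))) {1..}"
    and nv: "((\<lambda>n. norm (v n)) has_sum (\<Sum>n. norm (dterm g s n))) {1..}"
    unfolding has_sum_shift_atLeast_1 u_Suc v_Suc using b g
    by (simp_all add: norm_summable_imp_has_sum summable_sums)
  have "(\<lambda>(d, m). norm (u d * v m)) summable_on ({1..} \<times> {1..})"
  proof (rule summable_on_SigmaI)
    show "((\<lambda>m. case (d, m) of (d, m) \<Rightarrow> norm (u d * v m)) has_sum
        norm (u d) * (\<Sum>n. norm (dterm g s n))) {1..}" for d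
      using has_sum_cmult_right[OF nv, of "norm (u d)"] by (simp add: norm_mult)
    show "(\<lambda>d. norm (u d) * (\<Sum>n. norm (dterm g s n))) summable_on {1..}"
      using has_sum_cmult_left[OF nu, of "\<Sum>n. norm (dterm g s n)"] by (rule has_sum_imp_summable)
  qed auto
  moreover have "(\<lambda>(d, m). norm (u d * v m)) = (\<lambda>x. norm (case x of (d, m) \<Rightarrow> u d * v m))"
    by (simp add: fun_eq_iff split: prod.split)
  ultimately have "(\<lambda>(d, m). u d * v m) summable_on ({1..} \<times> {1..})"
    by (simp only: abs_summable_summable)
  moreover have "((\<lambda>m. case (d, m) of (d, m) \<Rightarrow> u d * v m) has_sum u d * dseries g s) {1..}" for d
    using has_sum_cmult_right[OF v, of "u d"] by simp
  moreover have "((\<lambda>d. u d * dseries g s) has_sum dseries b s * dseries g s) {1..}"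
    by (rule has_sum_cmult_left[OF u])
  ultimately have "((\<lambda>(d, m). u d * v m) has_sum dseries b s * dseries g s) ({1..} \<times> {1..})"
    by (intro has_sum_SigmaI) auto
  then have "(\<lambda>n. \<Sum>d | d dvd Suc n. u d * v (Suc n div d)) sums (dseries b s * dseries g s)"
    using has_sum_pairs_sums_divisors by fastforce
  moreover have "(\<Sum>d | d dvd Suc n. u d * v (Suc n div d)) = dterm a s n" for n
  proof -
    have "u d * v (Suc n div d) = (real (Suc n) powr - s) *\<^sub>R (b d * g (Suc n div d))"
      if "d dvd Suc n" for d
    proof -
      have "real (Suc n) = real d * real (Suc n div d)"
        using that by (simp only: of_nat_mult[symmetric] dvd_mult_div_cancel)
      then have "real (Suc n) powr - s = real d powr - s * real (Suc n div d) powr - s"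
        by (simp only: powr_mult of_nat_0_le_iff)
      then show ?thesis by (simp only: u_def v_def mult_scaleR_left mult_scaleR_right scaleR_scaleR mult.commute)
    qed
    then show ?thesis using a[of "Suc n"] by (simp add: dterm_def scaleR_sum_right)
  qed
  ultimately show ?thesis by (simp add: dseries_def sums_iff)
qed

section \<open>Logarithms of Dirichlet series with bounded partial sums\<close>

text \<open>
  The coefficients \<open>b\<close> are those of \<open>-L'/L\<close>, where \<open>L(s) = \<Sum>n. g(n) n powr -s\<close>.  Bounded partial sums of
  \<open>g\<close> make \<open>L\<close> converge at \<open>s = 1\<close>, and the linear bound on \<open>\<Sum>n\<le>N. |b(n)|\<close> is Chebyshev's bound in the
  applications: nonprincipal characters with \<open>b = \<chi> \<Lambda>\<close>, and the alternating zeta function.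
\<close>

locale dirichlet_log =
  fixes g b :: "nat \<Rightarrow> complex" and A C :: real
  assumes g_1: "g (Suc 0) = 1"
    and norm_g_le: "norm (g n) \<le> 1"
    and partial_sum_le: "norm (\<Sum>n<N. g (Suc n)) \<le> A"
    and ln_convolution: "n > 0 \<Longrightarrow> ln (real n) *\<^sub>R g n = (\<Sum>d | d dvd n. b d * g (n div d))"
    and sum_norm_b_le: "(\<Sum>n<N. norm (b (Suc n))) \<le> C * real N"
begin

definition logc :: "nat \<Rightarrow> complex" where
  "logc n = b n /\<^sub>R ln (real n)"

lemma b_1: "b (Suc 0) = 0"
  using ln_convolution[of 1] g_1 by simp

lemma summable_g: "summable (dterm g 1)"
proof -
  have "(\<lambda>n. real (Suc n) powr - 1) \<longlonglongrightarrow> 0" by real_asymp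
  then have "summable (\<lambda>n. (real (Suc n) powr - 1) *\<^sub>R g (Suc n))"
    by (rule summable_Dirichlet_test[OF decseq_powr_Suc[OF zero_le_one] _ partial_sum_le])
  then show ?thesis by (simp only: dterm_def[abs_def])
qed

lemma summable_ln_g: "summable (dterm (\<lambda>n. ln (real n) *\<^sub>R g n) 1)"
proof -
  \<comment> \<open>\<open>ln x / x\<close> increases up to \<open>x = e\<close>, but \<open>(1 + ln x) / x\<close> decreases for all \<open>x \<ge> 1\<close>.\<close>
  define w where "w n = (1 + ln (real (Suc n))) / real (Suc n)" for n
  have "w n \<le> w m" if "m \<le> n" for m n
  proof -
    define x y where "x = real (Suc m)" and "y = real (Suc n)"
    have xy: "1 \<le> x" "x \<le> y" using that by (simp_all add: x_def y_def)
    have "ln y = ln x + ln (y / x)" using xy by (simp add: ln_div)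
    also have "ln (y / x) \<le> y / x - 1" using xy by (intro ln_le_minus_one) simp
    finally have "x * (1 + ln y) \<le> x * (1 + (ln x + (y / x - 1)))" using xy by simp
    also have "\<dots> = x * ln x + y" using xy by (simp add: field_simps)
    also have "\<dots> \<le> y * ln x + y" using xy by (simp add: mult_right_mono)
    finally have "(1 + ln y) / y \<le> (1 + ln x) / x" using xy by (simp add: field_simps)
    then show ?thesis by (simp only: w_def x_def y_def)
  qed
  then have "decseq w" by (simp add: decseq_def)
  moreover have "w \<longlonglongrightarrow> 0" unfolding w_def by real_asymp
  ultimately have "summable (\<lambda>n. w n *\<^sub>R g (Suc n))"
    by (rule summable_Dirichlet_test[OF _ _ partial_sum_le])
  then have "summable (\<lambda>n. w n *\<^sub>R g (Suc n) - dterm g 1 n)"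
    by (rule summable_diff[OF _ summable_g])
  moreover have "w n *\<^sub>R g (Suc n) - dterm g 1 n = dterm (\<lambda>n. ln (real n) *\<^sub>R g n) 1 n" for n
    by (simp add: w_def dterm_def scaleR_diff_left[symmetric] powr_minus field_simps
        diff_divide_distrib[symmetric] del: of_nat_Suc)
  ultimately show ?thesis by simp
qed

lemma summable_norm_g:
  assumes "s > 1"
  shows "summable (\<lambda>n. norm (dterm g s n))"
proof (rule summable_comparison_test')
  show "summable (\<lambda>n. real (Suc n) powr - s)"
    using assms summable_Suc_iff[of "\<lambda>n. real n powr - s"] summable_real_powr_iff[of "- s"] by simp
  show "norm (norm (dterm g s n)) \<le> real (Suc n) powr - s" if "n \<ge> 0" for n
    using norm_g_le[of "Suc n"] mult_left_mono[of "norm (g (Suc n))" 1 "real (Suc n) powr - s"]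
    by (simp add: dterm_def del: of_nat_Suc)
qed

lemma summable_norm_b:
  assumes "s > 1"
  shows "summable (\<lambda>n. norm (dterm b s n))"
proof (rule summableI_nonneg_bounded)
  have sw: "summable (\<lambda>n. real (Suc n) powr - s)"
    using assms summable_Suc_iff[of "\<lambda>n. real n powr - s"] summable_real_powr_iff[of "- s"] by simp
  fix N
  have "(\<Sum>n<N. norm (dterm b s n)) = (\<Sum>n<N. real (Suc n) powr - s * norm (b (Suc n)))"
    by (simp add: dterm_def del: of_nat_Suc)
  also have "\<dots> \<le> (\<Sum>n<N. real (Suc n) powr - s * C)"
    by (rule weighted_sum_mono[OF decseq_powr_Suc])
      (use assms sum_norm_b_le in \<open>simp_all add: mult.commute del: of_nat_Suc\<close>)
  also have "\<dots> = C * (\<Sum>n<N. real (Suc n) powr - s)" by (simp add: sum_distrib_left mult.commute)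
  also have "\<dots> \<le> C * (\<Sum>n. real (Suc n) powr - s)"
  proof (rule mult_left_mono)
    show "(\<Sum>n<N. real (Suc n) powr - s) \<le> (\<Sum>n. real (Suc n) powr - s)"
      by (rule sum_le_suminf[OF sw]) auto
    show "0 \<le> C" using sum_norm_b_le[of 1] order.trans[OF norm_ge_zero] by simp
  qed
  finally show "(\<Sum>n<N. norm (dterm b s n)) \<le> C * (\<Sum>n. real (Suc n) powr - s)" .
qed auto

lemma summable_norm_logc:
  assumes "s > 1"
  shows "summable (\<lambda>n. norm (dterm logc s n))"
proof (rule summable_comparison_test')
  show "summable (\<lambda>n. norm (dterm b s n) / ln 2)"
    by (rule summable_divide[OF summable_norm_b[OF assms]])
  show "norm (norm (dterm logc s n)) \<le> norm (dterm b s n) / ln 2" if "n \<ge> 0" for n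
  proof (cases "n = 0")
    case False
    then have "ln 2 \<le> ln (real (Suc n))" by simp
    then have "inverse (ln (real (Suc n))) \<le> inverse (ln 2)" by (intro le_imp_inverse_le) simp_all
    then have "inverse (ln (real (Suc n))) * norm (dterm b s n) \<le> inverse (ln 2) * norm (dterm b s n)"
      by (rule mult_right_mono) simp
    moreover have "norm (norm (dterm logc s n)) = inverse (ln (real (Suc n))) * norm (dterm b s n)"
      using \<open>ln 2 \<le> _\<close> by (simp add: dterm_def logc_def del: of_nat_Suc)
    ultimately show ?thesis by (simp add: divide_inverse mult.commute)
  qed (simp add: dterm_def logc_def)
qed

lemma summable_logc: "s > 1 \<Longrightarrow> summable (dterm logc s)"
  using summable_norm_logc summable_norm_cancel by blast

lemma dterm_ln_logc: "dterm (\<lambda>n. ln (real n) *\<^sub>R logc n) s = dterm b s"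
proof
  fix n
  have "ln (real (Suc n)) *\<^sub>R logc (Suc n) = b (Suc n)"
    by (cases "n = 0") (simp_all add: b_1 logc_def)
  then show "dterm (\<lambda>n. ln (real n) *\<^sub>R logc n) s n = dterm b s n" by (simp add: dterm_def)
qed

lemma logc_1: "logc 1 = 0"
  by (simp add: logc_def)

text \<open>
  The convolution identity says \<open>- L'(s) = L(s) (\<Sum>n. b(n) n powr -s)\<close>, that is, \<open>L exp(-f)\<close> is constant for
  \<open>f(s) = \<Sum>n. b(n)/ln n n powr -s\<close>.  As \<open>s \<rightarrow> \<infinity>\<close> it tends to \<open>1\<close>.
\<close>

lemma exp_dseries_logc:
  assumes s: "s > 1"
  shows "exp (dseries logc s) = dseries g s"
proof -
  \<comment> \<open>On \<open>[s0,\<infinity>)\<close> with \<open>1 < s0 < s\<close> all series involved converge, so they may be differentiated termwise.\<close>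
  define s0 where "s0 = (1 + s) / 2"
  have s0: "s0 > 1" "s0 \<le> s" using s by (simp_all add: s0_def)
  let ?F = "\<lambda>t. exp (- dseries logc t) * dseries g t"
  have deriv: "(?F has_derivative (\<lambda>h. 0)) (at t within {s0..})" if t: "t \<in> {s0..}" for t
  proof -
    have t1: "t > 1" using t s0 by simp
    have sg: "summable (dterm g s0)" "summable (dterm (\<lambda>n. ln (real n) *\<^sub>R g n) s0)"
      using dseries_sums[OF summable_g, of s0] dseries_sums[OF summable_ln_g, of s0] s0
      by (simp_all add: sums_iff)
    have sb: "summable (dterm (\<lambda>n. ln (real n) *\<^sub>R logc n) s0)"
      unfolding dterm_ln_logc using summable_norm_b[OF s0(1)] by (rule summable_norm_cancel)
    have ts: "s0 \<le> t" using t by simp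
    note Dg = dseries_has_vector_derivative[OF sg ts]
    note Df = dseries_has_vector_derivative[OF summable_logc[OF s0(1)] sb ts]
    have De: "((\<lambda>z. exp (- z)) has_field_derivative - exp (- dseries logc t))
        (at (dseries logc t) within dseries logc ` {s0..})"
      by (auto intro!: derivative_eq_intros)
    have "((\<lambda>t. exp (- dseries logc t)) has_vector_derivative
        - dseries (\<lambda>n. ln (real n) *\<^sub>R logc n) t * - exp (- dseries logc t)) (at t within {s0..})"
      using field_vector_diff_chain_within[OF Df De] by (simp add: o_def)
    then have "(?F has_vector_derivative
        exp (- dseries logc t) * - dseries (\<lambda>n. ln (real n) *\<^sub>R g n) t +
        (- dseries (\<lambda>n. ln (real n) *\<^sub>R logc n) t * - exp (- dseries logc t)) * dseries g t)
        (at t within {s0..})"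
      by (rule has_vector_derivative_mult[OF _ Dg])
    moreover have conv: "dseries (\<lambda>n. ln (real n) *\<^sub>R g n) t = dseries b t * dseries g t"
      by (rule dseries_convolution[symmetric, OF summable_norm_b[OF t1] summable_norm_g[OF t1] ln_convolution])
    moreover have "dseries (\<lambda>n. ln (real n) *\<^sub>R logc n) t = dseries b t"
      by (simp add: dseries_def dterm_ln_logc)
    moreover have "e * - (v * w) + (- v * - e) * w = 0" for e v w :: complex
      by (simp add: algebra_simps)
    ultimately have "(?F has_vector_derivative 0) (at t within {s0..})" by (simp only:)
    then show ?thesis by (simp only: has_vector_derivative_def scaleR_zero_right)
  qed
  from has_derivative_zero_constant[OF convex_real_interval(1) deriv]
  obtain k where "\<forall>t\<in>{s0..}. ?F t = k" ..
  then have k: "?F t = k" if "t \<ge> s0" for t using that by (simp only: atLeast_iff Ball_def)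
  have "(?F \<longlongrightarrow> exp (- logc 1) * g 1) at_top"
    using summable_logc[OF s0(1)] summable_g by (intro tendsto_intros dseries_tendsto_at_top)
  moreover have "(?F \<longlongrightarrow> k) at_top"
    by (rule tendsto_eventually) (rule eventually_mono[OF eventually_ge_at_top[of s0] k])
  ultimately have "exp (- logc 1) * g 1 = k" by (rule tendsto_unique[OF trivial_limit_at_top_linorder])
  then have "k = 1" using g_1 by (simp add: logc_1[simplified])
  then have "exp (dseries logc s) * (exp (- dseries logc s) * dseries g s) = exp (dseries logc s)"
    using k[OF s0(2)] by simp
  then show ?thesis by (simp only: mult.assoc[symmetric] exp_minus_inverse mult_1_left)
qed

lemma g_tail_le: "norm (dseries g 1 - (\<Sum>n<M. dterm g 1 n)) \<le> 2 * A / real (Suc M)"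
proof -
  have dterm_g: "dterm g 1 k = (real (Suc k) powr - 1) *\<^sub>R g (Suc k)" for k by (simp add: dterm_def)
  have "(\<lambda>n. (\<Sum>k<n. dterm g 1 k) - (\<Sum>k<M. dterm g 1 k)) \<longlonglongrightarrow> dseries g 1 - (\<Sum>k<M. dterm g 1 k)"
    unfolding dseries_def by (intro tendsto_intros summable_LIMSEQ summable_g)
  then have lim: "(\<lambda>n. norm ((\<Sum>k<n. dterm g 1 k) - (\<Sum>k<M. dterm g 1 k)))
      \<longlonglongrightarrow> norm (dseries g 1 - (\<Sum>k<M. dterm g 1 k))" by (rule tendsto_norm)
  show ?thesis
  proof (rule LIMSEQ_le_const2[OF lim], intro exI[of _ M] allI impI)
    fix n assume "M \<le> n"
    then have "(\<Sum>k<n. dterm g 1 k) - (\<Sum>k<M. dterm g 1 k) = (\<Sum>k=M..<n. dterm g 1 k)"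
      using sum_diff_nat_ivl[of 0 M n "dterm g 1"] by (simp add: atLeast0LessThan)
    also have "norm \<dots> \<le> real (Suc M) powr - 1 * (2 * A)"
      unfolding dterm_g
      by (rule norm_weighted_block_le[OF decseq_powr_Suc _ norm_block_le_of_partial_sums[OF partial_sum_le]]) auto
    finally show "norm ((\<Sum>k<n. dterm g 1 k) - (\<Sum>k<M. dterm g 1 k)) \<le> 2 * A / real (Suc M)"
      by (simp add: powr_minus field_simps del: of_nat_Suc)
  qed
qed

lemma sum_dterm: "(\<Sum>n<N. dterm c 1 n) = (\<Sum>n=1..N. c n /\<^sub>R real n)"
  by (rule sum.reindex_bij_witness[of _ "\<lambda>n. n - 1" Suc]) (auto simp: dterm_def powr_minus)

text \<open>
  Summing \<open>g(n) ln n / n = \<Sum>dm=n. (b(d)/d) (g(m)/m)\<close> over \<open>n \<le> N\<close> and replacing the inner partial sums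
  by their limit \<open>L(1)\<close>, at a cost of \<open>O(d/N)\<close> each, gives \<open>L(1) (\<Sum>d\<le>N. b(d)/d) = O(1)\<close>.  This is the
  step of Mertens that turns \<open>L(1) \<noteq> 0\<close> into information on primes.
\<close>

lemma bounded_partial_sums_b:
  assumes nonzero: "dseries g 1 \<noteq> 0"
  shows "\<exists>K. \<forall>N. norm (\<Sum>n<N. dterm b 1 n) \<le> K"
proof -
  define L where "L = dseries g 1"
  obtain K1 where K1: "\<And>N. norm (\<Sum>n<N. dterm (\<lambda>n. ln (real n) *\<^sub>R g n) 1 n) \<le> K1"
    using summable_imp_sums_bounded[OF summable_ln_g] unfolding bounded_iff by blast
  have A: "A \<ge> 0" using partial_sum_le[of 0] by simp
  have "norm (\<Sum>n<N. dterm b 1 n) \<le> (K1 + 2 * A * C) / norm L" for N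
  proof (cases "N = 0")
    case True
    have "C \<ge> 0" using sum_norm_b_le[of 1] order.trans[OF norm_ge_zero] by simp
    moreover have "K1 \<ge> 0" using K1[of 0] by simp
    ultimately show ?thesis using True A by simp
  next
    case False
    define G where "G M = (\<Sum>m=1..M. g m /\<^sub>R real m)" for M
    have tail: "norm (L - G M) \<le> 2 * A / real (Suc M)" for M
      using g_tail_le[of M] by (simp add: L_def G_def sum_dterm)
    have "(\<Sum>n<N. dterm (\<lambda>n. ln (real n) *\<^sub>R g n) 1 n) =
        (\<Sum>n=1..N. \<Sum>d | d dvd n. (b d /\<^sub>R real d) * (g (n div d) /\<^sub>R real (n div d)))"
      unfolding sum_dterm
    proof (rule sum.cong[OF refl])
      fix n assume n: "n \<in> {1..N}"
      have "(b d /\<^sub>R real d) * (g (n div d) /\<^sub>R real (n div d)) = (b d * g (n div d)) /\<^sub>R real n"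
        if "d dvd n" for d
      proof -
        have "real n = real d * real (n div d)"
          using that by (simp only: of_nat_mult[symmetric] dvd_mult_div_cancel)
        then show ?thesis by (simp add: mult.commute)
      qed
      then have "(\<Sum>d | d dvd n. (b d /\<^sub>R real d) * (g (n div d) /\<^sub>R real (n div d))) =
          (\<Sum>d | d dvd n. (b d * g (n div d)) /\<^sub>R real n)"
        by (intro sum.cong refl) blast
      then show "(ln (real n) *\<^sub>R g n) /\<^sub>R real n =
          (\<Sum>d | d dvd n. (b d /\<^sub>R real d) * (g (n div d) /\<^sub>R real (n div d)))"
        using n ln_convolution[of n] by (simp add: scaleR_sum_right)
    qed
    also have "\<dots> = (\<Sum>d=1..N. (b d /\<^sub>R real d) * G (N div d))"
      by (subst sum_divisors_swap[of "\<lambda>d m. (b d /\<^sub>R real d) * (g m /\<^sub>R real m)"])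
        (simp only: G_def sum_distrib_left)
    finally have main: "(\<Sum>d=1..N. (b d /\<^sub>R real d) * G (N div d)) =
        (\<Sum>n<N. dterm (\<lambda>n. ln (real n) *\<^sub>R g n) 1 n)" by simp
    have "L * (\<Sum>d=1..N. b d /\<^sub>R real d) = (\<Sum>d=1..N. (b d /\<^sub>R real d) * G (N div d)) +
        (\<Sum>d=1..N. (b d /\<^sub>R real d) * (L - G (N div d)))"
      by (simp add: sum_distrib_left sum.distrib[symmetric] algebra_simps)
    also have "norm \<dots> \<le> K1 + 2 * A * C"
    proof (rule norm_triangle_mono)
      show "norm (\<Sum>d=1..N. (b d /\<^sub>R real d) * G (N div d)) \<le> K1" unfolding main by (rule K1)
      have "norm (\<Sum>d=1..N. (b d /\<^sub>R real d) * (L - G (N div d))) \<le> (\<Sum>d=1..N. norm (b d) * (2 * A / real N))"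
      proof (rule sum_norm_le)
        fix d assume d: "d \<in> {1..N}"
        have "N < d * Suc (N div d)" using d dividend_less_times_div[of d N] by simp
        then have "real N \<le> real d * real (Suc (N div d))"
          by (simp only: of_nat_mult[symmetric] of_nat_le_iff less_imp_le)
        then have "2 * A / (real d * real (Suc (N div d))) \<le> 2 * A / real N"
          using A False by (intro divide_left_mono) (auto intro!: mult_pos_pos)
        moreover have "norm (L - G (N div d)) / real d \<le> 2 * A / real (Suc (N div d)) / real d"
          using tail by (rule divide_right_mono) simp
        ultimately have "norm (L - G (N div d)) / real d \<le> 2 * A / real N" by (simp add: mult.commute)
        then have "norm (b d) * (norm (L - G (N div d)) / real d) \<le> norm (b d) * (2 * A / real N)"
          by (rule mult_left_mono) simp
        then show "norm ((b d /\<^sub>R real d) * (L - G (N div d))) \<le> norm (b d) * (2 * A / real N)"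
          by (simp only: norm_mult norm_scaleR norm_inverse norm_of_nat abs_inverse abs_of_nat
              divide_inverse mult_ac)
      qed
      also have "\<dots> = (\<Sum>n<N. norm (b (Suc n))) * (2 * A / real N)"
        unfolding sum_distrib_right by (rule sum.reindex_bij_witness[of _ Suc "\<lambda>n. n - 1"]) auto
      also have "\<dots> \<le> (C * real N) * (2 * A / real N)"
        using sum_norm_b_le[of N] A by (intro mult_right_mono) auto
      also have "\<dots> = 2 * A * C" using False by simp
      finally show "norm (\<Sum>d=1..N. (b d /\<^sub>R real d) * (L - G (N div d))) \<le> 2 * A * C" .
    qed
    finally show ?thesis
      using nonzero by (simp add: sum_dterm norm_mult L_def field_simps)
  qed
  then show ?thesis by blast
qed

lemma summable_logc_1:
  assumes nonzero: "dseries g 1 \<noteq> 0"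
  shows "summable (dterm logc 1)"
proof -
  \<comment> \<open>\<open>1 / ln 1 = 0\<close> would spoil monotonicity; the first term vanishes since \<open>b 1 = 0\<close>, so any weight will do there.\<close>
  define w where "w n = inverse (ln (real (max 2 (Suc n))))" for n
  have "decseq w" unfolding decseq_def w_def by (auto intro!: le_imp_inverse_le)
  moreover have "w \<longlonglongrightarrow> 0"
  proof (rule Lim_transform_eventually)
    show "(\<lambda>n. inverse (ln (real (Suc n)))) \<longlonglongrightarrow> 0" by real_asymp
    show "\<forall>\<^sub>F n in sequentially. inverse (ln (real (Suc n))) = w n"
      using eventually_ge_at_top[of 1] by eventually_elim (simp add: w_def max_def)
  qed
  moreover obtain K where "\<And>N. norm (\<Sum>n<N. dterm b 1 n) \<le> K"
    using bounded_partial_sums_b[OF nonzero] by blast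
  ultimately have "summable (\<lambda>n. w n *\<^sub>R dterm b 1 n)" by (rule summable_Dirichlet_test)
  moreover have "w n *\<^sub>R dterm b 1 n = dterm logc 1 n" for n
    by (cases "n = 0") (auto simp: w_def dterm_def logc_def b_1 max_def mult.commute)
  ultimately show ?thesis by simp
qed

text \<open>
  Abel's theorem: both series converge at \<open>1\<close>, hence are continuous there from the right, and the
  identity for \<open>s > 1\<close> passes to the limit.
\<close>

lemma exp_dseries_logc_ge_1:
  assumes nonzero: "dseries g 1 \<noteq> 0" and s: "s \<ge> 1"
  shows "exp (dseries logc s) = dseries g s"
proof (cases "s = 1")
  case True
  have right: "(dseries c \<longlongrightarrow> dseries c 1) (at_right 1)" if "summable (dterm c 1)" for c
    by (rule continuous_on_Icc_at_rightD[of 1 2])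
      (use continuous_on_subset[OF continuous_on_dseries[OF that]] in auto)
  have "((\<lambda>s. exp (dseries logc s)) \<longlongrightarrow> exp (dseries logc 1)) (at_right 1)"
    by (intro tendsto_intros right summable_logc_1 nonzero)
  moreover have "\<forall>\<^sub>F s in at_right 1. exp (dseries logc s) = dseries g s"
    using eventually_at_right_less by eventually_elim (rule exp_dseries_logc)
  ultimately have "(dseries g \<longlongrightarrow> exp (dseries logc 1)) (at_right 1)"
    by (rule Lim_transform_eventually)
  then show ?thesis using right[OF summable_g] True by (auto dest: tendsto_unique[rotated])
qed (use s exp_dseries_logc in auto)

text \<open>
  If \<open>L(1) = 0\<close> this says \<open>L(s) = O(s - 1)\<close>, the form in which a zero at \<open>1\<close> is used below.
\<close>

lemma dseries_g_Lipschitz: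
  "\<exists>K. \<forall>s\<in>{1..2}. norm (dseries g s - dseries g 1) \<le> K * (s - 1)"
proof -
  let ?D = "dseries (\<lambda>n. ln (real n) *\<^sub>R g n)"
  have "compact (?D ` {1..2})"
    by (intro compact_continuous_image continuous_on_subset[OF continuous_on_dseries[OF summable_ln_g]]) auto
  then have "\<exists>K. \<forall>s\<in>{1..2}. norm (?D s) \<le> K"
    using compact_imp_bounded[of "?D ` {1..2}"] unfolding bounded_iff by simp
  then obtain K where "\<forall>s\<in>{1..2}. norm (?D s) \<le> K" ..
  then have K: "norm (?D s) \<le> K" if "s \<in> {1..2}" for s using that by (rule bspec)
  have "norm (dseries g s - dseries g 1) \<le> K * norm (s - 1)" if s: "s \<in> {1..2}" for s
  proof (rule differentiable_bound[of "{1..2}"])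
    fix t :: real assume t: "t \<in> {1..2}"
    have "(dseries g has_vector_derivative - ?D t) (at t within {1..2})"
      using dseries_has_vector_derivative[OF summable_g summable_ln_g, of t] t
      by (auto intro: has_vector_derivative_within_subset)
    then show "(dseries g has_derivative (\<lambda>h. h *\<^sub>R - ?D t)) (at t within {1..2})"
      by (simp add: has_vector_derivative_def)
    show "onorm (\<lambda>h. h *\<^sub>R - ?D t) \<le> K"
    proof (rule onorm_bound)
      show "0 \<le> K" using K[OF t] norm_ge_zero order.trans by blast
      show "norm (h *\<^sub>R - ?D t) \<le> K * norm h" for h
        using mult_left_mono[OF K[OF t], of "\<bar>h\<bar>"] by (simp add: mult.commute)
    qed
  qed (use s in auto)
  then show ?thesis by (intro exI[of _ K]) auto
qed

end

section \<open>Chebyshev's upper bound\<close>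

lemma sum_ln_eq_sum_mangoldt:
  "(\<Sum>n=1..N. ln (real n)) = (\<Sum>d=1..N. mangoldt d * real (N div d))"
proof -
  have "(\<Sum>n=1..N. ln (real n)) = (\<Sum>n=1..N. \<Sum>d | d dvd n. mangoldt d)"
    by (rule sum.cong[OF refl]) (use mangoldt_sum[where 'a = real] in auto)
  also have "\<dots> = (\<Sum>d=1..N. mangoldt d * real (N div d))"
    by (subst sum_divisors_swap[of "\<lambda>d m. mangoldt d"]) (simp add: mult.commute)
  finally show ?thesis .
qed

text \<open>
  Each \<open>d\<close> with \<open>n < d \<le> 2n\<close> has \<open>2n div d - 2 (n div d) = 1\<close>, and this difference is nonnegative for all \<open>d\<close>.
  Hence \<open>\<psi>(2n) - \<psi>(n) \<le> ln ((2n)!/(n!)\<^sup>2) = ln (2n choose n) \<le> 2n ln 2\<close>.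
\<close>

lemma sum_mangoldt_dyadic_le:
  "(\<Sum>d=n+1..2*n. mangoldt d) \<le> 2 * real n * ln 2"
proof -
  have ln_fact: "ln (fact N) = (\<Sum>k=1..N. ln (real k))" for N
    by (induction N) (simp_all add: ln_mult)
  have "(\<Sum>d=n+1..2*n. mangoldt d) =
      (\<Sum>d=1..2*n. if d > n then mangoldt d else 0 :: real)"
    by (rule sum.mono_neutral_cong_left) auto
  also have "\<dots> \<le> (\<Sum>d=1..2*n. mangoldt d * (real (2 * n div d) - 2 * real (n div d)))"
  proof (rule sum_mono)
    fix d assume d: "d \<in> {1..2*n}"
    have "2 * (n div d) \<le> 2 * n div d"
      using d by (simp add: less_eq_div_iff_mult_less_eq)
    then have ge: "2 * real (n div d) \<le> real (2 * n div d)"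
      by (metis of_nat_le_iff of_nat_mult of_nat_numeral)
    show "(if d > n then mangoldt d else 0) \<le> mangoldt d * (real (2 * n div d) - 2 * real (n div d))"
    proof (cases "d > n")
      case True
      then have "2 * n div d = 1" "n div d = 0"
        using d by (auto intro!: div_nat_eqI)
      then show ?thesis using True by simp
    next
      case False
      then show ?thesis using ge mangoldt_nonneg[of d] by simp
    qed
  qed
  also have "\<dots> = (\<Sum>d=1..2*n. mangoldt d * real (2 * n div d)) - 2 * (\<Sum>d=1..2*n. mangoldt d * real (n div d))"
    by (simp add: algebra_simps sum_subtractf sum_distrib_left)
  also have "(\<Sum>d=1..2*n. mangoldt d * real (n div d)) = (\<Sum>d=1..n. mangoldt d * real (n div d))"
    by (rule sum.mono_neutral_right) auto
  also have "(\<Sum>d=1..2*n. mangoldt d * real (2 * n div d)) = ln (fact (2 * n))"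
    by (simp only: sum_ln_eq_sum_mangoldt[symmetric] ln_fact)
  also have "(\<Sum>d=1..n. mangoldt d * real (n div d)) = ln (fact n)"
    by (simp only: sum_ln_eq_sum_mangoldt[symmetric] ln_fact)
  also have "ln (fact (2 * n)) - 2 * ln (fact n) = ln (real (2 * n choose n))"
  proof -
    have "(fact (2 * n) :: real) = fact n * fact n * real (2 * n choose n)"
      using binomial_fact[of n "2 * n", where 'a = real] by (simp add: mult_2)
    then show ?thesis by (simp add: ln_mult)
  qed
  also have "\<dots> \<le> ln (2 ^ (2 * n))"
  proof -
    have "real (2 * n choose n) \<le> real (2 ^ (2 * n))"
      using binomial_le_pow2[of "2 * n" n] by (simp only: of_nat_le_iff)
    moreover have "real (2 * n choose n) > 0" by simp
    ultimately show ?thesis by simp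
  qed
  also have "\<dots> = 2 * real n * ln 2" by (simp add: ln_realpow)
  finally show ?thesis .
qed

lemma chebyshev_psi_le: "(\<Sum>n=1..N. mangoldt n) \<le> 4 * ln 2 * real N"
proof (induction N rule: less_induct)
  case (less N)
  show ?case
  proof (cases "N \<le> 1")
    case True
    then show ?thesis by (cases N) auto
  next
    case False
    \<comment> \<open>Rounding up gives \<open>N \<le> 2 n\<close>; the loss is absorbed by taking \<open>4 ln 2\<close> instead of \<open>2 ln 2\<close>.\<close>
    define n where "n = (N + 1) div 2"
    have n: "n < N" "N \<le> 2 * n" "2 * n \<le> N + 1" using False by (auto simp: n_def)
    have "(\<Sum>d=1..N. mangoldt d) \<le> (\<Sum>d=1..2*n. mangoldt d :: real)"
      by (rule sum_mono2) (use n mangoldt_nonneg in auto)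
    also have "{1..2*n} = {1..n} \<union> {n+1..2*n}" by auto
    also have "sum (mangoldt :: nat \<Rightarrow> real) ({1..n} \<union> {n+1..2*n}) =
        (\<Sum>d=1..n. mangoldt d) + (\<Sum>d=n+1..2*n. mangoldt d)"
      by (rule sum.union_disjoint) auto
    also have "\<dots> \<le> 4 * ln 2 * real n + 2 * real n * ln 2"
      by (intro add_mono less.IH n sum_mangoldt_dyadic_le)
    also have "\<dots> = 2 * ln 2 * (3 * real n)" by simp
    also have "\<dots> \<le> 2 * ln 2 * (2 * real N)"
    proof (rule mult_left_mono)
      have "3 * n \<le> 2 * N" using n False by linarith
      then show "3 * real n \<le> 2 * real N" by linarith
    qed simp
    finally show ?thesis by simp
  qed
qed

lemma sum_Suc_conv: "(\<Sum>n<N. f (Suc n)) = (\<Sum>n=1..N. f n)"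
  by (rule sum.reindex_bij_witness[of _ "\<lambda>n. n - 1" Suc]) auto

section \<open>Mertens' theorem with Euler's constant\<close>

text \<open>
  The alternating zeta function \<open>\<eta>(s) = \<Sum>n. (-1)^(n-1) n powr -s = (1 - 2 powr (1-s)) \<zeta>(s)\<close> behaves like the
  \<open>L\<close>-function of a nonprincipal character and stands in for \<open>\<zeta>\<close>, which has a pole at \<open>1\<close>.
\<close>

definition eta_coeff :: "nat \<Rightarrow> real" where
  "eta_coeff n = (if even n then - 1 else 1)"

text \<open>
  Up to sign, these are the coefficients of the logarithmic derivative of the factor
  \<open>1 - 2 powr (1-s) = exp (- (\<Sum>k\<ge>1. 2^k (2^k) powr -s / k))\<close>: dividing by \<open>ln (2^k)\<close> gives \<open>2^k/k\<close> at \<open>2^k\<close>.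
\<close>

definition two_power_weight :: "nat \<Rightarrow> real" where
  "two_power_weight n = (if \<exists>k\<ge>1. n = 2 ^ k then real n * ln 2 else 0)"

lemma sum_powers_of_two:
  fixes f :: "nat \<Rightarrow> real"
  assumes "N > 0"
  shows "(\<Sum>n=1..N. if \<exists>k\<ge>1. n = 2 ^ k then f n else 0) = (\<Sum>k=1..floor_log N. f (2 ^ k))"
proof -
  have le: "2 ^ k \<le> N \<longleftrightarrow> k \<le> floor_log N" for k
  proof
    assume "2 ^ k \<le> N"
    then have "floor_log (2 ^ k) \<le> floor_log N" by (rule floor_log_le_iff)
    then show "k \<le> floor_log N" by simp
  next
    assume "k \<le> floor_log N"
    then have "(2::nat) ^ k \<le> 2 ^ floor_log N" by (rule power_increasing) simp
    then show "2 ^ k \<le> N" using floor_log_exp2_le[OF assms] by linarith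
  qed
  have "(\<Sum>n=1..N. if \<exists>k\<ge>1. n = 2 ^ k then f n else 0) = (\<Sum>n\<in>(^) 2 ` {1..floor_log N}. f n)"
    by (rule sum.mono_neutral_cong_right) (auto simp: le)
  also have "\<dots> = (\<Sum>k=1..floor_log N. f (2 ^ k))"
    by (subst sum.reindex) (auto simp: inj_on_def)
  finally show ?thesis .
qed

lemma sum_two_power_weight_le: "(\<Sum>n=1..N. two_power_weight n) \<le> 2 * ln 2 * real N"
proof (cases "N = 0")
  case False
  have "(\<Sum>n=1..N. two_power_weight n) = (\<Sum>k=1..floor_log N. real (2 ^ k) * ln 2)"
    unfolding two_power_weight_def using False by (subst sum_powers_of_two) auto
  also have "\<dots> = (\<Sum>k=1..floor_log N. 2 ^ k) * ln 2" by (simp add: sum_distrib_right)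
  also have "(\<Sum>k=1..M. (2::real) ^ k) \<le> 2 * 2 ^ M" for M
    by (induction M) auto
  then have "(\<Sum>k=1..floor_log N. (2::real) ^ k) * ln 2 \<le> 2 * 2 ^ floor_log N * ln 2"
    by (rule mult_right_mono) simp
  also have "(2::real) ^ floor_log N \<le> real N"
    using floor_log_exp2_le[of N] False by (metis neq0_conv of_nat_le_iff of_nat_numeral of_nat_power)
  then have "2 * 2 ^ floor_log N * ln 2 \<le> 2 * real N * ln (2::real)"
    by (intro mult_right_mono mult_left_mono) auto
  finally show ?thesis by (simp add: mult_ac)
qed simp

lemma two_power_weight_odd: "odd n \<Longrightarrow> two_power_weight n = 0"
  by (auto simp: two_power_weight_def)

lemma two_power_weight_double:
  "two_power_weight (2 * n) = 2 * two_power_weight n + (if n = 1 then 2 * ln 2 else 0)"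
proof -
  have "(\<exists>k\<ge>1. 2 * n = 2 ^ k) \<longleftrightarrow> n = 1 \<or> (\<exists>k\<ge>1. n = 2 ^ k)"
  proof
    assume "\<exists>k\<ge>1. 2 * n = 2 ^ k"
    then obtain k where k: "k \<ge> 1" "2 * n = 2 ^ k" by blast
    then obtain j where "k = Suc j" by (cases k) auto
    then have "n = 2 ^ j" using k by simp
    then show "n = 1 \<or> (\<exists>k\<ge>1. n = 2 ^ k)" by (cases j) auto
  next
    assume "n = 1 \<or> (\<exists>k\<ge>1. n = 2 ^ k)"
    then show "\<exists>k\<ge>1. 2 * n = 2 ^ k"
      by (metis Suc_le_eq le_SucI mult_1_right One_nat_def order_refl power_Suc power_one_right)
  qed
  moreover have "\<not> (\<exists>k\<ge>1. (1::nat) = 2 ^ k)"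
    by (metis One_nat_def Suc_le_eq less_irrefl one_less_power one_less_numeral_iff semiring_norm(76))
  ultimately show ?thesis by (auto simp: two_power_weight_def)
qed

text \<open>
  Only even divisors contribute, and halving them reduces the sum for \<open>2m\<close> to the sum for \<open>m\<close>.
\<close>

lemma sum_two_power_weight_divisors:
  assumes "n > 0"
  shows "(\<Sum>d | d dvd n. two_power_weight d * eta_coeff (n div d)) = (if even n then 2 * ln 2 else 0)"
  using assms
proof (induction n rule: less_induct)
  case (less n)
  show ?case
  proof (cases "even n")
    case False
    then have "two_power_weight d = 0" if "d dvd n" for d
      using that dvd_trans by (intro two_power_weight_odd) blast
    then show ?thesis using False by simp
  next
    case True
    then obtain m where m: "n = 2 * m" by blast
    with less.prems have m0: "m > 0" "m < n" by auto
    have "(\<Sum>d | d dvd n. two_power_weight d * eta_coeff (n div d)) =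
        (\<Sum>d\<in>(*) 2 ` {d. d dvd m}. two_power_weight d * eta_coeff (n div d))"
    proof (rule sum.mono_neutral_right)
      show "finite {d. d dvd n}" using less.prems by simp
      show "(*) 2 ` {d. d dvd m} \<subseteq> {d. d dvd n}" by (auto simp: m)
      show "\<forall>d\<in>{d. d dvd n} - (*) 2 ` {d. d dvd m}. two_power_weight d * eta_coeff (n div d) = 0"
      proof
        fix d assume d: "d \<in> {d. d dvd n} - (*) 2 ` {d. d dvd m}"
        have "odd d"
        proof
          assume "even d"
          then obtain e where "d = 2 * e" by blast
          then show False using d by (auto simp: m)
        qed
        then show "two_power_weight d * eta_coeff (n div d) = 0" by (simp add: two_power_weight_odd)
      qed
    qed
    also have "\<dots> = (\<Sum>d | d dvd m. two_power_weight (2 * d) * eta_coeff (m div d))"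
      by (subst sum.reindex) (auto simp: inj_on_def m)
    also have "\<dots> = 2 * (\<Sum>d | d dvd m. two_power_weight d * eta_coeff (m div d)) +
        (\<Sum>d | d dvd m. if d = 1 then 2 * ln 2 * eta_coeff m else 0)"
      by (simp add: two_power_weight_double distrib_right sum.distrib sum_distrib_left mult.assoc
          if_distrib[of "\<lambda>x. x * _"] cong: if_cong)
    also have "(\<Sum>d | d dvd m. if d = 1 then 2 * ln 2 * eta_coeff m else 0) = 2 * ln 2 * eta_coeff m"
      using m0 by (subst sum.delta) auto
    also have "2 * (\<Sum>d | d dvd m. two_power_weight d * eta_coeff (m div d)) + 2 * ln 2 * eta_coeff m
        = 2 * ln 2"
      using less.IH[OF m0(2,1)] by (simp add: eta_coeff_def)
    finally show ?thesis using True by simp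
  qed
qed

lemma sum_mangoldt_eta_divisors:
  assumes "n > 0"
  shows "(\<Sum>d | d dvd n. mangoldt d * eta_coeff (n div d)) =
    ln (real n) - (if even n then 2 * ln (real (n div 2)) else 0)"
proof -
  have "(\<Sum>d | d dvd n. mangoldt d * eta_coeff (n div d)) =
      (\<Sum>d | d dvd n. mangoldt d - 2 * (if even (n div d) then mangoldt d else 0))"
    by (intro sum.cong refl) (auto simp: eta_coeff_def)
  also have "\<dots> = ln (real n) - 2 * (\<Sum>d | d dvd n. if even (n div d) then mangoldt d else 0)"
    using mangoldt_sum[of n, where 'a = real] assms by (simp add: sum_subtractf sum_distrib_left)
  also have "(\<Sum>d | d dvd n. if even (n div d) then mangoldt d else 0) =
      (if even n then ln (real (n div 2)) else 0)"
  proof (cases "even n")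
    case True
    then obtain m where m: "n = 2 * m" by blast
    with assms have m0: "m > 0" by simp
    have "(\<Sum>d | d dvd n. if even (n div d) then mangoldt d else 0) = (\<Sum>d | d dvd m. mangoldt d :: real)"
    proof (rule sum.mono_neutral_cong_right)
      show "\<forall>d\<in>{d. d dvd n} - {d. d dvd m}. (if even (n div d) then mangoldt d else 0 :: real) = 0"
      proof
        fix d assume d: "d \<in> {d. d dvd n} - {d. d dvd m}"
        have "odd (n div d)"
        proof
          assume "even (n div d)"
          then obtain k where "n div d = 2 * k" by blast
          then have "2 * m = 2 * (d * k)" using d m by (metis DiffD1 dvd_mult_div_cancel mem_Collect_eq mult.left_commute)
          then show False using d by simp
        qed
        then show "(if even (n div d) then mangoldt d else 0 :: real) = 0" by simp
      qed
      show "(if even (n div d) then mangoldt d else 0 :: real) = mangoldt d" if "d \<in> {d. d dvd m}" for d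
        using that m by (auto simp: div_mult_swap[symmetric])
    qed (use assms m in auto)
    also have "\<dots> = ln (real m)" using mangoldt_sum[of m, where 'a = real] m0 by simp
    finally show ?thesis using True m by simp
  next
    case False
    then have "odd (n div d)" if "d dvd n" for d
      using that by (metis dvd_mult_div_cancel even_mult_iff)
    then show ?thesis using False by simp
  qed
  finally show ?thesis by simp
qed

interpretation eta: dirichlet_log "\<lambda>n. of_real (eta_coeff n)"
  "\<lambda>n. of_real (mangoldt n - two_power_weight n)" 1 "6 * ln 2"
proof
  show "complex_of_real (eta_coeff (Suc 0)) = 1" by (simp add: eta_coeff_def)
  show "norm (complex_of_real (eta_coeff n)) \<le> 1" for n by (simp add: eta_coeff_def)
  have "(\<Sum>n<N. eta_coeff (Suc n)) = (if even N then 0 else 1)" for N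
    by (induction N) (auto simp: eta_coeff_def)
  then show "norm (\<Sum>n<N. complex_of_real (eta_coeff (Suc n))) \<le> 1" for N
    by (simp add: of_real_sum[symmetric] del: of_real_sum)
  show "ln (real n) *\<^sub>R complex_of_real (eta_coeff n) =
      (\<Sum>d | d dvd n. complex_of_real (mangoldt d - two_power_weight d) * complex_of_real (eta_coeff (n div d)))"
    if n: "n > 0" for n
  proof -
    have "(\<Sum>d | d dvd n. (mangoldt d - two_power_weight d) * eta_coeff (n div d)) =
        ln (real n) - (if even n then 2 * ln (real (n div 2)) else 0) - (if even n then 2 * ln 2 else 0)"
      by (simp add: left_diff_distrib sum_subtractf sum_mangoldt_eta_divisors[OF n]
          sum_two_power_weight_divisors[OF n])
    also have "\<dots> = ln (real n) * eta_coeff n"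
      using n by (auto simp: eta_coeff_def ln_mult algebra_simps elim!: evenE)
    finally show ?thesis
      by (simp only: of_real_mult[symmetric] of_real_sum[symmetric] scaleR_conv_of_real)
  qed
  show "(\<Sum>n<N. norm (complex_of_real (mangoldt (Suc n) - two_power_weight (Suc n)))) \<le> 6 * ln 2 * real N" for N
  proof -
    have "two_power_weight n \<ge> 0" for n by (simp add: two_power_weight_def)
    then have "(\<Sum>n=1..N. norm (complex_of_real (mangoldt n - two_power_weight n))) \<le>
        (\<Sum>n=1..N. mangoldt n + two_power_weight n)"
    proof (intro sum_mono)
      fix n
      show "norm (complex_of_real (mangoldt n - two_power_weight n)) \<le> mangoldt n + two_power_weight n"
        unfolding norm_of_real using mangoldt_nonneg[of n] \<open>two_power_weight n \<ge> 0\<close> by linarith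
    qed
    also have "\<dots> \<le> 4 * ln 2 * real N + 2 * ln 2 * real N"
      unfolding sum.distrib by (intro add_mono chebyshev_psi_le sum_two_power_weight_le)
    finally show ?thesis by (simp only: sum_Suc_conv[of "\<lambda>n. norm (complex_of_real (mangoldt n - two_power_weight n))"])
  qed
qed

lemma eta_at_1: "dseries (\<lambda>n. of_real (eta_coeff n)) 1 = of_real (ln 2)"
proof -
  have "dterm (\<lambda>n. of_real (eta_coeff n)) 1 = (\<lambda>n. complex_of_real ((-1) ^ n / real (Suc n)))"
    by (rule ext) (auto simp: dterm_def eta_coeff_def powr_minus scaleR_conv_of_real divide_inverse
        simp del: of_nat_Suc)
  moreover have "(\<lambda>n. complex_of_real ((-1) ^ n / real (Suc n))) sums of_real (ln 2)"
    by (intro sums_of_real alternating_harmonic_series_sums)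
  ultimately show ?thesis by (simp add: dseries_def sums_iff)
qed

text \<open>
  Euler's constant enters as follows.  The logarithm of \<open>\<eta>(1) = ln 2\<close> is the limit of
  \<open>(\<Sum>n\<le>N. \<Lambda>(n)/(n ln n)) - (\<Sum>2^k\<le>N. 1/k)\<close>, and the second sum is a harmonic number with about \<open>ln N / ln 2\<close>
  terms, that is, \<open>ln (ln N) - ln (ln 2) + \<gamma> + o(1)\<close>.  The two copies of \<open>ln (ln 2)\<close> cancel.
\<close>

theorem sum_mangoldt_over_n_ln_n:
  "(\<lambda>N. (\<Sum>n=1..N. mangoldt n / (real n * ln (real n))) - ln (ln (real N))) \<longlonglongrightarrow> euler_mascheroni"
proof -
  define r where "r n = (mangoldt n - two_power_weight n) / (real n * ln (real n))" for n
  have dterm_r: "dterm eta.logc 1 = (\<lambda>n. of_real (r (Suc n)))"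
    unfolding dterm_def eta.logc_def r_def
    by (rule ext) (simp add: powr_minus scaleR_conv_of_real divide_inverse mult_ac del: of_nat_Suc)
  have nonzero: "dseries (\<lambda>n. of_real (eta_coeff n)) 1 \<noteq> 0" by (simp add: eta_at_1)
  have sm: "summable (\<lambda>n. complex_of_real (r (Suc n)))"
    using eta.summable_logc_1[OF nonzero] unfolding dterm_r .
  then have sm': "summable (\<lambda>n. r (Suc n))" using summable_Re[OF sm] by simp
  have "dseries eta.logc 1 = of_real (\<Sum>n. r (Suc n))"
    using suminf_of_real[OF sm', where 'a = complex] unfolding dseries_def dterm_r by simp
  then have "complex_of_real (exp (\<Sum>n. r (Suc n))) = of_real (ln 2)"
    using eta.exp_dseries_logc_ge_1[OF nonzero, of 1] unfolding eta_at_1 by (simp only: exp_of_real)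
  then have "exp (\<Sum>n. r (Suc n)) = ln 2" by (simp only: of_real_eq_iff)
  then have "(\<Sum>n. r (Suc n)) = ln (ln 2)" using ln_exp[of "\<Sum>n. r (Suc n)"] by simp
  then have "(\<lambda>N. \<Sum>n<N. r (Suc n)) \<longlonglongrightarrow> ln (ln 2)"
    using summable_LIMSEQ[OF sm'] by simp
  then have lim1: "(\<lambda>N. \<Sum>n=1..N. r n) \<longlonglongrightarrow> ln (ln 2)" by (simp only: sum_Suc_conv)

  have log_bounds: "log 2 (real N) - 1 \<le> real (floor_log N)" "real (floor_log N) \<le> log 2 (real N)"
    if "N > 0" for N
    using that by (simp_all add: floor_log_altdef)
  have "filterlim (\<lambda>N. real (floor_log N)) at_top sequentially"
  proof (rule filterlim_at_top_mono)
    show "filterlim (\<lambda>N. log 2 (real N) - 1) at_top sequentially" by real_asymp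
    show "\<forall>\<^sub>F N in sequentially. log 2 (real N) - 1 \<le> real (floor_log N)"
      using eventually_gt_at_top[of 0] by eventually_elim (rule log_bounds)
  qed
  then have "filterlim floor_log sequentially sequentially"
    by (simp add: filterlim_sequentially_iff_filterlim_real)
  then have lim2: "(\<lambda>N. harm (floor_log N) - ln (real (floor_log N))) \<longlonglongrightarrow> euler_mascheroni"
    by (rule filterlim_compose[OF euler_mascheroni_LIMSEQ])

  have lim3: "(\<lambda>N. ln (real (floor_log N)) - ln (ln (real N))) \<longlonglongrightarrow> - ln (ln 2)"
  proof (rule tendsto_sandwich)
    show "(\<lambda>N. ln (log 2 (real N) - 1) - ln (ln (real N))) \<longlonglongrightarrow> - ln (ln 2)"
      unfolding ln_inverse[symmetric] by real_asymp
    show "(\<lambda>N. ln (log 2 (real N)) - ln (ln (real N))) \<longlonglongrightarrow> - ln (ln 2)"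
      unfolding ln_inverse[symmetric] by real_asymp
    have big: "\<forall>\<^sub>F N in sequentially. log 2 (real N) - 1 > 0" by real_asymp
    show "\<forall>\<^sub>F N in sequentially. ln (log 2 (real N) - 1) - ln (ln (real N)) \<le>
        ln (real (floor_log N)) - ln (ln (real N))"
      using big eventually_gt_at_top[of 0]
    proof eventually_elim
      case (elim N)
      then have "0 < log 2 (real N) - 1" "log 2 (real N) - 1 \<le> real (floor_log N)"
        using log_bounds(1)[of N] by blast+
      then show ?case by (intro diff_right_mono) (subst ln_le_cancel_iff, linarith+)
    qed
    show "\<forall>\<^sub>F N in sequentially. ln (real (floor_log N)) - ln (ln (real N)) \<le>
        ln (log 2 (real N)) - ln (ln (real N))"
      using big eventually_gt_at_top[of 0]
    proof eventually_elim
      case (elim N)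
      then have "0 < log 2 (real N) - 1" "log 2 (real N) - 1 \<le> real (floor_log N)"
        "real (floor_log N) \<le> log 2 (real N)"
        using log_bounds[of N] by blast+
      then show ?case by (intro diff_right_mono) (subst ln_le_cancel_iff, linarith+)
    qed
  qed
  have "(\<lambda>N. (\<Sum>n=1..N. r n) + (harm (floor_log N) - ln (real (floor_log N))) +
      (ln (real (floor_log N)) - ln (ln (real N)))) \<longlonglongrightarrow> ln (ln 2) + euler_mascheroni + - ln (ln 2)"
    by (intro tendsto_intros lim1 lim2 lim3)
  moreover have "\<forall>\<^sub>F N in sequentially. (\<Sum>n=1..N. r n) + (harm (floor_log N) - ln (real (floor_log N))) +
      (ln (real (floor_log N)) - ln (ln (real N))) =
      (\<Sum>n=1..N. mangoldt n / (real n * ln (real n))) - ln (ln (real N))"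
    using eventually_gt_at_top[of 0]
  proof eventually_elim
    case (elim N)
    have "(\<Sum>n=1..N. two_power_weight n / (real n * ln (real n))) =
        (\<Sum>n=1..N. if \<exists>k\<ge>1. n = 2 ^ k then ln 2 / ln (real n) else 0)"
      by (rule sum.cong) (auto simp: two_power_weight_def)
    also have "\<dots> = (\<Sum>k=1..floor_log N. ln 2 / ln (real (2 ^ k)))"
      using elim by (rule sum_powers_of_two)
    also have "\<dots> = harm (floor_log N)"
      unfolding harm_def by (rule sum.cong) (auto simp: ln_realpow divide_simps)
    finally show ?case by (simp add: r_def diff_divide_distrib sum_subtractf)
  qed
  ultimately show ?thesis by (simp add: Lim_transform_eventually)
qed

section \<open>Nonvanishing at 1 for real characters\<close>

lemma dirichlet_log_character:
  assumes "q > 0" "dirichlet_character q chi" "chi \<noteq> principal_character q"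
  shows "dirichlet_log chi (\<lambda>n. chi n * mangoldt n) (real q + 1) (4 * ln 2)"
proof
  show "chi (Suc 0) = 1" by (rule character_one[OF assms(2)])
  show "norm (chi n) \<le> 1" for n by (rule norm_character_le_1[OF assms(2,1)])
  show "norm (\<Sum>n<N. chi (Suc n)) \<le> real q + 1" for N by (rule norm_sum_character_le[OF assms])
  show "ln (real n) *\<^sub>R chi n = (\<Sum>d | d dvd n. chi d * mangoldt d * chi (n div d))" if "n > 0" for n
  proof -
    have "chi d * mangoldt d * chi (n div d) = chi n * mangoldt d" if "d dvd n" for d
    proof -
      have "chi n = chi d * chi (n div d)"
        using that by (simp only: character_mult[OF assms(2), symmetric] dvd_mult_div_cancel)
      then show ?thesis by (simp add: mult_ac)
    qed
    then have "(\<Sum>d | d dvd n. chi d * mangoldt d * chi (n div d)) = (\<Sum>d | d dvd n. chi n * mangoldt d)"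
      by (intro sum.cong refl) blast
    also have "\<dots> = chi n * (\<Sum>d | d dvd n. mangoldt d)" by (simp add: sum_distrib_left)
    finally have "(\<Sum>d | d dvd n. chi d * mangoldt d * chi (n div d)) = chi n * (\<Sum>d | d dvd n. mangoldt d)" .
    then show ?thesis
      using that mangoldt_sum[of n, where 'a = complex] by (simp add: scaleR_conv_of_real mult.commute)
  qed
  show "(\<Sum>n<N. norm (chi (Suc n) * mangoldt (Suc n))) \<le> 4 * ln 2 * real N" for N
  proof -
    have "(\<Sum>n<N. norm (chi (Suc n) * mangoldt (Suc n))) \<le> (\<Sum>n<N. mangoldt (Suc n))"
      using norm_character_le_1[OF assms(2,1)] mangoldt_nonneg
      by (intro sum_mono) (simp add: norm_mult mult_left_le_one_le)
    also have "\<dots> \<le> 4 * ln 2 * real N"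
      unfolding sum_Suc_conv[of mangoldt] by (rule chebyshev_psi_le)
    finally show ?thesis .
  qed
qed

lemma dirichlet_L_eq_dseries: "dirichlet_L chi (of_real s) = dseries chi s"
proof -
  have "chi (Suc n) / of_nat (Suc n) powr of_real s = dterm chi s n" for n
  proof -
    have "complex_of_real (real (Suc n)) powr of_real s = of_real (real (Suc n) powr s)"
      by (rule powr_of_real) simp
    then show ?thesis
      by (simp only: dterm_def of_real_of_nat_eq) (simp add: powr_minus scaleR_conv_of_real divide_inverse mult.commute del: of_nat_Suc)
  qed
  then show ?thesis by (simp add: dirichlet_L_def dseries_def)
qed

lemma sum_character_divisors_prime_power:
  fixes r :: "nat \<Rightarrow> real"
  assumes p: "prime p" "\<not> p dvd m" and m: "m > 0" and mult: "\<And>a b. r (a * b) = r a * r b"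
    and one: "r 1 = 1"
  shows "(\<Sum>d | d dvd p ^ k * m. r d) = (\<Sum>j\<le>k. r p ^ j) * (\<Sum>d | d dvd m. r d)"
proof -
  have pow: "r (p ^ j) = r p ^ j" for j by (induction j) (use one in \<open>simp_all add: mult\<close>)
  have nd: "\<not> p dvd d" if "d dvd m" for d using p(2) that dvd_trans by blast
  have "bij_betw (\<lambda>(j, d). p ^ j * d) ({..k} \<times> {d. d dvd m}) {d. d dvd p ^ k * m}"
  proof (rule bij_betwI')
    fix x y assume x: "x \<in> {..k} \<times> {d. d dvd m}" and y: "y \<in> {..k} \<times> {d. d dvd m}"
    obtain i d j e where xy: "x = (i, d)" "y = (j, e)" by (cases x, cases y)
    have "i = j \<and> d = e" if eq: "p ^ i * d = p ^ j * e"
    proof -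
      have "i = j"
      proof (rule prime_power_cancel2[OF p(1)])
        show "d * p ^ i = e * p ^ j" using eq by (simp add: mult.commute)
      qed (use x y xy nd in auto)
      then show ?thesis using eq p(1) by (auto simp: prime_gt_0_nat)
    qed
    then show "((case x of (j, d) \<Rightarrow> p ^ j * d) = (case y of (j, d) \<Rightarrow> p ^ j * d)) \<longleftrightarrow> x = y"
      using xy by auto
  next
    fix x assume "x \<in> {..k} \<times> {d. d dvd m}"
    then show "(case x of (j, d) \<Rightarrow> p ^ j * d) \<in> {d. d dvd p ^ k * m}"
      by (auto intro!: mult_dvd_mono le_imp_power_dvd)
  next
    fix e assume "e \<in> {d. d dvd p ^ k * m}"
    then obtain u v where uv: "e = u * v" "u dvd p ^ k" "v dvd m" by (auto elim: dvd_productE)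
    then obtain j where "j \<le> k" "u = p ^ j" using divides_primepow_nat[OF p(1)] by blast
    then show "\<exists>x\<in>{..k} \<times> {d. d dvd m}. e = (case x of (j, d) \<Rightarrow> p ^ j * d)"
      using uv by (intro bexI[of _ "(j, v)"]) auto
  qed
  then have "(\<Sum>d | d dvd p ^ k * m. r d) = (\<Sum>(j, d)\<in>{..k} \<times> {d. d dvd m}. r (p ^ j * d))"
    by (subst sum.reindex_bij_betw[symmetric]) (auto simp: case_prod_unfold)
  also have "\<dots> = (\<Sum>(j, d)\<in>{..k} \<times> {d. d dvd m}. r p ^ j * r d)"
    by (simp add: mult pow)
  also have "\<dots> = (\<Sum>j\<le>k. r p ^ j) * (\<Sum>d | d dvd m. r d)"
    by (simp add: sum_product sum.cartesian_product)
  finally show ?thesis .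
qed

lemma geometric_sum_sign:
  fixes x :: real
  assumes "x = -1 \<or> x = 0 \<or> x = 1"
  shows "(\<Sum>j\<le>k. x ^ j) \<ge> 0" "even k \<Longrightarrow> (\<Sum>j\<le>k. x ^ j) \<ge> 1"
proof -
  have "(\<Sum>j\<le>k. (-1::real) ^ j) = (if even k then 1 else 0)" by (induction k) auto
  moreover have "(\<Sum>j\<le>k. (0::real) ^ j) = 1" by (induction k) auto
  ultimately show "(\<Sum>j\<le>k. x ^ j) \<ge> 0" "even k \<Longrightarrow> (\<Sum>j\<le>k. x ^ j) \<ge> 1"
    using assms by auto
qed

lemma sum_real_character_divisors_nonneg:
  fixes r :: "nat \<Rightarrow> real"
  assumes mult: "\<And>a b. r (a * b) = r a * r b" and one: "r 1 = 1"
    and sign: "\<And>n. r n = -1 \<or> r n = 0 \<or> r n = 1" and n: "n > 0"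
  shows "(\<Sum>d | d dvd n. r d) \<ge> 0"
  using n
proof (induction n rule: less_induct)
  case (less n)
  show ?case
  proof (cases "n = 1")
    case True
    then show ?thesis using one by simp
  next
    case False
    then obtain p where p: "prime p" "p dvd n" using prime_factor_nat by blast
    have "n \<noteq> 0" "\<not> is_unit p" using less.prems p by auto
    then obtain m where m: "n = p ^ multiplicity p n * m" "\<not> p dvd m"
      using multiplicity_decompose'[of n p] by blast
    have "multiplicity p n > 0" using p less.prems by (simp add: prime_multiplicity_gt_zero_iff)
    then have "p ^ multiplicity p n > 1" using prime_gt_1_nat[OF p(1)] by (intro one_less_power)
    moreover have m0: "m > 0" using m less.prems by (cases m) auto
    ultimately have "m < n" using m(1) by (metis mult_less_cancel2 mult_1)
    then have "(\<Sum>d | d dvd m. r d) \<ge> 0" using less.IH m0 by blast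
    then show ?thesis
      using sum_character_divisors_prime_power[of p m r "multiplicity p n", OF p(1) m(2) m0 mult one]
        geometric_sum_sign(1)[OF sign] m(1) by simp
  qed
qed

text \<open>
  Pairing the terms \<open>j\<close> and \<open>n - 1 - j\<close>, the inequality of the means applies to each pair.  The square in the
  base avoids half-integer exponents.
\<close>

lemma power_mean_le_geometric_sum:
  fixes u :: real
  assumes "u \<ge> 0"
  shows "real n * u ^ (n - 1) \<le> (\<Sum>j<n. (u\<^sup>2) ^ j)"
proof -
  have "(\<Sum>j<n. (u\<^sup>2) ^ (n - Suc j)) = (\<Sum>j<n. (u\<^sup>2) ^ j)"
    by (rule sum.nat_diff_reindex)
  then have "2 * (\<Sum>j<n. (u\<^sup>2) ^ j) = (\<Sum>j<n. (u\<^sup>2) ^ j + (u\<^sup>2) ^ (n - Suc j))"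
    by (simp add: sum.distrib)
  also have "\<dots> \<ge> (\<Sum>j<n. 2 * u ^ (n - 1))"
  proof (rule sum_mono)
    fix j assume j: "j \<in> {..<n}"
    have "u ^ (n - 1) = u ^ j * u ^ (n - Suc j)" using j by (simp add: power_add[symmetric])
    moreover have "2 * (u ^ j * u ^ (n - Suc j)) \<le> (u ^ j)\<^sup>2 + (u ^ (n - Suc j))\<^sup>2"
      using sum_squares_bound[of "u ^ j" "u ^ (n - Suc j)"] by (simp add: mult.assoc)
    ultimately show "2 * u ^ (n - 1) \<le> (u\<^sup>2) ^ j + (u\<^sup>2) ^ (n - Suc j)"
      by (simp add: power_mult[symmetric] mult.commute)
  qed
  finally show ?thesis by simp
qed

text \<open>
  The difference between \<open>t^n/(1 - t^n)\<close> and its leading behaviour \<open>1/(n (1 - t))\<close> as \<open>t \<rightarrow> 1\<close>.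
\<close>

definition monsky_weight :: "real \<Rightarrow> nat \<Rightarrow> real" where
  "monsky_weight t n = 1 / (real (Suc n) * (1 - t)) - t ^ Suc n / (1 - t ^ Suc n)"

text \<open>
  With \<open>S k = 1 + t + \<dots> + t^(k-1)\<close> the claim reads \<open>n (n+1) t^n \<le> S n S (n+1)\<close>, which follows from the
  inequality of the means for the two geometric sums.
\<close>

lemma monsky_weight_decseq:
  assumes t: "0 < t" "t < 1"
  shows "decseq (monsky_weight t)"
  unfolding decseq_Suc_iff
proof
  fix n
  define u where "u = sqrt t"
  have u: "u > 0" "u < 1" "t = u\<^sup>2" using t by (simp_all add: u_def)
  define S where "S k = (\<Sum>j<k. t ^ j)" for k
  have S: "1 - t ^ k = (1 - t) * S k" for k
    unfolding S_def by (rule one_diff_power_eq)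
  have S_ge: "real k * u ^ (k - 1) \<le> S k" for k
    unfolding S_def u(3) by (rule power_mean_le_geometric_sum) (use u in simp)
  let ?a = "Suc n" and ?b = "Suc (Suc n)"
  have "real ?a * u ^ n > 0" "real ?b * u ^ Suc n > 0" using u by simp_all
  then have S_pos: "S ?a > 0" "S ?b > 0" using S_ge[of ?a] S_ge[of ?b] by simp_all
  have "real ?a * real ?b * t ^ ?a \<le> (real ?a * u ^ n) * (real ?b * u ^ Suc n)"
  proof -
    have "t ^ ?a = u ^ (2 * ?a)" by (simp only: u(3) power_mult)
    also have "\<dots> \<le> u ^ (n + Suc n)" using u by (intro power_decreasing) auto
    finally have "real ?a * real ?b * t ^ ?a \<le> real ?a * real ?b * u ^ (n + Suc n)"
      by (intro mult_left_mono) auto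
    then show ?thesis by (simp only: power_add mult_ac)
  qed
  also have "\<dots> \<le> S ?a * S ?b"
    using S_ge[of ?a] S_ge[of ?b] S_pos u by (intro mult_mono) auto
  finally have key: "t ^ ?a / (S ?a * S ?b) \<le> 1 / (real ?a * real ?b)"
    using S_pos by (simp add: divide_simps mult.commute del: of_nat_Suc)
  have frac: "t ^ k / (1 - t ^ k) = 1 / (1 - t ^ k) - 1" if "k > 0" for k
    using t that power_strict_decreasing[of 0 k t] by (simp add: field_simps)
  have "(1 - t) * (t ^ ?a / (1 - t ^ ?a) - t ^ ?b / (1 - t ^ ?b)) = 1 / S ?a - 1 / S ?b"
  proof -
    have "(1 - t) * ((1 / ((1 - t) * A) - 1) - (1 / ((1 - t) * B) - 1)) = 1 / A - 1 / B" for A B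
      using t by (simp add: right_diff_distrib[of "1 - t"])
    then show ?thesis unfolding frac[OF zero_less_Suc] unfolding S .
  qed
  also have "\<dots> = t ^ ?a / (S ?a * S ?b)"
    using S_pos by (simp add: field_simps) (simp add: S_def)
  also note key
  also have "1 / (real ?a * real ?b) = (1 - t) * (1 / (real ?a * (1 - t)) - 1 / (real ?b * (1 - t)))"
    using t by (simp add: divide_simps)
  finally have "t ^ ?a / (1 - t ^ ?a) - t ^ ?b / (1 - t ^ ?b) \<le>
      1 / (real ?a * (1 - t)) - 1 / (real ?b * (1 - t))"
    using t by (simp only: mult_le_cancel_left_pos diff_gt_0_iff_gt)
  then show "monsky_weight t (Suc n) \<le> monsky_weight t n" unfolding monsky_weight_def by linarith
qed

lemma monsky_weight_nonneg:
  assumes t: "0 < t" "t < 1"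
  shows "monsky_weight t n \<ge> 0"
proof (rule decseq_ge[OF monsky_weight_decseq[OF t]])
  have "(\<lambda>n. t ^ Suc n) \<longlonglongrightarrow> 0" using LIMSEQ_Suc[OF LIMSEQ_power_zero[of t]] t by simp
  then have "(\<lambda>n. t ^ Suc n / (1 - t ^ Suc n)) \<longlonglongrightarrow> 0 / (1 - 0)" by (intro tendsto_intros) simp_all
  moreover have "(\<lambda>n. 1 / (real (Suc n) * (1 - t))) \<longlonglongrightarrow> 0" using t by real_asymp
  ultimately show "monsky_weight t \<longlonglongrightarrow> 0"
    unfolding monsky_weight_def using tendsto_diff by fastforce
qed

text \<open>
  The Lambert series \<open>\<Sum>n. \<chi>(n) t^n/(1-t^n) = \<Sum>n. c(n) t^n\<close> with \<open>c(n) = \<Sum>d|n. \<chi>(d)\<close> tends to infinity as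
  \<open>t \<rightarrow> 1\<close>, since \<open>c \<ge> 0\<close> and \<open>c(4^k) \<ge> 1\<close>.  If \<open>L(1,\<chi>) = 0\<close> it equals
  \<open>- (\<Sum>n. \<chi>(n) (1/(n(1-t)) - t^n/(1-t^n)))\<close>, whose weights decrease from \<open>1\<close>, and so it is bounded by the
  partial sums of \<open>\<chi>\<close>.  The argument is due to P. Monsky.
\<close>

lemma dseries_real_character_nonzero:
  assumes q: "q > 0" and chi: "dirichlet_character q chi" "chi \<noteq> principal_character q"
    and real: "\<And>n. cnj (chi n) = chi n"
  shows "dseries chi 1 \<noteq> 0"
proof
  assume zero: "dseries chi 1 = 0"
  interpret dirichlet_log chi "\<lambda>n. chi n * mangoldt n" "real q + 1" "4 * ln 2"
    by (rule dirichlet_log_character[OF q chi])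
  define r where "r n = Re (chi n)" for n
  have chi_r: "chi n = of_real (r n)" for n
    using real[of n] by (simp add: r_def complex_eq_iff)
  have mult: "r (a * b) = r a * r b" for a b
    using character_mult[OF chi(1), of a b] unfolding chi_r by (simp only: of_real_mult[symmetric] of_real_eq_iff)
  have one: "r 1 = 1" using g_1 by (simp add: r_def)
  have sign: "r n = -1 \<or> r n = 0 \<or> r n = 1" for n
  proof (cases "coprime n q")
    case True
    then have "\<bar>r n\<bar> = 1" using norm_character[OF chi(1) _ q, of n] by (simp add: chi_r)
    then show ?thesis by linarith
  next
    case False
    then have "chi n = 0" using character_eq_0_iff[OF chi(1)] by simp
    then show ?thesis by (simp add: r_def)
  qed
  define c where "c n = (\<Sum>d | d dvd n. r d)" for n
  have c_nonneg: "c n \<ge> 0" if "n > 0" for n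
    unfolding c_def by (rule sum_real_character_divisors_nonneg[OF mult one sign that])
  have c_square: "c (4 ^ k) \<ge> 1" for k
  proof -
    have "c (2 ^ (2 * k) * 1) = (\<Sum>j\<le>2 * k. r 2 ^ j) * (\<Sum>d | d dvd 1. r d)"
      unfolding c_def by (rule sum_character_divisors_prime_power[OF _ _ _ mult one]) auto
    then have "c (4 ^ k) = (\<Sum>j\<le>2 * k. r 2 ^ j)"
      using one by (simp add: power_mult)
    then show ?thesis using geometric_sum_sign(2)[OF sign, of "2 * k"] by simp
  qed
  have abs_r: "\<bar>r n\<bar> \<le> 1" for n using sign[of n] by auto
  have partial: "\<bar>\<Sum>n<N. r (Suc n)\<bar> \<le> real q + 1" for N
    using partial_sum_le[of N] unfolding chi_r of_real_sum[symmetric] norm_of_real .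
  have lim0: "(\<lambda>N. \<Sum>n<N. r (Suc n) / real (Suc n)) \<longlonglongrightarrow> 0"
  proof -
    have "(\<lambda>N. \<Sum>n<N. dterm chi 1 n) \<longlonglongrightarrow> 0"
      using summable_LIMSEQ[OF summable_g] zero by (simp add: dseries_def)
    then have "(\<lambda>N. Re (\<Sum>n<N. dterm chi 1 n)) \<longlonglongrightarrow> Re 0" by (rule tendsto_Re)
    then show ?thesis by (simp add: dterm_def powr_minus r_def divide_inverse mult.commute del: of_nat_Suc)
  qed
  have bounded: "(\<Sum>k<K. t ^ (4 ^ k)) \<le> real q + 1" if t: "0 < t" "t < 1" for t K
  proof -
    define F where "F = (\<lambda>(d, m). r d * t ^ (d * m))"
    have tn: "0 < t ^ n \<and> t ^ n < 1" if "n \<ge> 1" for n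
      using t that power_strict_decreasing[of 0 n t] by simp
    have geom: "((\<lambda>m. t ^ (d * m)) has_sum t ^ d / (1 - t ^ d)) {1..}" if "d \<in> {1..}" for d
      using has_sum_geometric_from_1[of "t ^ d"] tn[of d] that by (simp add: power_mult)
    have "(\<lambda>x. norm (F x)) summable_on {1..} \<times> {1..}"
    proof (rule summable_on_comparison_test[of "\<lambda>(d, m). t ^ (d * m)"])
      show "(\<lambda>(d, m). t ^ (d * m)) summable_on {1..} \<times> {1..}"
      proof (rule summable_on_SigmaI)
        show "((\<lambda>m. case (d, m) of (d, m) \<Rightarrow> t ^ (d * m)) has_sum t ^ d / (1 - t ^ d)) {1..}"
          if "d \<in> {1..}" for d using geom[OF that] by simp
        show "(\<lambda>d. t ^ d / (1 - t ^ d)) summable_on {1..}"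
        proof (rule summable_on_comparison_test[of "\<lambda>d. t ^ d * (1 / (1 - t))"])
          show "(\<lambda>d. t ^ d * (1 / (1 - t))) summable_on {1..}"
            using has_sum_geometric_from_1[of t] t
            by (intro summable_on_cmult_left has_sum_imp_summable) auto
          fix d :: nat assume d: "d \<in> {1..}"
          then have "t ^ d \<le> t ^ 1" using t by (intro power_decreasing) auto
          then show "t ^ d / (1 - t ^ d) \<le> t ^ d * (1 / (1 - t))"
            using t tn[of d] d by (simp add: frac_le)
          show "0 \<le> t ^ d / (1 - t ^ d)" using tn[of d] d by simp
        qed
      qed (use t in auto)
      show "norm (F x) \<le> (case x of (d, m) \<Rightarrow> t ^ (d * m))" for x
        using t mult_right_mono[OF abs_r, of "t ^ (fst x * snd x)" "fst x"]
        by (simp add: F_def abs_mult case_prod_unfold)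
    qed simp
    then have "F summable_on {1..} \<times> {1..}" by (rule abs_summable_summable)
    then obtain S where S: "(F has_sum S) ({1..} \<times> {1..})" by (auto simp: summable_on_def)
    have "((\<lambda>m. F (d, m)) has_sum r d * (t ^ d / (1 - t ^ d))) {1..}" if "d \<in> {1..}" for d
      unfolding F_def prod.case by (rule has_sum_cmult_right[OF geom[OF that]])
    with S have "((\<lambda>d. r d * (t ^ d / (1 - t ^ d))) has_sum S) {1..}" by (rule has_sum_SigmaD)
    then have "(\<lambda>n. r (Suc n) * (t ^ Suc n / (1 - t ^ Suc n))) sums S"
      unfolding has_sum_shift_atLeast_1 by (rule has_sum_imp_sums)
    then have "(\<lambda>N. \<Sum>n<N. r (Suc n) * (t ^ Suc n / (1 - t ^ Suc n))) \<longlonglongrightarrow> S"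
      by (simp only: sums_def)
    moreover have "(\<Sum>n<N. r (Suc n) * (t ^ Suc n / (1 - t ^ Suc n))) =
        (\<Sum>n<N. r (Suc n) / real (Suc n)) / (1 - t) - (\<Sum>n<N. monsky_weight t n *\<^sub>R r (Suc n))" for N
      unfolding sum_divide_distrib sum_subtractf[symmetric]
      by (rule sum.cong[OF refl]) (simp add: monsky_weight_def right_diff_distrib left_diff_distrib mult.commute)
    ultimately have "(\<lambda>N. (\<Sum>n<N. r (Suc n) / real (Suc n)) / (1 - t) -
        (\<Sum>n<N. monsky_weight t n *\<^sub>R r (Suc n))) \<longlonglongrightarrow> S" by simp
    then have "(\<lambda>N. (\<Sum>n<N. r (Suc n) / real (Suc n)) / (1 - t) -
        ((\<Sum>n<N. r (Suc n) / real (Suc n)) / (1 - t) -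
        (\<Sum>n<N. monsky_weight t n *\<^sub>R r (Suc n)))) \<longlonglongrightarrow> 0 / (1 - t) - S"
      using t by (intro tendsto_diff tendsto_divide lim0 tendsto_const) auto
    then have "(\<lambda>N. \<Sum>n<N. monsky_weight t n *\<^sub>R r (Suc n)) \<longlonglongrightarrow> - S" by simp
    then have limabs: "(\<lambda>N. norm (\<Sum>n<N. monsky_weight t n *\<^sub>R r (Suc n))) \<longlonglongrightarrow> norm (- S)" by (rule tendsto_norm)
    have w0: "monsky_weight t 0 = 1" using t by (simp add: monsky_weight_def field_simps)
    have "norm (\<Sum>n<N. monsky_weight t n *\<^sub>R r (Suc n)) \<le> real q + 1" for N
      using norm_weighted_sum_le[OF monsky_weight_decseq[OF t] monsky_weight_nonneg[OF t], of "\<lambda>n. r (Suc n)" "real q + 1" N]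
        partial w0 by simp
    then have "norm (- S) \<le> real q + 1" by (intro LIMSEQ_le_const2[OF limabs]) auto
    then have S_le: "S \<le> real q + 1" by simp
    have "(\<lambda>n. \<Sum>d | d dvd Suc n. F (d, Suc n div d)) sums S"
      by (rule has_sum_pairs_sums_divisors[OF S])
    moreover have "(\<Sum>d | d dvd Suc n. F (d, Suc n div d)) = c (Suc n) * t ^ Suc n" for n
      unfolding c_def F_def prod.case sum_distrib_right by (rule sum.cong) (auto simp del: power_Suc)
    ultimately have sums: "(\<lambda>n. c (Suc n) * t ^ Suc n) sums S" by simp
    have "(\<Sum>k<K. t ^ (4 ^ k)) \<le> (\<Sum>k<K. c (4 ^ k) * t ^ (4 ^ k))"
      using c_square t by (intro sum_mono) simp
    also have "\<dots> = (\<Sum>n\<in>(\<lambda>k. 4 ^ k - 1) ` {..<K}. c (Suc n) * t ^ Suc n)"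
    proof (subst sum.reindex)
      show "inj_on (\<lambda>k. 4 ^ k - 1 :: nat) {..<K}"
      proof (rule inj_onI)
        fix x y :: nat assume "4 ^ x - 1 = (4 ^ y - 1 :: nat)"
        moreover have "(4::nat) ^ x > 0" "(4::nat) ^ y > 0" by simp_all
        ultimately have "(4::nat) ^ x = 4 ^ y" by linarith
        then show "x = y" by simp
      qed
    qed (simp del: power_Suc)
    also have "\<dots> \<le> S"
      using sum_le_suminf[of "\<lambda>n. c (Suc n) * t ^ Suc n" "(\<lambda>k. 4 ^ k - 1) ` {..<K}"]
        sums c_nonneg t by (simp add: sums_iff del: power_Suc)
    finally show ?thesis using S_le by simp
  qed
  \<comment> \<open>The \<open>q + 2\<close> terms all tend to \<open>1\<close>, so their sum exceeds the bound \<open>q + 1\<close> for \<open>t\<close> near \<open>1\<close>.\<close>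
  have "((\<lambda>t. \<Sum>k<q + 2. t ^ (4 ^ k)) \<longlongrightarrow> (\<Sum>k<q + 2. 1 ^ (4 ^ k))) (at_left (1::real))"
    by (intro tendsto_intros)
  then have "\<forall>\<^sub>F t in at_left (1::real). (\<Sum>k<q + 2. t ^ (4 ^ k)) > real q + 1"
    by (rule order_tendstoD(1)) simp
  moreover have "\<forall>\<^sub>F t in at_left (1::real). t \<in> {0<..<1}"
    by (rule eventually_at_left_real) simp
  ultimately have "\<forall>\<^sub>F t in at_left (1::real). False"
  proof eventually_elim
    case (elim t)
    then show ?case using bounded[of t "q + 2"] by auto
  qed
  then show False by simp
qed

section \<open>Nonvanishing at 1 for all nonprincipal characters\<close>

lemma has_sum_ln_one_minus:
  fixes y :: real
  assumes "0 \<le> y" "y < 1"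
  shows "((\<lambda>k. y ^ k / real k) has_sum - ln (1 - y)) {1..}"
proof -
  have "(\<lambda>k. y ^ k / real k) sums - ln (1 - y)"
    using sums_minus[OF ln_series'[of "- y"]] assms by simp
  then have "((\<lambda>k. y ^ k / real k) has_sum - ln (1 - y)) UNIV"
    using assms by (intro norm_summable_imp_has_sum) (auto simp: sums_iff)
  then show ?thesis
    by (subst (asm) has_sum_cong_neutral[where T = "{1..}"]) (auto simp: not_le)
qed

text \<open>
  At \<open>1\<close> the quotient is \<open>0 / 0 = 0\<close>, as it should be: these are the coefficients of \<open>ln \<zeta>\<close>, with value \<open>1/k\<close> at
  \<open>p^k\<close> and \<open>0\<close> elsewhere.
\<close>

definition log_coeff :: "nat \<Rightarrow> real" where
  "log_coeff n = mangoldt n / ln (real n)"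

lemma log_coeff_nonneg: "log_coeff n \<ge> 0"
  by (cases "n = 0") (simp_all add: log_coeff_def mangoldt_nonneg)

lemma log_coeff_le_1: "log_coeff n \<le> 1"
proof (cases "n \<le> 1")
  case True
  then have "n = 0 \<or> n = 1" by auto
  then show ?thesis by (auto simp: log_coeff_def)
next
  case False
  then show ?thesis using mangoldt_le[of n] by (simp add: log_coeff_def field_simps)
qed

lemma summable_log_coeff:
  assumes "s > 1"
  shows "summable (\<lambda>n. real (Suc n) powr - s * log_coeff (Suc n))"
proof (rule summable_comparison_test')
  show "summable (\<lambda>n. real (Suc n) powr - s)"
    using assms summable_Suc_iff[of "\<lambda>n. real n powr - s"] summable_real_powr_iff[of "- s"] by simp
  show "norm (real (Suc n) powr - s * log_coeff (Suc n)) \<le> real (Suc n) powr - s" if "n \<ge> 0" for n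
    using log_coeff_nonneg[of "Suc n"] log_coeff_le_1[of "Suc n"] by (simp add: abs_mult mult_left_le)
qed

definition log_zeta :: "real \<Rightarrow> real" where
  "log_zeta s = (\<Sum>n. real (Suc n) powr - s * log_coeff (Suc n))"

text \<open>
  This is \<open>ln \<zeta>(s) = ln \<eta>(s) - ln (1 - 2 powr (1-s))\<close>, read off from the coefficients.
\<close>

lemma log_zeta_eq_eta:
  assumes s: "s > 1"
  shows "log_zeta s = Re (dseries eta.logc s) - ln (1 - 2 powr (1 - s))"
proof -
  define y where "y = 2 powr (1 - s)"
  have y: "0 \<le> y" "y < 1" using s powr_less_mono[of "1 - s" 0 2] by (simp_all add: y_def)
  define u where "u n = real n powr - s * (two_power_weight n / ln (real n))" for n
  have "((\<lambda>k. y ^ k / real k) has_sum - ln (1 - y)) {1..}"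
    by (rule has_sum_ln_one_minus[OF y])
  also have "((\<lambda>k. y ^ k / real k) has_sum - ln (1 - y)) {1..} \<longleftrightarrow>
      ((u \<circ> (\<lambda>k. 2 ^ k)) has_sum - ln (1 - y)) {1..}"
  proof (rule has_sum_cong)
    fix k :: nat assume k: "k \<in> {1..}"
    have "two_power_weight (2 ^ k) = 2 ^ k * ln 2" using k by (auto simp: two_power_weight_def)
    then have "u (2 ^ k) = (2 ^ k) powr - s * 2 ^ k / real k"
      using k by (simp add: u_def ln_realpow)
    also have "(2 ^ k) powr - s * 2 ^ k = y ^ k"
    proof -
      have two: "(2::real) ^ k = 2 powr real k" by (simp only: powr_realpow zero_less_numeral)
      have "y ^ k = y powr real k" by (simp add: powr_realpow y_def)
      also have "\<dots> = 2 powr (real k * - s + real k)"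
        unfolding y_def powr_powr by (simp add: algebra_simps)
      also have "\<dots> = (2 ^ k) powr - s * 2 ^ k" unfolding two powr_powr powr_add ..
      finally show ?thesis ..
    qed
    finally show "y ^ k / real k = (u \<circ> (\<lambda>k. 2 ^ k)) k" by simp
  qed
  also have "\<dots> \<longleftrightarrow> (u has_sum - ln (1 - y)) ((\<lambda>k. 2 ^ k) ` {1..})"
    by (rule has_sum_reindex[symmetric]) (simp add: inj_on_def)
  also have "\<dots> \<longleftrightarrow> (u has_sum - ln (1 - y)) {1..}"
    by (rule has_sum_cong_neutral) (auto simp: u_def two_power_weight_def)
  finally have "(\<lambda>n. u (Suc n)) sums - ln (1 - y)"
    unfolding has_sum_shift_atLeast_1 by (rule has_sum_imp_sums)
  moreover have "(\<lambda>n. Re (dterm eta.logc s n)) sums Re (dseries eta.logc s)"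
    using eta.summable_logc[OF s] unfolding dseries_def by (intro sums_Re summable_sums)
  moreover have "Re (dterm eta.logc s n) = real (Suc n) powr - s * log_coeff (Suc n) - u (Suc n)" for n
    unfolding dterm_def eta.logc_def
    by (simp add: log_coeff_def u_def right_diff_distrib left_diff_distrib divide_inverse mult_ac del: of_nat_Suc)
  ultimately have "(\<lambda>n. real (Suc n) powr - s * log_coeff (Suc n) - u (Suc n) + u (Suc n))
      sums (Re (dseries eta.logc s) + - ln (1 - y))"
    by (intro sums_add) simp_all
  then show ?thesis by (simp add: log_zeta_def y_def sums_iff)
qed

lemma log_zeta_asymptotic: "((\<lambda>s. log_zeta s + ln (s - 1)) \<longlongrightarrow> 0) (at_right 1)"
proof -
  let ?eta = "dseries (\<lambda>n. complex_of_real (eta_coeff n))"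
  have nonzero: "?eta 1 \<noteq> 0" by (simp add: eta_at_1)
  have "continuous_on {1..2} (?eta)"
    by (rule continuous_on_subset[OF continuous_on_dseries[OF eta.summable_g]]) simp
  then have "(?eta \<longlongrightarrow> of_real (ln 2)) (at_right 1)"
    unfolding eta_at_1[symmetric] by (rule continuous_on_Icc_at_rightD) simp
  then have "((\<lambda>s. ln (norm (?eta s))) \<longlongrightarrow> ln (norm (complex_of_real (ln 2)))) (at_right 1)"
    by (intro tendsto_intros) simp_all
  moreover have "((\<lambda>s. ln (s - 1) - ln (1 - 2 powr (1 - s))) \<longlongrightarrow> - ln (ln 2)) (at_right (1::real))"
    by real_asymp
  ultimately have "((\<lambda>s. ln (norm (?eta s)) +
      (ln (s - 1) - ln (1 - 2 powr (1 - s)))) \<longlongrightarrow> ln (norm (complex_of_real (ln 2))) + - ln (ln 2)) (at_right 1)"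
    by (rule tendsto_add)
  moreover have "\<forall>\<^sub>F s in at_right 1. ln (norm (?eta s)) +
      (ln (s - 1) - ln (1 - 2 powr (1 - s))) = log_zeta s + ln (s - 1)"
    using eventually_at_right_less[of 1]
  proof eventually_elim
    case (elim s)
    have "ln (norm (?eta s)) = Re (dseries eta.logc s)"
      unfolding eta.exp_dseries_logc[OF elim, symmetric] by simp
    then show ?case using log_zeta_eq_eta[OF elim] by simp
  qed
  ultimately show ?thesis by (simp add: Lim_transform_eventually)
qed

definition char_log_coeff :: "(nat \<Rightarrow> complex) \<Rightarrow> nat \<Rightarrow> complex" where
  "char_log_coeff chi n = log_coeff n *\<^sub>R chi n"

lemma norm_dterm_char_log_coeff_le:
  assumes "q > 0" "dirichlet_character q chi"
  shows "norm (dterm (char_log_coeff chi) s n) \<le> real (Suc n) powr - s * log_coeff (Suc n)"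
  using norm_character_le_1[OF assms(2,1), of "Suc n"] log_coeff_nonneg[of "Suc n"]
  by (simp add: dterm_def char_log_coeff_def mult_left_mono mult_left_le del: of_nat_Suc)

lemma summable_norm_char_log_coeff:
  assumes "q > 0" "dirichlet_character q chi" "s > 1"
  shows "summable (\<lambda>n. norm (dterm (char_log_coeff chi) s n))"
  by (rule summable_comparison_test'[OF summable_log_coeff[OF assms(3)]])
    (use norm_dterm_char_log_coeff_le[OF assms(1,2)] in simp)

lemma norm_log_series_le_log_zeta:
  assumes "q > 0" "dirichlet_character q chi" "s > 1"
  shows "norm (dseries (char_log_coeff chi) s) \<le> log_zeta s"
  unfolding dseries_def log_zeta_def
  by (rule order.trans[OF summable_norm suminf_le])
    (use summable_norm_char_log_coeff[OF assms] summable_log_coeff[OF assms(3)]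
      norm_dterm_char_log_coeff_le[OF assms(1,2)] in auto)

text \<open>
  By orthogonality \<open>\<Sum>\<chi>. ln L(s,\<chi>) = \<phi>(q) (\<Sum>n\<equiv>1. \<Lambda>(n)/ln n n powr -s)\<close>.
\<close>

lemma sum_log_series_nonneg:
  assumes q: "q > 0" and s: "s > 1"
  shows "(\<Sum>chi | dirichlet_character q chi. Re (dseries (char_log_coeff chi) s)) \<ge> 0"
proof -
  let ?X = "{chi. dirichlet_character q chi}"
  have sm: "summable (dterm (char_log_coeff chi) s)" if "chi \<in> ?X" for chi
    using summable_norm_char_log_coeff[OF q _ s] that summable_norm_cancel by blast
  have term_nonneg: "(\<Sum>chi\<in>?X. Re (dterm (char_log_coeff chi) s n)) \<ge> 0" for n
  proof -
    have "(\<Sum>chi\<in>?X. Re (dterm (char_log_coeff chi) s n)) =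
        real (Suc n) powr - s * log_coeff (Suc n) * Re (\<Sum>chi\<in>?X. cnj (chi 1) * chi (Suc n))"
      unfolding Re_sum sum_distrib_left
      by (rule sum.cong) (auto simp: dterm_def char_log_coeff_def character_one simp del: of_nat_Suc)
    also have "\<dots> \<ge> 0"
      using character_orthogonality[OF q, of 1 "Suc n"] log_coeff_nonneg[of "Suc n"] by simp
    finally show ?thesis .
  qed
  have sums: "(\<lambda>n. Re (dterm (char_log_coeff chi) s n)) sums Re (dseries (char_log_coeff chi) s)"
    if "chi \<in> ?X" for chi
    unfolding dseries_def by (intro sums_Re summable_sums sm that)
  have "(\<lambda>n. \<Sum>chi\<in>?X. Re (dterm (char_log_coeff chi) s n)) sums
      (\<Sum>chi\<in>?X. Re (dseries (char_log_coeff chi) s))"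
    by (rule sums_sum) (rule sums)
  then show ?thesis using term_nonneg by (metis sums_iff suminf_nonneg)
qed

text \<open>
  If \<open>L(1,\<chi>) = 0\<close> then \<open>L(s,\<chi>) = O(s - 1)\<close>.  Were this to happen for two characters, the sum of
  \<open>ln |L(s,\<chi>)|\<close> over all characters would be at most \<open>ln (s - 1) + O(1)\<close>, since the principal character
  contributes at most \<open>ln \<zeta>(s) = - ln (s - 1) + o(1)\<close>; so it would become negative.  A complex character
  and its conjugate vanish together, which leaves the real characters.
\<close>

theorem dseries_character_nonzero:
  assumes q: "q > 0" and chi: "dirichlet_character q chi" "chi \<noteq> principal_character q"
  shows "dseries chi 1 \<noteq> 0"
proof (cases "\<forall>n. cnj (chi n) = chi n")
  case True
  then show ?thesis using dseries_real_character_nonzero[OF q chi] by blast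
next
  case False
  define psi where "psi = (\<lambda>n. cnj (chi n))"
  have psi: "dirichlet_character q psi" unfolding psi_def by (rule dirichlet_character_cnj[OF chi(1)])
  have "psi \<noteq> chi" using False by (auto simp: psi_def fun_eq_iff)
  have psi': "psi \<noteq> principal_character q"
  proof
    assume eq: "psi = principal_character q"
    have "chi n = cnj (psi n)" for n by (simp add: psi_def)
    then have "chi = principal_character q" unfolding eq by (auto simp: principal_character_def)
    then show False using chi(2) by simp
  qed
  show ?thesis
  proof
    assume zero: "dseries chi 1 = 0"
    let ?X = "{chi. dirichlet_character q chi}" and ?f = "\<lambda>chi s. Re (dseries (char_log_coeff chi) s)"
    have log_eq: "?f rho s = ln (norm (dseries rho s))" "dseries rho s \<noteq> 0"
      if "dirichlet_character q rho" "rho \<noteq> principal_character q" "s > 1" for rho s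
    proof -
      interpret dirichlet_log rho "\<lambda>n. rho n * mangoldt n" "real q + 1" "4 * ln 2"
        by (rule dirichlet_log_character[OF q that(1,2)])
      have "logc = char_log_coeff rho"
        unfolding logc_def by (rule ext) (simp add: char_log_coeff_def log_coeff_def scaleR_conv_of_real divide_inverse mult_ac)
      then have "exp (dseries (char_log_coeff rho) s) = dseries rho s"
        using exp_dseries_logc[OF that(3)] by simp
      then show "?f rho s = ln (norm (dseries rho s))" "dseries rho s \<noteq> 0"
        by (metis norm_exp_eq_Re ln_exp, metis exp_not_eq_zero)
    qed
    have right: "\<forall>\<^sub>F s in at_right (1::real). s \<in> {1<..<2}"
      by (rule eventually_at_right_real) simp
    have vanishing: "\<exists>K. \<forall>\<^sub>F s in at_right 1. ?f rho s \<le> ln (s - 1) + K"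
      if rho: "dirichlet_character q rho" "rho \<noteq> principal_character q" "dseries rho 1 = 0" for rho
    proof -
      interpret dirichlet_log rho "\<lambda>n. rho n * mangoldt n" "real q + 1" "4 * ln 2"
        by (rule dirichlet_log_character[OF q rho(1,2)])
      obtain K where K: "\<forall>s\<in>{1..2}. norm (dseries rho s) \<le> K * (s - 1)"
        using dseries_g_Lipschitz unfolding rho(3) diff_zero by blast
      have "\<forall>\<^sub>F s in at_right 1. ?f rho s \<le> ln (s - 1) + ln K"
        using right
      proof eventually_elim
        case (elim s)
        then have s: "s > 1" by simp
        have pos: "0 < norm (dseries rho s)" using log_eq(2)[OF rho(1,2) s] by simp
        have le: "norm (dseries rho s) \<le> K * (s - 1)" using K elim by simp
        then have "K * (s - 1) > 0" using pos by linarith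
        then have "K > 0" using s by (simp add: zero_less_mult_iff)
        have "ln (norm (dseries rho s)) \<le> ln (K * (s - 1))"
          using pos le \<open>K * (s - 1) > 0\<close> by (subst ln_le_cancel_iff) assumption+
        then show ?case using log_eq(1)[OF rho(1,2) s] \<open>K > 0\<close> s by (simp add: ln_mult)
      qed
      then show ?thesis by blast
    qed
    have bounded: "\<exists>K. \<forall>\<^sub>F s in at_right 1. ?f rho s \<le> K"
      if rho: "dirichlet_character q rho" "rho \<noteq> principal_character q" for rho
    proof -
      interpret dirichlet_log rho "\<lambda>n. rho n * mangoldt n" "real q + 1" "4 * ln 2"
        by (rule dirichlet_log_character[OF q rho])
      obtain K where K: "\<forall>s\<in>{1..2}. norm (dseries rho s - dseries rho 1) \<le> K * (s - 1)"
        using dseries_g_Lipschitz by blast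
      have "\<forall>\<^sub>F s in at_right 1. ?f rho s \<le> ln (\<bar>K\<bar> + norm (dseries rho 1))"
        using right
      proof eventually_elim
        case (elim s)
        then have s: "s > 1" by simp
        have pos: "0 < norm (dseries rho s)" using log_eq(2)[OF rho s] by simp
        have "K * (s - 1) \<le> \<bar>K\<bar> * 1" using elim by (intro mult_mono) auto
        moreover have "norm (dseries rho s - dseries rho 1) \<le> K * (s - 1)" using K elim by simp
        ultimately have "norm (dseries rho s) \<le> \<bar>K\<bar> + norm (dseries rho 1)"
          using norm_triangle_sub[of "dseries rho s" "dseries rho 1"] by linarith
        moreover from this pos have "0 < \<bar>K\<bar> + norm (dseries rho 1)" by linarith
        ultimately show ?case
          unfolding log_eq(1)[OF rho s] using pos by (subst ln_le_cancel_iff) assumption+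
      qed
      then show ?thesis by blast
    qed
    have "dseries psi 1 = cnj (dseries chi 1)"
    proof -
      interpret dirichlet_log chi "\<lambda>n. chi n * mangoldt n" "real q + 1" "4 * ln 2"
        by (rule dirichlet_log_character[OF q chi])
      have "(\<lambda>n. cnj (dterm chi 1 n)) sums cnj (dseries chi 1)"
        unfolding dseries_def sums_cnj by (rule summable_sums[OF summable_g])
      moreover have "cnj (dterm chi 1 n) = dterm psi 1 n" for n by (simp add: dterm_def psi_def)
      ultimately show ?thesis unfolding dseries_def by (simp add: sums_iff)
    qed
    then have zero': "dseries psi 1 = 0" using zero by simp
    obtain K1 where K1: "\<forall>\<^sub>F s in at_right 1. ?f chi s \<le> ln (s - 1) + K1"
      using vanishing[OF chi zero] by blast
    obtain K2 where K2: "\<forall>\<^sub>F s in at_right 1. ?f psi s \<le> ln (s - 1) + K2"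
      using vanishing[OF psi psi' zero'] by blast
    let ?Y = "?X - {principal_character q, chi, psi}"
    have "\<forall>rho\<in>?Y. \<exists>K. \<forall>\<^sub>F s in at_right 1. ?f rho s \<le> K" using bounded by blast
    then obtain K where "\<forall>rho\<in>?Y. \<forall>\<^sub>F s in at_right 1. ?f rho s \<le> K rho" by metis
    then have K: "\<forall>\<^sub>F s in at_right 1. \<forall>rho\<in>?Y. ?f rho s \<le> K rho"
      using finite_dirichlet_characters[OF q] by (intro eventually_ball_finite) auto
    have zeta: "\<forall>\<^sub>F s in at_right 1. log_zeta s + ln (s - 1) < 1"
      using order_tendstoD(2)[OF log_zeta_asymptotic] by simp
    have "filterlim (\<lambda>s. ln (s - 1)) at_bot (at_right (1::real))" by real_asymp
    then have small: "\<forall>\<^sub>F s in at_right (1::real). ln (s - 1) < - (1 + K1 + K2 + (\<Sum>rho\<in>?Y. K rho))"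
      by (simp only: filterlim_at_bot_dense)
    have "\<forall>\<^sub>F s in at_right (1::real). False"
      using right K1 K2 K zeta small
    proof eventually_elim
      case (elim s)
      then have s: "s > 1" by simp
      have "(\<Sum>rho\<in>?X. ?f rho s) = ?f (principal_character q) s + (?f chi s + (?f psi s + (\<Sum>rho\<in>?Y. ?f rho s)))"
      proof -
        have "?X = insert (principal_character q) (insert chi (insert psi ?Y))"
          using chi psi dirichlet_character_principal[OF q] by auto
        then have "(\<Sum>rho\<in>?X. ?f rho s) = (\<Sum>rho\<in>insert (principal_character q) (insert chi (insert psi ?Y)). ?f rho s)"
          by simp
        also have "\<dots> = ?f (principal_character q) s + (?f chi s + (?f psi s + (\<Sum>rho\<in>?Y. ?f rho s)))"
          using chi(2) psi' \<open>psi \<noteq> chi\<close> finite_dirichlet_characters[OF q] by (subst sum.insert; auto)+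
        finally show ?thesis .
      qed
      moreover have "?f (principal_character q) s \<le> log_zeta s"
        using norm_log_series_le_log_zeta[OF q dirichlet_character_principal[OF q] s]
          complex_Re_le_cmod order.trans by blast
      moreover have "(\<Sum>rho\<in>?Y. ?f rho s) \<le> (\<Sum>rho\<in>?Y. K rho)"
        using elim by (intro sum_mono) blast
      moreover have "0 \<le> (\<Sum>rho\<in>?X. ?f rho s)" by (rule sum_log_series_nonneg[OF q s])
      ultimately show False using elim by linarith
    qed
    then show False by simp
  qed
qed

section \<open>The value at 1 of the logarithm of a Dirichlet L-function\<close>

text \<open>
  Two continuous logarithms differ by a multiple of \<open>2\<pi>\<i>\<close>, which is constant on \<open>[1,\<infinity>)\<close> and vanishes because
  both tend to \<open>0\<close> at infinity.
\<close>

lemma log_dirichlet_L_eqI: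
  assumes f: "continuous_on {1..} f" "\<And>t. t \<ge> 1 \<Longrightarrow> exp (f t) = dirichlet_L chi (of_real t)"
    "(f \<longlongrightarrow> 0) at_top" and s: "s \<ge> 1"
  shows "log_dirichlet_L chi s = f s"
  unfolding log_dirichlet_L_def
proof (rule the_equality)
  show "\<exists>g. continuous_on {1..} g \<and> (\<forall>t\<ge>1. exp (g t) = dirichlet_L chi (of_real t)) \<and>
      (g \<longlongrightarrow> 0) at_top \<and> f s = g s"
    using f by (intro exI[of _ f]) auto
next
  fix z assume "\<exists>g. continuous_on {1..} g \<and> (\<forall>t\<ge>1. exp (g t) = dirichlet_L chi (of_real t)) \<and>
      (g \<longlongrightarrow> 0) at_top \<and> z = g s"
  then obtain g where g: "continuous_on {1..} g" "\<forall>t\<ge>1. exp (g t) = dirichlet_L chi (of_real t)"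
    "(g \<longlongrightarrow> 0) at_top" and z: "z = g s" by blast
  define h where "h t = g t - f t" for t
  have exp_h: "exp (h t) = 1" if "t \<ge> 1" for t
  proof -
    have "exp (g t) = exp (f t)" using f(2)[OF that] g(2) that by simp
    then show ?thesis by (simp add: h_def exp_diff)
  qed
  have "h constant_on {1..}"
  proof (rule continuous_discrete_range_constant)
    show "connected {1::real..}" by (simp add: convex_connected)
    show "continuous_on {1..} h" unfolding h_def by (intro continuous_intros f g)
    fix x :: real assume x: "x \<in> {1..}"
    have "1 \<le> norm (h y - h x)" if y: "y \<in> {1..}" "h y \<noteq> h x" for y
    proof (rule ccontr)
      assume "\<not> 1 \<le> norm (h y - h x)"
      then have "\<bar>Im (h y) - Im (h x)\<bar> < 1" using abs_Im_le_cmod[of "h y - h x"] by simp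
      moreover have "1 < 2 * pi" using pi_gt3 by linarith
      ultimately have "\<bar>Im (h y) - Im (h x)\<bar> < 2 * pi" by linarith
      moreover have "exp (h y) = exp (h x)" using exp_h[of x] exp_h[of y] x y(1) by simp
      ultimately have "h y = h x" by (rule exp_complex_eqI)
      then show False using y by simp
    qed
    then show "\<exists>e>0. \<forall>y. y \<in> {1..} \<and> h y \<noteq> h x \<longrightarrow> e \<le> norm (h y - h x)"
      by (intro exI[of _ 1]) auto
  qed
  then obtain k where k: "\<And>t. t \<ge> 1 \<Longrightarrow> h t = k" unfolding constant_on_def by auto
  have "(h \<longlongrightarrow> 0 - 0) at_top" unfolding h_def by (intro tendsto_diff f g)
  moreover have "(h \<longlongrightarrow> k) at_top"
    by (rule tendsto_eventually) (rule eventually_mono[OF eventually_ge_at_top[of 1] k])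
  ultimately have "k = 0 - 0" by (rule tendsto_unique[OF trivial_limit_at_top_linorder, rotated])
  then show "z = f s" using k[OF s] z by (simp add: h_def)
qed

text \<open>
  The branch of \<open>ln L(s,\<chi>)\<close> that vanishes at infinity is given by its Dirichlet series up to \<open>s = 1\<close>.
\<close>

theorem log_dirichlet_L_at_1:
  assumes q: "q > 0" and chi: "dirichlet_character q chi" "chi \<noteq> principal_character q"
  shows "(\<lambda>N. \<Sum>n=1..N. (log_coeff n / real n) *\<^sub>R chi n) \<longlonglongrightarrow> log_dirichlet_L chi 1"
proof -
  interpret dirichlet_log chi "\<lambda>n. chi n * mangoldt n" "real q + 1" "4 * ln 2"
    by (rule dirichlet_log_character[OF q chi])
  note nonzero = dseries_character_nonzero[OF q chi]
  note sm = summable_logc_1[OF nonzero]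
  have "log_dirichlet_L chi 1 = dseries logc 1"
  proof (rule log_dirichlet_L_eqI)
    show "continuous_on {1..} (dseries logc)" by (rule continuous_on_dseries[OF sm])
    show "exp (dseries logc t) = dirichlet_L chi (of_real t)" if "t \<ge> 1" for t
      using exp_dseries_logc_ge_1[OF nonzero that] by (simp add: dirichlet_L_eq_dseries)
    show "(dseries logc \<longlongrightarrow> 0) at_top" using dseries_tendsto_at_top[OF sm] logc_1 by simp
  qed simp
  moreover have "(\<lambda>N. \<Sum>n<N. dterm logc 1 n) \<longlonglongrightarrow> dseries logc 1"
    unfolding dseries_def by (rule summable_LIMSEQ[OF sm])
  moreover have "(\<Sum>n<N. dterm logc 1 n) = (\<Sum>n=1..N. (log_coeff n / real n) *\<^sub>R chi n)" for N
    unfolding sum_dterm logc_def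
    by (rule sum.cong) (simp_all add: log_coeff_def scaleR_conv_of_real divide_inverse mult_ac)
  ultimately show ?thesis by simp
qed

section \<open>Sums over prime powers\<close>

lemma log_coeff_prime_power:
  assumes "prime p" "k > 0"
  shows "log_coeff (p ^ k) = 1 / real k"
  using assms prime_gt_1_nat[OF assms(1)] by (simp add: log_coeff_def ln_realpow)

lemma log_coeff_nonzeroD:
  assumes "log_coeff n \<noteq> 0"
  obtains p k where "prime p" "k > 0" "n = p ^ k"
  using assms by (auto simp: log_coeff_def mangoldt_def primepow_def split: if_splits)

text \<open>
  Unique factorisation turns sums over pairs (prime, exponent) into sums over integers weighted by
  \<open>\<Lambda>(n)/(n ln n)\<close>.
\<close>

lemma has_sum_prime_powers:
  assumes "\<And>p k. (p, k) \<in> T \<Longrightarrow> prime p \<and> k > 0"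
    and "\<And>n. n \<in> U \<Longrightarrow> log_coeff n \<noteq> 0 \<Longrightarrow> n \<in> (\<lambda>(p, k). p ^ k) ` T"
    and "(\<lambda>(p, k). p ^ k) ` T \<subseteq> U"
  shows "((\<lambda>(p, k). 1 / (real k * real p ^ k)) has_sum S) T \<longleftrightarrow> ((\<lambda>n. log_coeff n / real n) has_sum S) U"
proof -
  have "((\<lambda>(p, k). 1 / (real k * real p ^ k)) has_sum S) T \<longleftrightarrow>
      (((\<lambda>n. log_coeff n / real n) \<circ> (\<lambda>(p, k). p ^ k)) has_sum S) T"
    by (rule has_sum_cong) (use assms(1) in \<open>auto simp: log_coeff_prime_power\<close>)
  also have "\<dots> \<longleftrightarrow> ((\<lambda>n. log_coeff n / real n) has_sum S) ((\<lambda>(p, k). p ^ k) ` T)"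
  proof (rule has_sum_reindex[symmetric], rule inj_onI)
    fix x y assume xy: "x \<in> T" "y \<in> T" "(case x of (p, k) \<Rightarrow> p ^ k) = (case y of (p, k) \<Rightarrow> p ^ k)"
    obtain p k r l where *: "x = (p, k)" "y = (r, l)" by (cases x, cases y)
    show "x = y"
      using assms(1)[of p k] assms(1)[of r l] prime_power_inj''[of p r k l] xy * by auto
  qed
  also have "\<dots> \<longleftrightarrow> ((\<lambda>n. log_coeff n / real n) has_sum S) U"
    by (rule has_sum_cong_neutral) (use assms(2,3) in auto)
  finally show ?thesis .
qed

lemma has_sum_imp_partial_sums:
  fixes f :: "nat \<Rightarrow> real"
  assumes "(f has_sum S) {n. n > 0 \<and> P n}"
  shows "(\<lambda>N. \<Sum>n=1..N. if P n then f n else 0) \<longlonglongrightarrow> S"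
proof -
  have "((\<lambda>n. if P n then f n else 0) has_sum S) {1..}"
    using assms by (subst has_sum_cong_neutral[where T = "{n. n > 0 \<and> P n}" and g = f]) auto
  then have "(\<lambda>n. if P (Suc n) then f (Suc n) else 0) sums S"
    unfolding has_sum_shift_atLeast_1 by (rule has_sum_imp_sums)
  then show ?thesis unfolding sums_def sum_Suc_conv[of "\<lambda>n. if P n then f n else 0"] .
qed

lemma has_sum_one_prime:
  assumes "prime p"
  shows "((\<lambda>k. 1 / (real k * real p ^ k)) has_sum - ln (1 - 1 / real p)) {1..}"
proof -
  have "(1 / real p) ^ k / real k = 1 / (real k * real p ^ k)" for k
    by (simp add: power_divide mult.commute)
  then show ?thesis
    using has_sum_ln_one_minus[of "1 / real p"] prime_gt_1_nat[OF assms] by simp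
qed

text \<open>
  The prime powers that share a factor with \<open>q\<close> contribute \<open>- (\<Sum>p|q. ln (1 - 1/p)) = - ln (\<phi>(q)/q)\<close>.  This is
  where the factor \<open>\<phi>(q)/q\<close> in \<^const>\<open>mertens_L\<close> comes from.
\<close>

lemma sum_log_coeff_not_coprime:
  assumes q: "q > 0"
  shows "(\<lambda>N. \<Sum>n=1..N. if \<not> coprime n q then log_coeff n / real n else 0)
    \<longlonglongrightarrow> - ln (real (totient q) / real q)"
proof -
  let ?T = "(SIGMA p:prime_factors q. {1..}) :: (nat \<times> nat) set"
  have "((\<lambda>(p, k). 1 / (real k * real p ^ k)) has_sum (\<Sum>p\<in>prime_factors q. - ln (1 - 1 / real p))) ?T"
  proof (rule has_sum_SigmaI)
    show "((\<lambda>k. case (p, k) of (p, k) \<Rightarrow> 1 / (real k * real p ^ k)) has_sum - ln (1 - 1 / real p)) {1..}"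
      if "p \<in> prime_factors q" for p using has_sum_one_prime[of p] that by auto
    show "((\<lambda>p. - ln (1 - 1 / real p)) has_sum (\<Sum>p\<in>prime_factors q. - ln (1 - 1 / real p))) (prime_factors q)"
      by (rule has_sum_finite) simp
    show "(\<lambda>(p, k). 1 / (real k * real p ^ k)) summable_on ?T"
    proof (rule summable_on_SigmaI)
      show "((\<lambda>k. case (p, k) of (p, k) \<Rightarrow> 1 / (real k * real p ^ k)) has_sum - ln (1 - 1 / real p)) {1..}"
        if "p \<in> prime_factors q" for p using has_sum_one_prime[of p] that by auto
    qed auto
  qed
  also have "((\<lambda>(p, k). 1 / (real k * real p ^ k)) has_sum (\<Sum>p\<in>prime_factors q. - ln (1 - 1 / real p))) ?T \<longleftrightarrow>
      ((\<lambda>n. log_coeff n / real n) has_sum (\<Sum>p\<in>prime_factors q. - ln (1 - 1 / real p))) {n. n > 0 \<and> \<not> coprime n q}"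
  proof (rule has_sum_prime_powers)
    fix n assume n: "n \<in> {n. n > 0 \<and> \<not> coprime n q}" "log_coeff n \<noteq> 0"
    then obtain p k where pk: "prime p" "k > 0" "n = p ^ k" by (auto elim: log_coeff_nonzeroD)
    then have "\<not> coprime p q" using n by simp
    then have "p dvd q" using pk prime_imp_coprime by blast
    then have "p \<in> prime_factors q" using pk q by (simp add: prime_factors_dvd)
    then show "n \<in> (\<lambda>(p, k). p ^ k) ` ?T" using pk by (intro image_eqI[of _ _ "(p, k)"]) auto
  next
    show "(\<lambda>(p, k). p ^ k) ` ?T \<subseteq> {n. n > 0 \<and> \<not> coprime n q}"
    proof (rule image_subsetI)
      fix x assume "x \<in> ?T"
      then obtain p k where x: "x = (p, k)" "prime p" "p dvd q" "k \<ge> 1" by auto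
      have "\<not> is_unit p" using x(2) not_prime_unit by blast
      then have "\<not> coprime (p ^ k) q"
        using x(3,4) coprime_common_divisor[of p q p] by auto
      then show "(case x of (p, k) \<Rightarrow> p ^ k) \<in> {n. n > 0 \<and> \<not> coprime n q}"
        using x prime_gt_0_nat by auto
    qed
  qed auto
  also have "(\<Sum>p\<in>prime_factors q. - ln (1 - 1 / real p)) = - ln (real (totient q) / real q)"
  proof -
    have "real (totient q) / real q = (\<Prod>p\<in>prime_factors q. 1 - 1 / real p)"
      using q totient_formula2[of q] by simp
    moreover have "ln (\<Prod>p\<in>prime_factors q. 1 - 1 / real p) = (\<Sum>p\<in>prime_factors q. ln (1 - 1 / real p))"
      by (rule ln_prod) (auto simp: prime_gt_1_nat dest!: in_prime_factors_imp_prime)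
    ultimately show ?thesis by (simp add: sum_negf)
  qed
  finally show ?thesis by (rule has_sum_imp_partial_sums)
qed

definition ln_remainder :: "nat \<Rightarrow> real" where
  "ln_remainder p = - ln (1 - 1 / real p) - 1 / real p"

lemma has_sum_ln_remainder:
  assumes "prime p"
  shows "((\<lambda>k. 1 / (real k * real p ^ k)) has_sum ln_remainder p) {2..}"
proof -
  have "((\<lambda>k. 1 / (real k * real p ^ k)) has_sum ln_remainder p) ({1..} - {1})"
    unfolding ln_remainder_def
    using has_sum_Diff[OF has_sum_one_prime[OF assms] has_sum_finite[of "{1}"]] by simp
  moreover have "{1..} - {1} = {2::nat..}" by auto
  ultimately show ?thesis by simp
qed

lemma ln_remainder_nonneg: "prime p \<Longrightarrow> ln_remainder p \<ge> 0"
  by (rule has_sum_nonneg[OF has_sum_ln_remainder]) auto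

lemma ln_remainder_le:
  assumes "prime p"
  shows "ln_remainder p \<le> 2 / real p ^ 2"
proof -
  have "real p \<ge> 2" using prime_ge_2_nat[OF assms] by simp
  then have "\<bar>- (1 / real p)\<bar> \<le> 1 / 2" by (simp add: field_simps)
  then have "\<bar>ln (1 + - (1 / real p)) - - (1 / real p)\<bar> \<le> 2 * (- (1 / real p))\<^sup>2"
    by (rule abs_ln_one_plus_x_minus_x_bound)
  then show ?thesis by (simp add: ln_remainder_def power_one_over)
qed

lemma summable_ln_remainder: "ln_remainder summable_on {p. prime p}"
proof (rule summable_on_comparison_test)
  have "summable (\<lambda>n. norm (2 / real n ^ 2))"
    using summable_mult[OF inverse_power_summable[of 2, where 'a = real], of 2]
    by (simp add: divide_inverse)
  then have "(\<lambda>n. 2 / real n ^ 2) summable_on UNIV" by (rule norm_summable_imp_summable_on)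
  then show "(\<lambda>n. 2 / real n ^ 2) summable_on {p. prime p}" by (rule summable_on_subset) simp
qed (auto intro: ln_remainder_le ln_remainder_nonneg)

lemma summable_proper_prime_powers:
  "(\<lambda>(p, k). 1 / (real k * real p ^ k)) summable_on (SIGMA p:{p. prime p}. {2..})"
  by (rule summable_on_SigmaI[where g = ln_remainder])
    (use has_sum_ln_remainder summable_ln_remainder in auto)

section \<open>Mertens' theorem in arithmetic progressions\<close>

definition log_L_sum :: "nat \<Rightarrow> nat \<Rightarrow> complex" where
  "log_L_sum q a = (\<Sum>chi | dirichlet_character q chi \<and> chi \<noteq> principal_character q.
     cnj (chi a) * log_dirichlet_L chi 1)"

text \<open>
  Orthogonality expresses the sum over the class of \<open>a\<close> by sums over characters.  The principal character
  gives Mertens' sum without the primes dividing \<open>q\<close>, the others give \<open>ln L(1,\<chi>)\<close> in the limit.  The sum over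
  the class and the principal part are real for every \<open>N\<close>, so the limit \<^term>\<open>log_L_sum q a\<close> of their difference is real.
\<close>

lemma sum_log_coeff_residue_class:
  assumes q: "q > 0" and a: "coprime a q"
  shows "Im (log_L_sum q a) = 0"
    and "(\<lambda>N. real (totient q) * (\<Sum>n=1..N. if [n = a] (mod q) then log_coeff n / real n else 0) - ln (ln (real N)))
      \<longlonglongrightarrow> euler_mascheroni + ln (real (totient q) / real q) + Re (log_L_sum q a)"
proof -
  let ?A = "\<lambda>N. (\<Sum>n=1..N. mangoldt n / (real n * ln (real n)))"
  let ?B = "\<lambda>N. (\<Sum>n=1..N. if \<not> coprime n q then log_coeff n / real n else 0)"
  let ?C = "\<lambda>chi N. (\<Sum>n=1..N. (log_coeff n / real n) *\<^sub>R chi n)"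
  let ?X = "{chi. dirichlet_character q chi}"
  let ?Y = "{chi. dirichlet_character q chi \<and> chi \<noteq> principal_character q}"
  define W where "W N = (\<Sum>n=1..N. if [n = a] (mod q) then log_coeff n / real n else 0)" for N
  define P where "P N = (\<Sum>n=1..N. if coprime n q then log_coeff n / real n else 0)" for N
  define D where "D N = real (totient q) * W N - P N" for N
  have split: "complex_of_real (D N) = (\<Sum>chi\<in>?Y. cnj (chi a) * ?C chi N)" for N
  proof -
    have "complex_of_real (real (totient q) * W N) =
        (\<Sum>n=1..N. (log_coeff n / real n) *\<^sub>R (\<Sum>chi\<in>?X. cnj (chi a) * chi n))"
      unfolding W_def sum_distrib_left of_real_sum
      unfolding character_orthogonality[OF q a]
      by (rule sum.cong[OF refl]) (simp add: scaleR_conv_of_real mult.commute)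
    also have "\<dots> = (\<Sum>chi\<in>?X. cnj (chi a) * ?C chi N)"
      unfolding scaleR_sum_right sum_distrib_left
      by (subst sum.swap) (simp add: scaleR_conv_of_real mult_ac)
    also have "?X = insert (principal_character q) ?Y"
      using dirichlet_character_principal[OF q] by auto
    also have "(\<Sum>chi\<in>insert (principal_character q) ?Y. cnj (chi a) * ?C chi N) =
        cnj (principal_character q a) * (\<Sum>n=1..N. (log_coeff n / real n) *\<^sub>R principal_character q n) +
        (\<Sum>chi\<in>?Y. cnj (chi a) * ?C chi N)"
      using finite_dirichlet_characters[OF q] by (subst sum.insert) auto
    also have "cnj (principal_character q a) * (\<Sum>n=1..N. (log_coeff n / real n) *\<^sub>R principal_character q n) =
        of_real (P N)"
      using a unfolding P_def of_real_sum
      by (simp add: principal_character_def) (rule sum.cong, auto simp: scaleR_conv_of_real)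
    finally show ?thesis by (simp add: D_def)
  qed
  have lim: "(\<lambda>N. complex_of_real (D N)) \<longlonglongrightarrow> log_L_sum q a"
    unfolding split log_L_sum_def by (intro tendsto_sum tendsto_mult tendsto_const log_dirichlet_L_at_1[OF q]) auto
  from tendsto_Im[OF lim] have "(\<lambda>N. 0::real) \<longlonglongrightarrow> Im (log_L_sum q a)" by simp
  then show "Im (log_L_sum q a) = 0" by (simp add: LIMSEQ_const_iff)
  from tendsto_Re[OF lim] have D: "D \<longlonglongrightarrow> Re (log_L_sum q a)" by simp
  have P: "P N = ?A N -
      ?B N" for N
    unfolding P_def sum_subtractf[symmetric] by (rule sum.cong) (auto simp: log_coeff_def)
  have "(\<lambda>N. D N + (?A N - ln (ln (real N)) -
      ?B N))
      \<longlonglongrightarrow> Re (log_L_sum q a) + (euler_mascheroni - - ln (real (totient q) / real q))"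
    by (intro tendsto_add tendsto_diff D sum_mangoldt_over_n_ln_n sum_log_coeff_not_coprime q)
  moreover have "D N + (?A N - ln (ln (real N)) -
      ?B N) = real (totient q) * W N - ln (ln (real N))" for N
    using P[of N] by (simp add: D_def)
  moreover have "Re (log_L_sum q a) + (euler_mascheroni - - ln (real (totient q) / real q)) =
      euler_mascheroni + ln (real (totient q) / real q) + Re (log_L_sum q a)" by simp
  ultimately show "(\<lambda>N. real (totient q) * (\<Sum>n=1..N. if [n = a] (mod q) then log_coeff n / real n else 0) - ln (ln (real N)))
      \<longlonglongrightarrow> euler_mascheroni + ln (real (totient q) / real q) + Re (log_L_sum q a)"
    unfolding W_def by (simp only:)
qed

text \<open>
  Since \<^term>\<open>log_L_sum q a\<close> is real, the product that defines \<^const>\<open>mertens_L\<close> is a positive real number,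
  which has exactly one positive root of order \<open>\<phi>(q)\<close>.
\<close>

lemma mertens_L_eq:
  assumes q: "q > 0" and a: "coprime a q"
  shows "mertens_L q a = exp ((ln (real (totient q) / real q) + Re (log_L_sum q a)) / real (totient q))"
    (is "_ = ?r")
proof -
  have phi: "totient q > 0" using q by simp
  have X: "log_L_sum q a = of_real (Re (log_L_sum q a))"
    using sum_log_coeff_residue_class(1)[OF q a] by (simp add: complex_eq_iff)
  have "(\<Prod>chi | dirichlet_character q chi \<and> chi \<noteq> principal_character q.
      dirichlet_L_power chi 1 (cnj (chi a))) = exp (log_L_sum q a)"
    unfolding dirichlet_L_power_def log_L_sum_def
    using finite_dirichlet_characters[OF q] by (subst exp_sum) auto
  also have "\<dots> = of_real (exp (Re (log_L_sum q a)))" by (subst X) (rule exp_of_real)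
  finally have prod: "of_nat (totient q) / of_nat q *
      (\<Prod>chi | dirichlet_character q chi \<and> chi \<noteq> principal_character q.
        dirichlet_L_power chi 1 (cnj (chi a))) =
      complex_of_real (real (totient q) / real q * exp (Re (log_L_sum q a)))" by simp
  have pow: "?r ^ totient q = real (totient q) / real q * exp (Re (log_L_sum q a))"
    using phi q by (simp add: exp_of_nat_mult[symmetric] exp_add)
  show ?thesis
    unfolding mertens_L_def prod of_real_eq_iff
  proof (rule the_equality)
    show "?r > 0 \<and> ?r ^ totient q = real (totient q) / real q * exp (Re (log_L_sum q a))"
      using pow by simp
    fix r :: real assume "r > 0 \<and> r ^ totient q = real (totient q) / real q * exp (Re (log_L_sum q a))"
    then have "r > 0" "r ^ totient q = ?r ^ totient q" using pow by simp_all
    then show "r = ?r" using power_eq_iff_eq_base[OF phi, of r ?r] by simp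
  qed
qed

definition primes_upto_in_class :: "real \<Rightarrow> nat \<Rightarrow> nat \<Rightarrow> nat set" where
  "primes_upto_in_class x q a = {p. prime p \<and> real p \<le> x \<and> [p = a] (mod q)}"

lemma finite_primes_upto_in_class: "finite (primes_upto_in_class x q a)"
proof (rule finite_subset)
  show "primes_upto_in_class x q a \<subseteq> {..nat \<lfloor>x\<rfloor>}"
    by (auto simp: primes_upto_in_class_def le_nat_floor)
qed simp

text \<open>
  Splitting off the prime powers with exponent at least \<open>2\<close> from the sum over the residue class
  produces the correction terms in the definition of \<open>G(q,a)\<close>.
\<close>

theorem mertens_sum_primes_residue_class:
  assumes q: "q > 0" and a: "coprime a q"
  shows "(\<lambda>N. (\<Sum>p\<in>primes_upto_in_class (real N) q a. 1 / real p) - ln (ln (real N)) / real (totient q))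
    \<longlonglongrightarrow> euler_mascheroni / real (totient q) + ln (mertens_G q a) -
      (\<Sum>\<^sub>\<infinity>p\<in>{p. prime p \<and> [p = a] (mod q)}. ln_remainder p)"
proof -
  let ?W = "\<lambda>N. (\<Sum>n=1..N. if [n = a] (mod q) then log_coeff n / real n else 0)"
  let ?V = "\<lambda>N. (\<Sum>n=1..N. if \<not> prime n \<and> [n = a] (mod q) then log_coeff n / real n else 0)"
  let ?U = "\<lambda>N. (\<Sum>n=1..N. if prime n \<and> [n = a] (mod q) then log_coeff n / real n else 0)"
  let ?S = "\<lambda>N. (\<Sum>p\<in>primes_upto_in_class (real N) q a. 1 / real p)"
  let ?phi = "real (totient q)"
  have phi: "?phi > 0" using q by simp
  define R where "R = (\<Sum>\<^sub>\<infinity>p\<in>{p. prime p \<and> [p = a] (mod q)}. ln_remainder p)"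
  let ?T = "{(p, k). prime p \<and> k \<ge> 2 \<and> [p ^ k = a] (mod q)}"
  define Q where "Q = (\<Sum>\<^sub>\<infinity>(p, k)\<in>?T. 1 / (real k * real p ^ k))"
  have "(\<lambda>(p, k). 1 / (real k * real p ^ k)) summable_on ?T"
    by (rule summable_on_subset[OF summable_proper_prime_powers]) auto
  then have "((\<lambda>(p, k). 1 / (real k * real p ^ k)) has_sum Q) ?T"
    unfolding Q_def by (rule has_sum_infsum)
  also have "((\<lambda>(p, k). 1 / (real k * real p ^ k)) has_sum Q) ?T \<longleftrightarrow>
      ((\<lambda>n. log_coeff n / real n) has_sum Q) {n. n > 0 \<and> (\<not> prime n \<and> [n = a] (mod q))}"
  proof (rule has_sum_prime_powers)
    fix n assume n: "n \<in> {n. n > 0 \<and> (\<not> prime n \<and> [n = a] (mod q))}" "log_coeff n \<noteq> 0"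
    then obtain p k where pk: "prime p" "k > 0" "n = p ^ k" by (auto elim: log_coeff_nonzeroD)
    have "k \<noteq> 1"
    proof
      assume "k = 1"
      then show False using pk n by simp
    qed
    then have "k \<ge> 2" using pk by linarith
    then show "n \<in> (\<lambda>(p, k). p ^ k) ` ?T" using pk n by (intro image_eqI[of _ _ "(p, k)"]) auto
  next
    show "(\<lambda>(p, k). p ^ k) ` ?T \<subseteq> {n. n > 0 \<and> (\<not> prime n \<and> [n = a] (mod q))}"
    proof (rule image_subsetI)
      fix x assume "x \<in> ?T"
      then obtain p k where x: "x = (p, k)" "prime p" "k \<ge> 2" "[p ^ k = a] (mod q)" by auto
      have "\<not> prime (p ^ k)" using x(3) prime_power_iff[of p k] by auto
      then show "(case x of (p, k) \<Rightarrow> p ^ k) \<in> {n. n > 0 \<and> (\<not> prime n \<and> [n = a] (mod q))}"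
        using x prime_gt_0_nat by auto
    qed
  qed auto
  finally have limQ: "(\<lambda>N. \<Sum>n=1..N. if \<not> prime n \<and> [n = a] (mod q) then log_coeff n / real n else 0) \<longlonglongrightarrow> Q"
    by (rule has_sum_imp_partial_sums)

  have "(\<Sum>\<^sub>\<infinity>p\<in>{p. prime p \<and> [p = a] (mod q)}. \<Sum>\<^sub>\<infinity>k\<in>{2..}. 1 / (real k * real p ^ k)) = R"
    unfolding R_def by (rule infsum_cong) (auto intro!: infsumI has_sum_ln_remainder)
  then have "mertens_G q a = mertens_L q a * exp (R - Q)" by (simp only: mertens_G_def Q_def)
  then have lnG: "ln (mertens_G q a) =
      (ln (?phi / real q) + Re (log_L_sum q a)) / ?phi + (R - Q)"
    by (simp add: mertens_L_eq[OF q a] ln_mult)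

  have "(\<lambda>N. (?phi * ?W N - ln (ln (real N)))
      / ?phi - ?V N)
      \<longlonglongrightarrow> (euler_mascheroni + ln (?phi / real q) + Re (log_L_sum q a)) / ?phi - Q"
    using phi by (intro tendsto_diff tendsto_divide sum_log_coeff_residue_class(2) q a limQ tendsto_const) auto
  also have "(\<lambda>N. (?phi * ?W N - ln (ln (real N)))
      / ?phi - ?V N) =
      (\<lambda>N. ?S N - ln (ln (real N)) / ?phi)"
  proof
    fix N
    have "?W N =
        ?U N +
        ?V N"
      by (subst sum.distrib[symmetric], rule sum.cong[OF refl]) simp
    also have "?U N =
        ?S N"
    proof (rule sum.mono_neutral_cong_right)
      show "primes_upto_in_class (real N) q a \<subseteq> {1..N}"
      proof
        fix p assume "p \<in> primes_upto_in_class (real N) q a"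
        then have "prime p" "p \<le> N" by (simp_all add: primes_upto_in_class_def)
        then show "p \<in> {1..N}" using prime_ge_1_nat[of p] by simp
      qed
      show "(if prime n \<and> [n = a] (mod q) then log_coeff n / real n else 0) = 1 / real n"
        if "n \<in> primes_upto_in_class (real N) q a" for n
        using that log_coeff_prime_power[of n 1] by (simp add: primes_upto_in_class_def)
    qed (auto simp: primes_upto_in_class_def)
    finally show "(?phi * ?W N - ln (ln (real N)))
      / ?phi - ?V N =
      ?S N - ln (ln (real N)) / ?phi"
      using phi by (simp add: diff_divide_distrib)
  qed
  also have "(euler_mascheroni + ln (?phi / real q) + Re (log_L_sum q a)) / ?phi - Q =
      euler_mascheroni / ?phi + ln (mertens_G q a) - R"
    unfolding lnG by (simp add: add_divide_distrib)
  finally show ?thesis unfolding R_def .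
qed

section \<open>The integral of the error term\<close>

text \<open>
  On an unbounded interval the Henstock-Kurzweil integral is an improper integral and requires only
  conditional convergence.
\<close>

lemma has_integral_atLeastI:
  fixes f :: "real \<Rightarrow> real"
  assumes f: "\<And>b. b \<ge> x \<Longrightarrow> (f has_integral J b) {x..b}" and J: "(J \<longlongrightarrow> l) at_top"
  shows "(f has_integral l) {x..}"
  unfolding has_integral_alt'
proof (intro conjI allI impI)
  have Int: "{x..} \<inter> cbox a b = {max a x..b}" for a b :: real by auto
  have "f integrable_on {max a x..b}" for a b
  proof (cases "max a x \<le> b")
    case True
    then have "f integrable_on {x..b}" using f[of b] by (auto simp: integrable_on_def)
    then show ?thesis by (rule integrable_subinterval_real) auto
  next
    case False
    then have "{max a x..b} = {}" by auto
    then show ?thesis by (simp only: integrable_on_empty)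
  qed
  then show "(\<lambda>t. if t \<in> {x..} then f t else 0) integrable_on cbox a b" for a b
    unfolding integrable_restrict_Int Int .
  fix e :: real assume "e > 0"
  then have "\<forall>\<^sub>F b in at_top. dist (J b) l < e" using J by (simp add: tendsto_iff)
  then obtain B where B: "\<And>b. b \<ge> B \<Longrightarrow> dist (J b) l < e" by (auto simp: eventually_at_top_linorder)
  show "\<exists>B>0. \<forall>a b. ball 0 B \<subseteq> cbox a b \<longrightarrow>
      norm (integral (cbox a b) (\<lambda>t. if t \<in> {x..} then f t else 0) - l) < e"
  proof (intro exI[of _ "\<bar>B\<bar> + \<bar>x\<bar> + 1"] conjI allI impI)
    fix a b :: real assume "ball 0 (\<bar>B\<bar> + \<bar>x\<bar> + 1) \<subseteq> cbox a b"
    moreover have "x \<in> ball 0 (\<bar>B\<bar> + \<bar>x\<bar> + 1)" "B \<in> ball 0 (\<bar>B\<bar> + \<bar>x\<bar> + 1)" by auto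
    ultimately have "x \<in> cbox a b" "B \<in> cbox a b" by blast+
    then have ab: "a \<le> x" "x \<le> b" "B \<le> b" by auto
    have "integral (cbox a b) (\<lambda>t. if t \<in> {x..} then f t else 0) = integral ({x..} \<inter> cbox a b) f"
      by (rule integral_restrict_Int)
    also have "\<dots> = J b" using ab f[of b] by (simp add: Int max_def integral_unique del: box_real)
    finally show "norm (integral (cbox a b) (\<lambda>t. if t \<in> {x..} then f t else 0) - l) < e"
      using B[OF ab(3)] by (simp add: dist_norm)
  qed linarith
qed

lemma has_integral_inverse_square:
  fixes c b :: real
  assumes "0 < c" "c \<le> b"
  shows "((\<lambda>t. 1 / t\<^sup>2) has_integral 1 / c - 1 / b) {c..b}"
proof -
  have "((\<lambda>t. 1 / t\<^sup>2) has_integral (- (1 / b)) - (- (1 / c))) {c..b}"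
  proof (rule fundamental_theorem_of_calculus[OF assms(2)])
    fix t assume "t \<in> {c..b}"
    then have "t \<noteq> 0" using assms by auto
    then show "((\<lambda>t. - (1 / t)) has_vector_derivative 1 / t\<^sup>2) (at t within {c..b})"
      unfolding has_real_derivative_iff_has_vector_derivative[symmetric]
      by (auto intro!: derivative_eq_intros simp: power2_eq_square)
  qed
  then show ?thesis by simp
qed

lemma prime_count_ap_eq: "prime_count_ap t q a = card (primes_upto_in_class t q a)"
  by (simp add: prime_count_ap_def primes_upto_in_class_def)

lemma has_integral_prime_count_ap:
  assumes x: "0 < x" "x \<le> b"
  shows "((\<lambda>t. real (prime_count_ap t q a) / t\<^sup>2) has_integral
    real (prime_count_ap x q a) / x - real (prime_count_ap b q a) / b +
    ((\<Sum>p\<in>primes_upto_in_class b q a. 1 / real p) - (\<Sum>p\<in>primes_upto_in_class x q a. 1 / real p))) {x..b}"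
proof -
  let ?P = "\<lambda>y. primes_upto_in_class y q a"
  have fin: "finite (?P y)" for y by (rule finite_primes_upto_in_class)
  have sub: "?P x \<subseteq> ?P b" using x by (auto simp: primes_upto_in_class_def)
  have one: "((\<lambda>t. if real p \<le> t then 1 / t\<^sup>2 else 0) has_integral 1 / max x (real p) - 1 / b) {x..b}"
    if p: "p \<in> ?P b" for p
  proof -
    have le: "max x (real p) \<le> b" using p x by (simp add: primes_upto_in_class_def)
    have "((\<lambda>t. 1 / t\<^sup>2) has_integral 1 / max x (real p) - 1 / b) {max x (real p)..b}"
      using x le by (intro has_integral_inverse_square) auto
    then have "((\<lambda>t. if t \<in> {max x (real p)..b} then 1 / t\<^sup>2 else 0) has_integral 1 / max x (real p) - 1 / b) {x..b}"
      by (subst has_integral_restrict) auto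
    then show ?thesis by (rule has_integral_eq[rotated]) auto
  qed
  have "((\<lambda>t. \<Sum>p\<in>?P b. if real p \<le> t then 1 / t\<^sup>2 else 0) has_integral
      (\<Sum>p\<in>?P b. 1 / max x (real p) - 1 / b)) {x..b}"
    by (rule has_integral_sum[OF fin one])
  then have "((\<lambda>t. real (prime_count_ap t q a) / t\<^sup>2) has_integral (\<Sum>p\<in>?P b. 1 / max x (real p) - 1 / b)) {x..b}"
  proof (rule has_integral_eq[rotated])
    fix t assume t: "t \<in> {x..b}"
    have "(\<Sum>p\<in>?P b. if real p \<le> t then 1 / t\<^sup>2 else 0) = (\<Sum>p\<in>?P t. 1 / t\<^sup>2)"
      by (rule sum.mono_neutral_cong_right[OF fin]) (use t in \<open>auto simp: primes_upto_in_class_def\<close>)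
    then show "(\<Sum>p\<in>?P b. if real p \<le> t then 1 / t\<^sup>2 else 0) = real (prime_count_ap t q a) / t\<^sup>2"
      by (simp add: prime_count_ap_eq)
  qed
  also have "(\<Sum>p\<in>?P b. 1 / max x (real p) - 1 / b) =
      real (prime_count_ap x q a) / x - real (prime_count_ap b q a) / b +
      ((\<Sum>p\<in>?P b. 1 / real p) - (\<Sum>p\<in>?P x. 1 / real p))"
  proof -
    have "(\<Sum>p\<in>?P b. 1 / max x (real p)) =
        (\<Sum>p\<in>?P b - ?P x. 1 / max x (real p)) + (\<Sum>p\<in>?P x. 1 / max x (real p))"
      by (rule sum.subset_diff[OF sub fin])
    also have "(\<Sum>p\<in>?P x. 1 / max x (real p)) = (\<Sum>p\<in>?P x. 1 / x)"
      by (rule sum.cong) (auto simp: primes_upto_in_class_def max_def)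
    also have "(\<Sum>p\<in>?P b - ?P x. 1 / max x (real p)) = (\<Sum>p\<in>?P b - ?P x. 1 / real p)"
      by (rule sum.cong) (auto simp: primes_upto_in_class_def max_def)
    also have "\<dots> = (\<Sum>p\<in>?P b. 1 / real p) - (\<Sum>p\<in>?P x. 1 / real p)"
      by (rule sum_diff[OF fin sub])
    finally show ?thesis by (simp add: sum_subtractf prime_count_ap_eq)
  qed
  finally show ?thesis .
qed

lemma log_integral_has_derivative:
  assumes "2 \<le> t" "t \<le> b"
  shows "(log_integral has_real_derivative 1 / ln t) (at t within {2..b})"
proof -
  have "continuous_on {2..b} (\<lambda>u. 1 / ln u)" by (intro continuous_intros) auto
  then show ?thesis
    using integral_has_vector_derivative[of 2 b "\<lambda>u. 1 / ln u" t] assms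
    unfolding has_real_derivative_iff_has_vector_derivative log_integral_def by simp
qed

lemma has_integral_log_integral:
  assumes x: "2 \<le> x" "x \<le> b"
  shows "((\<lambda>t. log_integral t / t\<^sup>2) has_integral
    log_integral x / x - log_integral b / b + (ln (ln b) - ln (ln x))) {x..b}"
proof -
  have "((\<lambda>t. log_integral t / t\<^sup>2) has_integral
      (ln (ln b) - log_integral b / b) - (ln (ln x) - log_integral x / x)) {x..b}"
  proof (rule fundamental_theorem_of_calculus[OF x(2)])
    fix t assume t: "t \<in> {x..b}"
    then have t0: "t > 1" "ln t > 0" using x by auto
    have D: "(log_integral has_real_derivative 1 / ln t) (at t within {x..b})"
      by (rule DERIV_subset[OF log_integral_has_derivative[of t b]]) (use t x in auto)
    have "((\<lambda>t. ln (ln t) - log_integral t / t) has_real_derivative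
        1 / ln t * (1 / t) - (1 / ln t * t - log_integral t * 1) / (t * t)) (at t within {x..b})"
    proof (rule DERIV_diff)
      show "((\<lambda>t. ln (ln t)) has_real_derivative 1 / ln t * (1 / t)) (at t within {x..b})"
        using t0 by (auto intro!: derivative_eq_intros)
      show "((\<lambda>t. log_integral t / t) has_real_derivative
          (1 / ln t * t - log_integral t * 1) / (t * t)) (at t within {x..b})"
        using t0 by (intro DERIV_divide D DERIV_ident) simp
    qed
    also have "1 / ln t * (1 / t) - (1 / ln t * t - log_integral t * 1) / (t * t) = log_integral t / t\<^sup>2"
      using t0 by (simp add: diff_divide_distrib power2_eq_square)
    finally show "((\<lambda>t. ln (ln t) - log_integral t / t) has_vector_derivative log_integral t / t\<^sup>2) (at t within {x..b})"
      unfolding has_real_derivative_iff_has_vector_derivative .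
  qed
  then show ?thesis by (simp add: algebra_simps)
qed

lemma log_integral_over_tendsto_0: "((\<lambda>t. log_integral t / t) \<longlongrightarrow> 0) at_top"
proof (rule lhospital_at_top_at_top[where g = "\<lambda>t. t" and g' = "\<lambda>_. 1"])
  show "((\<lambda>t. 1 / ln t / 1) \<longlongrightarrow> 0) (at_top :: real filter)" by real_asymp
  show "\<forall>\<^sub>F t in at_top. (log_integral has_real_derivative 1 / ln t) (at t)"
    using eventually_gt_at_top[of 2]
  proof eventually_elim
    case (elim t)
    have "(log_integral has_real_derivative 1 / ln t) (at t within {2..t + 1})"
      using elim by (intro log_integral_has_derivative) auto
    moreover have "at t within {2..t + 1} = at t"
      by (rule at_within_interior) (use elim in \<open>simp add: interior_atLeastAtMost_real\<close>)
    ultimately show ?case by (simp only:)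
  qed
qed (simp_all add: filterlim_ident)

text \<open>
  Primes between \<open>sqrt b\<close> and \<open>b\<close> carry the weight \<open>\<Lambda>(p) \<ge> ln b / 2\<close>, so Chebyshev's bound for \<open>\<psi>\<close> yields
  \<open>\<pi>(b) = O(b / ln b)\<close>.
\<close>

lemma prime_count_ap_le:
  assumes b: "b \<ge> 2"
  shows "real (prime_count_ap b q a) \<le> sqrt b + 8 * ln 2 * b / ln b"
proof -
  let ?P = "primes_upto_in_class b q a"
  have "ln b > 0" using b by simp
  have fin: "finite ?P" by (rule finite_primes_upto_in_class)
  have P: "prime p" "real p \<le> b" if "p \<in> ?P" for p using that by (auto simp: primes_upto_in_class_def)
  have "real (prime_count_ap b q a) = (\<Sum>p\<in>?P. 1)" by (simp add: prime_count_ap_eq)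
  also have "\<dots> \<le> (\<Sum>p\<in>?P. (if real p \<le> sqrt b then 1 else 0) + 2 * mangoldt p / ln b)"
  proof (rule sum_mono)
    fix p assume p: "p \<in> ?P"
    show "1 \<le> (if real p \<le> sqrt b then 1 else 0) + 2 * mangoldt p / ln b"
    proof (cases "real p \<le> sqrt b")
      case True
      then show ?thesis using mangoldt_nonneg[of p] \<open>ln b > 0\<close> by simp
    next
      case False
      have "ln (sqrt b) \<le> ln (real p)"
        using False b prime_gt_0_nat[OF P(1)[OF p]] by (subst ln_le_cancel_iff) auto
      then have "ln b \<le> 2 * mangoldt p" using P(1)[OF p] b by (simp add: ln_sqrt)
      then show ?thesis using False \<open>ln b > 0\<close> by simp
    qed
  qed
  also have "\<dots> = (\<Sum>p\<in>?P. if real p \<le> sqrt b then 1 else 0) + 2 / ln b * (\<Sum>p\<in>?P. mangoldt p)"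
    by (simp add: sum.distrib sum_distrib_left)
  also have "(\<Sum>p\<in>?P. if real p \<le> sqrt b then 1 else 0) \<le> sqrt b"
  proof -
    have "(\<Sum>p\<in>?P. if real p \<le> sqrt b then 1 else 0 :: real) = (\<Sum>p\<in>{p\<in>?P. real p \<le> sqrt b}. 1)"
      by (rule sum.mono_neutral_cong_right[OF fin]) auto
    also have "\<dots> \<le> (\<Sum>p\<in>{1..nat \<lfloor>sqrt b\<rfloor>}. 1)"
      by (rule sum_mono2) (auto dest!: P(1) simp: le_nat_floor prime_ge_Suc_0_nat)
    also have "\<dots> \<le> sqrt b" using b by simp
    finally show ?thesis .
  qed
  also have "(\<Sum>p\<in>?P. mangoldt p) \<le> 4 * ln 2 * b"
  proof -
    have "(\<Sum>p\<in>?P. mangoldt p) \<le> (\<Sum>n=1..nat \<lfloor>b\<rfloor>. mangoldt n :: real)"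
    proof (rule sum_mono2)
      show "?P \<subseteq> {1..nat \<lfloor>b\<rfloor>}"
      proof
        fix p assume "p \<in> ?P"
        then show "p \<in> {1..nat \<lfloor>b\<rfloor>}"
          using P[of p] prime_ge_1_nat[of p] by (simp add: le_nat_floor)
      qed
    qed (auto simp: mangoldt_nonneg)
    also have "\<dots> \<le> 4 * ln 2 * real (nat \<lfloor>b\<rfloor>)" by (rule chebyshev_psi_le)
    also have "\<dots> \<le> 4 * ln 2 * b" using b by (intro mult_left_mono) auto
    finally show ?thesis .
  qed
  finally show ?thesis using \<open>ln b > 0\<close> by (simp add: divide_right_mono mult_ac)
qed

lemma prime_error_ap_over_tendsto_0: "((\<lambda>t. prime_error_ap t q a / t) \<longlongrightarrow> 0) at_top"
proof -
  have "((\<lambda>t. real (prime_count_ap t q a) / t) \<longlongrightarrow> 0) at_top"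
  proof (rule tendsto_sandwich[where f = "\<lambda>_. 0" and h = "\<lambda>t. (sqrt t + 8 * ln 2 * t / ln t) / t"])
    show "((\<lambda>t. (sqrt t + 8 * ln 2 * t / ln t) / t) \<longlongrightarrow> 0) (at_top :: real filter)" by real_asymp
    show "\<forall>\<^sub>F t in at_top. 0 \<le> real (prime_count_ap t q a) / t"
      using eventually_ge_at_top[of 2] by eventually_elim simp
    show "\<forall>\<^sub>F t in at_top. real (prime_count_ap t q a) / t \<le> (sqrt t + 8 * ln 2 * t / ln t) / t"
      using eventually_ge_at_top[of 2]
      by eventually_elim (rule divide_right_mono[OF prime_count_ap_le], auto)
  qed simp
  then have "((\<lambda>t. real (prime_count_ap t q a) / t - inverse (real (totient q)) * (log_integral t / t))
      \<longlongrightarrow> 0 - inverse (real (totient q)) * 0) at_top"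
    by (rule tendsto_diff[OF _ tendsto_mult[OF tendsto_const log_integral_over_tendsto_0]])
  then show ?thesis by (simp add: prime_error_ap_def diff_divide_distrib)
qed

text \<open>
  Partial integration expresses the integral up to \<open>b\<close> by \<open>(\<Sum>p\<le>b. 1/p) - ln (ln b) / \<phi>(q)\<close>, which converges to
  \<open>M\<close>, and the boundary term \<open>E(b;q,a)/b\<close>, which tends to \<open>0\<close>.  The assumption is stated for integers \<open>N\<close>
  because Mertens' theorem is; replacing \<open>b\<close> by its integer part changes \<open>ln (ln b)\<close> by \<open>o(1)\<close>.
\<close>

theorem has_integral_prime_error_ap:
  assumes x: "x \<ge> 2" and q: "q > 0"
    and M: "(\<lambda>N. (\<Sum>p\<in>primes_upto_in_class (real N) q a. 1 / real p) - ln (ln (real N)) / real (totient q)) \<longlonglongrightarrow> M"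
  shows "((\<lambda>t. prime_error_ap t q a / t\<^sup>2) has_integral
    prime_error_ap x q a / x + M -
    ((\<Sum>p\<in>primes_upto_in_class x q a. 1 / real p) - ln (ln x) / real (totient q))) {x..}"
proof -
  define D where "D y = (\<Sum>p\<in>primes_upto_in_class y q a. 1 / real p) - ln (ln y) / real (totient q)" for y
  have "(D \<longlongrightarrow> M) at_top"
  proof -
    have floor: "filterlim (\<lambda>y::real. nat \<lfloor>y\<rfloor>) sequentially at_top"
      by (rule filterlim_compose[OF filterlim_nat_sequentially filterlim_floor_sequentially])
    have "((\<lambda>y::real. D (real (nat \<lfloor>y\<rfloor>))) \<longlongrightarrow> M) at_top"
      unfolding D_def by (rule filterlim_compose[OF M floor])
    moreover have "((\<lambda>y::real. (ln (ln (real_of_int \<lfloor>y\<rfloor>)) - ln (ln y)) / real (totient q)) \<longlongrightarrow> 0 / real (totient q)) at_top"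
      using q by (intro tendsto_divide tendsto_const) (real_asymp, simp)
    ultimately have "((\<lambda>y. D (real (nat \<lfloor>y\<rfloor>)) + (ln (ln (real_of_int \<lfloor>y\<rfloor>)) - ln (ln y)) / real (totient q)) \<longlongrightarrow> M + 0 / real (totient q)) at_top"
      by (rule tendsto_add)
    moreover have "\<forall>\<^sub>F y in at_top. D (real (nat \<lfloor>y\<rfloor>)) + (ln (ln (real_of_int \<lfloor>y\<rfloor>)) - ln (ln y)) / real (totient q) = D y"
      using eventually_ge_at_top[of 2]
    proof eventually_elim
      case (elim y)
      then have real_nat: "real (nat \<lfloor>y\<rfloor>) = real_of_int \<lfloor>y\<rfloor>" by simp
      have "real p \<le> real_of_int \<lfloor>y\<rfloor> \<longleftrightarrow> real p \<le> y" for p :: nat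
        by (metis le_floor_iff of_int_le_iff of_int_of_nat_eq)
      then have "primes_upto_in_class (real_of_int \<lfloor>y\<rfloor>) q a = primes_upto_in_class y q a"
        by (simp add: primes_upto_in_class_def)
      then show ?case unfolding real_nat D_def by (simp add: diff_divide_distrib)
    qed
    ultimately show ?thesis by (simp add: Lim_transform_eventually)
  qed
  then have J: "((\<lambda>b. prime_error_ap x q a / x - prime_error_ap b q a / b + (D b - D x)) \<longlongrightarrow>
      prime_error_ap x q a / x - 0 + (M - D x)) at_top"
    by (intro tendsto_add tendsto_diff tendsto_const prime_error_ap_over_tendsto_0)
  have "((\<lambda>t. prime_error_ap t q a / t\<^sup>2) has_integral
      prime_error_ap x q a / x - prime_error_ap b q a / b + (D b - D x)) {x..b}" if b: "b \<ge> x" for b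
  proof -
    let ?c = "inverse (real (totient q))"
    have "((\<lambda>t. real (prime_count_ap t q a) / t\<^sup>2 - ?c * (log_integral t / t\<^sup>2)) has_integral
        (real (prime_count_ap x q a) / x - real (prime_count_ap b q a) / b +
          ((\<Sum>p\<in>primes_upto_in_class b q a. 1 / real p) - (\<Sum>p\<in>primes_upto_in_class x q a. 1 / real p))) -
        ?c * (log_integral x / x - log_integral b / b + (ln (ln b) - ln (ln x)))) {x..b}"
      using x b by (intro has_integral_diff has_integral_mult_right has_integral_prime_count_ap
          has_integral_log_integral) auto
    moreover have "prime_error_ap t q a / t\<^sup>2 = real (prime_count_ap t q a) / t\<^sup>2 - ?c * (log_integral t / t\<^sup>2)" for t
      by (simp add: prime_error_ap_def diff_divide_distrib)
    moreover have "(real (prime_count_ap x q a) / x - real (prime_count_ap b q a) / b +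
          ((\<Sum>p\<in>primes_upto_in_class b q a. 1 / real p) - (\<Sum>p\<in>primes_upto_in_class x q a. 1 / real p))) -
        ?c * (log_integral x / x - log_integral b / b + (ln (ln b) - ln (ln x))) =
        prime_error_ap x q a / x - prime_error_ap b q a / b + (D b - D x)"
      by (simp add: prime_error_ap_def D_def diff_divide_distrib divide_inverse algebra_simps)
    ultimately show ?thesis by (simp only:)
  qed
  from has_integral_atLeastI[OF this J] show ?thesis
    by (simp only: D_def diff_0_right add_diff_eq)
qed

section \<open>The tail of the sum over primes\<close>

text \<open>
  Cutting the weights off at \<open>x\<close> keeps them decreasing, so that \<open>weighted_sum_mono\<close> applies from the start
  of the sum although only the terms with \<open>n > x\<close> are of interest.
\<close>

lemma sum_inverse_square_max_le:
  fixes x :: real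
  assumes x: "x \<ge> 1"
  shows "(\<Sum>n<N. 1 / (max x (real (Suc n)))\<^sup>2) \<le> 3 / x"
proof -
  let ?T = "\<lambda>N. (\<Sum>n<N. 1 / (max x (real (Suc n)))\<^sup>2)"
  have "?T N \<le> (if real N \<le> x then real N / x\<^sup>2 else 3 / x - 1 / real N)"
  proof (induction N)
    case (Suc N)
    consider "real (Suc N) \<le> x" | "real N \<le> x" "x < real (Suc N)" | "x < real N" by linarith
    then show ?case
    proof cases
      case 1
      then have "max x (real (Suc N)) = x" "real N \<le> x" by auto
      then show ?thesis using Suc.IH 1 by (simp add: add_divide_distrib)
    next
      case 2
      have "real N / x\<^sup>2 \<le> x / x\<^sup>2" using 2 by (intro divide_right_mono) auto
      also have "\<dots> = 1 / x" using x by (simp add: power2_eq_square)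
      finally have "real N / x\<^sup>2 \<le> 1 / x" .
      moreover have "1 / (real (Suc N))\<^sup>2 \<le> 1 / real (Suc N)"
        by (simp add: power2_eq_square divide_simps del: of_nat_Suc)
      moreover have "1 / real (Suc N) \<le> 1 / x" using 2 x by (intro divide_left_mono) auto
      ultimately have "?T N + 1 / (real (Suc N))\<^sup>2 \<le> 3 / x - 1 / real (Suc N)"
        using Suc.IH 2 by simp
      then show ?thesis using 2 by (simp add: max_def)
    next
      case 3
      then have N: "real N > 0" using x by linarith
      have "1 / (real (Suc N))\<^sup>2 \<le> 1 / (real N * real (Suc N))"
        using N by (intro divide_left_mono) (auto simp: power2_eq_square)
      also have "\<dots> = 1 / real N - 1 / real (Suc N)" using N by (simp add: field_simps)
      finally have "?T N + 1 / (real (Suc N))\<^sup>2 \<le> 3 / x - 1 / real (Suc N)"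
        using Suc.IH 3 by simp
      then show ?thesis using 3 by (simp add: max_def)
    qed
  qed (use x in simp)
  also have "\<dots> \<le> 3 / x"
  proof (cases "real N \<le> x")
    case True
    then have "real N / x\<^sup>2 \<le> x / x\<^sup>2" by (intro divide_right_mono) auto
    also have "\<dots> = 1 / x" using x by (simp add: power2_eq_square)
    also have "\<dots> \<le> 3 / x" using x by (intro divide_right_mono) auto
    finally show ?thesis using True by simp
  qed simp
  finally show ?thesis .
qed

lemma sum_mangoldt_tail_le:
  assumes x: "x \<ge> 1"
  shows "(\<Sum>n=1..N. if x < real n then mangoldt n / real n ^ 2 else 0) \<le> 12 * ln 2 / x"
proof -
  define w where "w n = 1 / (max x (real (Suc n)))\<^sup>2" for n
  have "decseq w"
    unfolding decseq_def w_def using x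
    by (auto intro!: divide_left_mono power_mono mult_pos_pos zero_less_power)
  have "(\<Sum>n=1..N. if x < real n then mangoldt n / real n ^ 2 else 0) =
      (\<Sum>n<N. if x < real (Suc n) then mangoldt (Suc n) / real (Suc n) ^ 2 else 0)"
    by (rule sum_Suc_conv[symmetric])
  also have "\<dots> \<le> (\<Sum>n<N. w n * mangoldt (Suc n))"
    by (intro sum_mono) (auto simp: w_def max_def mangoldt_nonneg simp del: of_nat_Suc)
  also have "\<dots> \<le> (\<Sum>n<N. w n * (4 * ln 2))"
  proof (rule weighted_sum_mono[OF \<open>decseq w\<close>])
    show "(\<Sum>k<n. mangoldt (Suc k)) \<le> (\<Sum>k<n. 4 * ln 2 :: real)" for n
      unfolding sum_Suc_conv[of mangoldt] using chebyshev_psi_le[of n] by (simp add: mult_ac)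
  qed (simp add: w_def)
  also have "\<dots> = 4 * ln 2 * (\<Sum>n<N. w n)" by (simp add: sum_distrib_right[symmetric])
  also have "\<dots> \<le> 4 * ln 2 * (3 / x)"
    unfolding w_def by (intro mult_left_mono sum_inverse_square_max_le x) auto
  finally show ?thesis by simp
qed

text \<open>
  This is the whole error term of the theorem.  For \<open>p > x\<close> the weight \<open>1/p\<^sup>2\<close> is at most \<open>\<Lambda>(p)/(p\<^sup>2 ln x)\<close>, and
  Chebyshev's bound sums this to \<open>O(1/(x ln x))\<close>, uniformly in \<open>q\<close> and \<open>a\<close>.
\<close>

lemma ln_remainder_tail_le:
  assumes x: "x \<ge> 2"
  shows "\<bar>(\<Sum>\<^sub>\<infinity>p\<in>{p. prime p \<and> [p = a] (mod q)}. ln_remainder p) -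
      (\<Sum>p\<in>primes_upto_in_class x q a. ln_remainder p)\<bar> \<le> 24 * ln 2 / (x * ln x)"
proof -
  let ?A = "{p. prime p \<and> [p = a] (mod q)}" and ?P = "primes_upto_in_class x q a"
  have lnx: "ln x > 0" using x by simp
  have summable: "ln_remainder summable_on B" if "B \<subseteq> {p. prime p}" for B
    by (rule summable_on_subset[OF summable_ln_remainder that])
  have "?A = ?P \<union> (?A - ?P)" by (auto simp: primes_upto_in_class_def)
  then have "infsum ln_remainder ?A = infsum ln_remainder (?P \<union> (?A - ?P))" by simp
  also have "\<dots> = infsum ln_remainder ?P + infsum ln_remainder (?A - ?P)"
    by (intro infsum_Un_disjoint summable) (auto simp: primes_upto_in_class_def)
  also have "infsum ln_remainder ?P = (\<Sum>p\<in>?P. ln_remainder p)"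
    by (simp add: finite_primes_upto_in_class)
  finally have diff: "infsum ln_remainder ?A - (\<Sum>p\<in>?P. ln_remainder p) = infsum ln_remainder (?A - ?P)" by simp
  have nonneg: "infsum ln_remainder (?A - ?P) \<ge> 0" by (rule infsum_nonneg) (auto intro: ln_remainder_nonneg)
  have "infsum ln_remainder (?A - ?P) \<le> 24 * ln 2 / (x * ln x)"
  proof (rule infsum_le_finite_sums)
    show "ln_remainder summable_on (?A - ?P)" by (rule summable) auto
    fix F assume F: "finite F" "F \<subseteq> ?A - ?P"
    then have F': "prime p" "x < real p" if "p \<in> F" for p using that by (auto simp: primes_upto_in_class_def)
    have "sum ln_remainder F \<le> (\<Sum>p\<in>F. 2 / ln x * (if x < real p then mangoldt p / real p ^ 2 else 0))"
    proof (rule sum_mono)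
      fix p assume p: "p \<in> F"
      have "ln x \<le> mangoldt p" using F'[OF p] x by simp
      then have "1 \<le> mangoldt p / ln x" using lnx by simp
      then have "2 / real p ^ 2 * 1 \<le> 2 / real p ^ 2 * (mangoldt p / ln x)" by (rule mult_left_mono) simp
      then have "2 / real p ^ 2 \<le> 2 / ln x * (mangoldt p / real p ^ 2)" by (simp add: mult.commute)
      then show "ln_remainder p \<le> 2 / ln x * (if x < real p then mangoldt p / real p ^ 2 else 0)"
        using ln_remainder_le[OF F'(1)[OF p]] F'(2)[OF p] by simp
    qed
    also have "\<dots> = 2 / ln x * (\<Sum>p\<in>F. if x < real p then mangoldt p / real p ^ 2 else 0)"
      by (simp add: sum_distrib_left)
    also have "\<dots> \<le> 2 / ln x * (\<Sum>n=1..Max (insert 0 F). if x < real n then mangoldt n / real n ^ 2 else 0)"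
    proof (intro mult_left_mono sum_mono2)
      show "F \<subseteq> {1..Max (insert 0 F)}"
        using F(1) F'(1) prime_ge_1_nat by auto
    qed (use lnx mangoldt_nonneg in auto)
    also have "\<dots> \<le> 2 / ln x * (12 * ln 2 / x)"
      using lnx x by (intro mult_left_mono sum_mangoldt_tail_le) auto
    also have "\<dots> = 24 * ln 2 / (x * ln x)" by (simp add: mult.commute)
    finally show "sum ln_remainder F \<le> 24 * ln 2 / (x * ln x)" .
  qed
  then show ?thesis using diff nonneg by simp
qed

section \<open>The Mertens product in arithmetic progressions\<close>

theorem proposition3p2:
  shows "\<exists>C::real. \<forall>x::real. \<forall>q a::nat.
    x \<ge> 2 \<longrightarrow> q > 0 \<longrightarrow> a > 0 \<longrightarrow> coprime q a \<longrightarrow>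
      (\<lambda>t. prime_error_ap t q a / t ^ 2) integrable_on {x..} \<and>
      \<bar>(\<Sum>p | prime p \<and> real p \<le> x \<and> [p = a] (mod q). ln (inverse (1 - 1 / real p)))
        - (inverse (real (totient q)) * (euler_mascheroni + ln (ln x))
           + ln (mertens_G q a)
           + prime_error_ap x q a / x
           - integral {x..} (\<lambda>t. prime_error_ap t q a / t ^ 2))\<bar>
      \<le> C * inverse (x * ln x)"
proof (intro exI[of _ "24 * ln 2"] allI impI)
  fix x :: real and q a :: nat
  assume x: "x \<ge> 2" and q: "q > 0" and "coprime q a"
  then have a: "coprime a q" by (simp add: coprime_commute)
  let ?P = "primes_upto_in_class x q a"
  define R where "R = (\<Sum>\<^sub>\<infinity>p\<in>{p. prime p \<and> [p = a] (mod q)}. ln_remainder p)"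
  define M where "M = euler_mascheroni / real (totient q) + ln (mertens_G q a) - R"
  have int: "((\<lambda>t. prime_error_ap t q a / t ^ 2) has_integral prime_error_ap x q a / x + M -
      ((\<Sum>p\<in>?P. 1 / real p) - ln (ln x) / real (totient q))) {x..}"
    unfolding M_def R_def
    by (rule has_integral_prime_error_ap[OF x q mertens_sum_primes_residue_class[OF q a]])
  have eq: "(\<Sum>p | prime p \<and> real p \<le> x \<and> [p = a] (mod q). ln (inverse (1 - 1 / real p))) =
      (\<Sum>p\<in>?P. 1 / real p + ln_remainder p)"
  proof (rule sum.cong)
    fix p assume "p \<in> ?P"
    then have "real p > 1" using prime_gt_1_nat by (auto simp: primes_upto_in_class_def)
    then show "ln (inverse (1 - 1 / real p)) = 1 / real p + ln_remainder p"
      by (simp add: ln_remainder_def ln_inverse)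
  qed (simp add: primes_upto_in_class_def)
  have "(\<Sum>p | prime p \<and> real p \<le> x \<and> [p = a] (mod q). ln (inverse (1 - 1 / real p))) -
      (inverse (real (totient q)) * (euler_mascheroni + ln (ln x)) + ln (mertens_G q a)
        + prime_error_ap x q a / x - integral {x..} (\<lambda>t. prime_error_ap t q a / t ^ 2)) =
      - (R - (\<Sum>p\<in>?P. ln_remainder p))"
    unfolding eq integral_unique[OF int] M_def sum.distrib
    by (simp add: divide_inverse algebra_simps)
  moreover have "(\<lambda>t. prime_error_ap t q a / t ^ 2) integrable_on {x..}"
    using int by (rule has_integral_integrable)
  moreover have "\<bar>- (R - (\<Sum>p\<in>?P. ln_remainder p))\<bar> \<le> 24 * ln 2 * inverse (x * ln x)"
    using ln_remainder_tail_le[OF x, of a q] by (simp add: R_def divide_inverse)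
  ultimately show "(\<lambda>t. prime_error_ap t q a / t ^ 2) integrable_on {x..} \<and>
      \<bar>(\<Sum>p | prime p \<and> real p \<le> x \<and> [p = a] (mod q). ln (inverse (1 - 1 / real p)))
        - (inverse (real (totient q)) * (euler_mascheroni + ln (ln x))
           + ln (mertens_G q a)
           + prime_error_ap x q a / x
           - integral {x..} (\<lambda>t. prime_error_ap t q a / t ^ 2))\<bar>
      \<le> 24 * ln 2 * inverse (x * ln x)"
    by (simp only: simp_thms)
qed

end
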